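(* Let $p\ge 1$ and $N\in\mathbb{N}$. Assume the following, for all $x,y\in\mathbb{R}^d$ and $\mu,\nu\in\mathscr{P}_2(\mathbb{R}^d)$. (i) There are constants $L_b^1,\alpha_1>0$ with $\langle x-y,b(x,\mu)-b(y,\mu)\rangle\le L_b^1|x-y|^2$, $\ |b(x,\mu)-b(y,\mu)|\le L_b^1(1+|x|^{\alpha_1}+|y|^{\alpha_1})|x-y|$, and $|b(x,\mu)-b(x,\nu)|\le L_b^1\mathbb{W}_2(\mu,\nu)$. (ii) There is a constant $L_b^4>0$ with $|b(0,\mu)|\le L_b^4$. (iii) There is a constant $L_\sigma^1>0$ with $\|\sigma(x,\mu)-\sigma(y,\nu)\|\le L_\sigma^1(|x-y|+\mathbb{W}_2(\mu,\nu))$. (iv) Each component $\sigma_{kl}$ of $\sigma$ ($1\le k\le d$, $1\le l\le m$) belongs to $C^{2,(2,1)}(\mathbb{R}^d\times\mathscr{P}_2(\mathbb{R}^d))$, and there is a constant $L_\sigma^2>0$ such that for all such $k,l$: $\|D^L\sigma_{kl}(x,\mu)(y)\|\vee\|\nabla\{D^L\sigma_{kl}(x,\mu)(\cdot)\}(y)\|\vee\|(D^L)^2\sigma_{kl}(x,\mu)(y,y)\|\le L_\sigma^2$. (v) There is a constant $L_\sigma^4>0$ with $\|\sigma(0,\mu)\|+\|D^L\sigma(x,\mu)(y)\,\sigma(y,\mu)\|\le L_\sigma^4$. For $M\in\mathbb{N}$ and $\delta=T/M$, let $Y^{i,N}_{t_n}$, $i\in\mathbb{S}_N$, $n\in\{0,\dots,M\}$,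 be the tamed Milstein scheme defined in the context, with $b_\delta(x,\mu)=\dfrac{b(x,\mu)}{1+\delta|b(x,\mu)|}$. Then there exists a constant $C>0$ independent of $M$ (respectively, of $\delta$) such that $$\sup_{i\in\mathbb{S}_N}\ \sup_{n\in\{0,\dots,M\}}\mathbb{E}|Y^{i,N}_{t_n}|^p\le C.$$
   Context: **Basic notation.** $T>0$ is fixed, $d,m\in\mathbb{N}$, $\mathbb{S}_N=\{1,\dots,N\}$. For $M\in\mathbb{N}$ put $\delta=T/M$ and $t_n=n\delta$. $\mathscr{P}_2(\mathbb{R}^d)$ is the set of Borel probability measures on $\mathbb{R}^d$ with finite second moment, and $\mathbb{W}_2(\mu,\nu)=\inf_\pi(\int|x-y|^2\pi(dx,dy))^{1/2}$ (infimum over couplings of $\mu,\nu$) is the 2-Wasserstein distance on it. $|\cdot|$ is the Euclidean norm and $\|\cdot\|$ the Hilbert–Schmidt norm of matrices, linear and bilinear operators. $b:\mathbb{R}^d\times\mathscr{P}_2(\mathbb{R}^d)\to\mathbb{R}^d$ and $\sigma:\mathbb{R}^d\times\mathscr{P}_2(\mathbb{R}^d)\to\mathbb{R}^{d\times m}$ are measurable. **Noise and initial data.** On a filtered, atomless probability space satisfying the usual conditions, $W$ is an $m$-dimensional Brownian motion and $X_0$ an $\mathbb{R}^d$-valued $\mathcal{F}_0$-measurable random variable, independent of $W$, with $\mathbb{E}|X_0|^q<\infty$ for all $q\ge1$ (standing assumption). $(W^i,X_0^i)$, $i\in\mathbb{S}_N$, are independent copies of $(W,X_0)$. **Lions derivative.**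 $f:\mathscr{P}_2(\mathbb{R}^d)\to\mathbb{R}$ is $L$-differentiable at $\mu_0$ if, for some random variable $X_0\in L_2(\Omega;\mathbb{R}^d)$ (generic notation) with law $\mu_0$, the lift $\tilde f(X)=f(\mathscr{L}_X)$ on $L_2(\Omega;\mathbb{R}^d)$ is Fréchet differentiable at $X_0$ ($\mathscr{L}_X$ is the law of $X$). The Fréchet derivative is then represented by $\xi(X_0)$ for a Borel function $\xi:\mathbb{R}^d\to\mathbb{R}^d$, and $D^Lf(\mu_0)(y):=\xi(y)$. The second-order derivative is $(D^L)^2f(\mu)(y,y')=(D^L((D^Lf)_j(\cdot)(y))(\mu,y'))_{j=1,\dots,d}$. For $f(x,\mu)$, $D^L$ acts on $\mu$ and $\nabla$ is the gradient in the state variable $x$; $\nabla\{D^Lf(x,\mu)(\cdot)\}(y)$ is the gradient in $y$. Vector- and matrix-valued functions are treated componentwise. $\nabla\sigma(x,\mu)$ and $D^L\sigma(x,\mu)(y)$ are viewed as linear operators from $\mathbb{R}^d$ to $\mathbb{R}^{d\times m}$; products such as $\nabla\sigma\,\sigma\,w$ ($w\in\mathbb{R}^m$) mean this operator applied to the vector $\sigma w$. **Class $C^{2,(2,1)}(\mathbb{R}^d\times\mathscr{P}_2(\mathbb{R}^d))$.** Functions $f:\mathbb{R}^d\times\mathscr{P}_2(\mathbb{R}^d)\to\mathbb{R}$ such that $f(\cdot,\mu)$ is twice continuously differentiable for every $\mu$, and $D^Lf(x,\mu)(y)$, $\nabla\{D^Lf(x,\mu)(\cdot)\}(y)$ and $(D^L)^2f(x,\mu)(y,y')$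 exist (for suitable versions) and are jointly continuous in all their variables, globally. **Scheme.** With $\mu^{Y^{\cdot,N}}_{t_n}=\frac1N\sum_{j=1}^N\delta_{Y^{j,N}_{t_n}}$ ($\delta_x$ the Dirac measure), $\Delta W^i_n=W^i_{t_{n+1}}-W^i_{t_n}$, and $Y_0^{i,N}=X_0^i$, for $n=0,\dots,M-1$: $$Y^{i,N}_{t_{n+1}}=Y^{i,N}_{t_n}+b_\delta(Y^{i,N}_{t_n},\mu^{Y^{\cdot,N}}_{t_n})\delta+\sigma(Y^{i,N}_{t_n},\mu^{Y^{\cdot,N}}_{t_n})\Delta W^i_n+\int_{t_n}^{t_{n+1}}\nabla\sigma(Y^{i,N}_{t_n},\mu^{Y^{\cdot,N}}_{t_n})\sigma(Y^{i,N}_{t_n},\mu^{Y^{\cdot,N}}_{t_n})\int_{t_n}^s dW^i_u\,dW^i_s$$ $$+\int_{t_n}^{t_{n+1}}\frac1N\sum_{j=1}^N D^L\sigma(Y^{i,N}_{t_n},\mu^{Y^{\cdot,N}}_{t_n})(Y^{j,N}_{t_n})\,\sigma(Y^{j,N}_{t_n},\mu^{Y^{\cdot,N}}_{t_n})\int_{t_n}^s dW^j_u\,dW^i_s .$$ *)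

theory Defs
  imports "HOL-Probability.Probability"
begin

section \<open>The Wasserstein space\<close>

definition P2 :: "'a::euclidean_space measure set" where
  "P2 = {\<mu>. prob_space \<mu> \<and> sets \<mu> = sets borel \<and> integrable \<mu> (\<lambda>x. (norm x)\<^sup>2)}"

definition couplings ::
    "'a::euclidean_space measure \<Rightarrow> 'a measure \<Rightarrow> ('a \<times> 'a) measure set" where
  "couplings \<mu> \<nu> = {\<pi>. sets \<pi> = sets (borel \<Otimes>\<^sub>M borel) \<and> distr \<pi> borel fst = \<mu> \<and> distr \<pi> borel snd = \<nu>}"

text \<open>Only used for arguments in \<^const>\<open>P2\<close>: there the cost is integrable for every coupling, and the
  product measure is a coupling.\<close>

definition W2 :: "'a::euclidean_space measure \<Rightarrow> 'a measure \<Rightarrow> real" where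
  "W2 \<mu> \<nu> = (INF \<pi>\<in>couplings \<mu> \<nu>. sqrt (\<integral>z. (norm (fst z - snd z))\<^sup>2 \<partial>\<pi>))"

definition P2_topology :: "'a::euclidean_space measure topology" where
  "P2_topology = topology (\<lambda>U. U \<subseteq> P2 \<and> (\<forall>\<mu>\<in>U. \<exists>r>0. \<forall>\<nu>\<in>P2. W2 \<mu> \<nu> < r \<longrightarrow> \<nu> \<in> U))"

lemma openin_P2_topology:
  "openin P2_topology U \<longleftrightarrow> U \<subseteq> P2 \<and> (\<forall>\<mu>\<in>U. \<exists>r>0. \<forall>\<nu>\<in>P2. W2 \<mu> \<nu> < r \<longrightarrow> \<nu> \<in> U)"
proof -
  let ?O = "\<lambda>U::'a measure set. U \<subseteq> P2 \<and> (\<forall>\<mu>\<in>U. \<exists>r>0. \<forall>\<nu>\<in>P2. W2 \<mu> \<nu> < r \<longrightarrow> \<nu> \<in> U)"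
  have inter: "?O (S \<inter> V)" if S: "?O S" and V: "?O V" for S V
  proof (intro conjI ballI)
    show "S \<inter> V \<subseteq> P2" using S by blast
    fix \<mu> assume "\<mu> \<in> S \<inter> V"
    then obtain r s where "r > 0" "\<forall>\<nu>\<in>P2. W2 \<mu> \<nu> < r \<longrightarrow> \<nu> \<in> S" "s > 0" "\<forall>\<nu>\<in>P2. W2 \<mu> \<nu> < s \<longrightarrow> \<nu> \<in> V"
      using S V by blast
    then show "\<exists>r>0. \<forall>\<nu>\<in>P2. W2 \<mu> \<nu> < r \<longrightarrow> \<nu> \<in> S \<inter> V"
      by (intro exI[of _ "min r s"]) auto
  qed
  have union: "?O (\<Union>K)" if K: "\<And>V. V \<in> K \<Longrightarrow> ?O V" for K
  proof (intro conjI ballI)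
    show "\<Union>K \<subseteq> P2" using K by blast
    fix \<mu> assume "\<mu> \<in> \<Union>K"
    then obtain V where V: "V \<in> K" "\<mu> \<in> V" by blast
    then obtain r where "r > 0" "\<forall>\<nu>\<in>P2. W2 \<mu> \<nu> < r \<longrightarrow> \<nu> \<in> V" using K by blast
    then show "\<exists>r>0. \<forall>\<nu>\<in>P2. W2 \<mu> \<nu> < r \<longrightarrow> \<nu> \<in> \<Union>K" using V by blast
  qed
  have "istopology ?O"
    unfolding istopology_def
    apply (rule conjI)
     apply (intro allI impI, rule inter, assumption+)
    apply (intro allI impI, rule union, erule bspec, assumption)
    done
  then show ?thesis
    by (simp add: P2_topology_def)
qed

lemma topspace_P2_topology [simp]: "topspace P2_topology = P2"
proof
  show "topspace P2_topology \<subseteq> (P2 :: 'a measure set)"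
    using openin_topspace[of "P2_topology :: 'a measure topology"] unfolding openin_P2_topology by blast
  have "openin P2_topology (P2 :: 'a measure set)"
    by (auto simp: openin_P2_topology intro: exI[of _ "1::real"])
  then show "(P2 :: 'a measure set) \<subseteq> topspace P2_topology"
    by (rule openin_subset)
qed

definition P2_borel :: "'a::euclidean_space measure measure" where
  "P2_borel = sigma P2 {U. openin P2_topology U}"

definition empirical :: "nat \<Rightarrow> (nat \<Rightarrow> 'a::euclidean_space) \<Rightarrow> 'a measure" where
  "empirical N y = distr (uniform_count_measure {1..N}) borel y"

lemma emeasure_empirical:
  fixes y :: "nat \<Rightarrow> 'a::euclidean_space"
  assumes "A \<in> sets borel" "N \<ge> 1"
  shows "emeasure (empirical N y) A = ennreal (1 / real N) * (\<Sum>j\<in>{1..N}. emeasure (return borel (y j)) A)"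
proof -
  have m: "y \<in> measurable (uniform_count_measure {1..N}) borel"
    by (auto simp: measurable_def space_uniform_count_measure sets_uniform_count_measure)
  have e: "y -` A \<inter> {1..N} = {j\<in>{1..N}. y j \<in> A}" by auto
  have "emeasure (empirical N y) A = emeasure (uniform_count_measure {1..N}) {j\<in>{1..N}. y j \<in> A}"
    unfolding empirical_def emeasure_distr[OF m assms(1)] space_uniform_count_measure e ..
  also have "\<dots> = ennreal (real (card {j\<in>{1..N}. y j \<in> A}) / real N)"
    by (subst emeasure_uniform_count_measure) auto
  finally have "emeasure (empirical N y) A = ennreal (real (card {j\<in>{1..N}. y j \<in> A}) / real N)" .
  moreover have "(\<Sum>j\<in>{1..N}. emeasure (return borel (y j)) A) = ennreal (real (card {j\<in>{1..N}. y j \<in> A}))"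
  proof -
    have "(\<Sum>j\<in>{1..N}. emeasure (return borel (y j)) A) = (\<Sum>j\<in>{1..N}. ennreal (indicator A (y j)))"
      using assms by (intro sum.cong) (auto simp: indicator_def)
    also have "\<dots> = ennreal (\<Sum>j\<in>{1..N}. indicator A (y j))"
      by (intro sum_ennreal) simp
    also have "(\<Sum>j\<in>{1..N}. indicator A (y j) :: real) = real (card {j\<in>{1..N}. y j \<in> A})"
      by (simp add: indicator_def sum.If_cases Int_def)
    finally show ?thesis .
  qed
  ultimately show ?thesis
    by (simp add: ennreal_mult[symmetric])
qed

section \<open>Lions derivatives\<close>

definition atomless :: "'w measure \<Rightarrow> bool" where
  "atomless P \<longleftrightarrow> (\<forall>A\<in>sets P. emeasure P A > 0 \<longrightarrow>
     (\<exists>B\<in>sets P. B \<subseteq> A \<and> 0 < emeasure P B \<and> emeasure P B < emeasure P A))"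

definition L2_vars :: "'w measure \<Rightarrow> ('w \<Rightarrow> 'a::euclidean_space) set" where
  "L2_vars P = {X. X \<in> borel_measurable P \<and> integrable P (\<lambda>\<omega>. (norm (X \<omega>))\<^sup>2)}"

definition L2_norm :: "'w measure \<Rightarrow> ('w \<Rightarrow> 'a::euclidean_space) \<Rightarrow> real" where
  "L2_norm P X = sqrt (\<integral>\<omega>. (norm (X \<omega>))\<^sup>2 \<partial>P)"

definition lift :: "'w measure \<Rightarrow> ('a::euclidean_space measure \<Rightarrow> real) \<Rightarrow> ('w \<Rightarrow> 'a) \<Rightarrow> real" where
  "lift P f X = f (distr P borel X)"

text \<open>The lift of \<open>f\<close> is Frechet differentiable at some \<open>X\<close> of law \<open>\<mu>\<close>, and its derivative
  is the bounded linear functional represented by \<open>\<xi>(X)\<close>. The function \<open>\<xi>\<close> is only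
  determined \<open>\<mu>\<close>-almost everywhere.\<close>

definition has_L_derivative ::
    "'w measure \<Rightarrow> ('a::euclidean_space measure \<Rightarrow> real) \<Rightarrow> 'a measure \<Rightarrow> ('a \<Rightarrow> 'a) \<Rightarrow> bool" where
  "has_L_derivative P f \<mu> \<xi> \<longleftrightarrow> \<xi> \<in> borel_measurable borel \<and>
     (\<exists>X\<in>L2_vars P. distr P borel X = \<mu> \<and> (\<lambda>\<omega>. \<xi> (X \<omega>)) \<in> L2_vars P \<and>
       (\<forall>\<epsilon>>0. \<exists>r>0. \<forall>H\<in>L2_vars P. L2_norm P H < r \<longrightarrow>
          \<bar>lift P f (\<lambda>\<omega>. X \<omega> + H \<omega>) - lift P f X - (\<integral>\<omega>. \<xi> (X \<omega>) \<bullet> H \<omega> \<partial>P)\<bar> \<le> \<epsilon> * L2_norm P H))"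

definition jointly_continuous ::
    "('p::topological_space \<Rightarrow> 'a::euclidean_space measure \<Rightarrow> 'a \<Rightarrow> 'b::topological_space) \<Rightarrow> bool" where
  "jointly_continuous g \<longleftrightarrow>
     continuous_map (prod_topology euclidean (prod_topology P2_topology euclidean)) euclidean
       (\<lambda>(x, \<mu>, y). g x \<mu> y)"

text \<open>\<open>D\<close> is a jointly continuous version of the L-derivative of a family of functions of measures
  that depends on a parameter \<open>x\<close>. Such a version is unique on \<^const>\<open>P2\<close>, because the
  measures of full support are dense.\<close>

definition cont_L_derivative ::
    "'w measure \<Rightarrow> ('p::topological_space \<Rightarrow> 'a::euclidean_space measure \<Rightarrow> real)
      \<Rightarrow> ('p \<Rightarrow> 'a measure \<Rightarrow> 'a \<Rightarrow> 'a) \<Rightarrow> bool" where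
  "cont_L_derivative P f D \<longleftrightarrow>
     (\<forall>x. \<forall>\<mu>\<in>P2. has_L_derivative P (f x) \<mu> (D x \<mu>)) \<and> jointly_continuous D"

definition DL ::
    "'w measure \<Rightarrow> ('p::topological_space \<Rightarrow> 'a::euclidean_space measure \<Rightarrow> real)
      \<Rightarrow> 'p \<Rightarrow> 'a measure \<Rightarrow> 'a \<Rightarrow> 'a" where
  "DL P f = (SOME D. cont_L_derivative P f D)"

text \<open>Second-order derivative: the point \<open>y\<close> is treated as a further parameter. Row \<open>j\<close> is
  the L-derivative of the \<open>j\<close>-th component of the first-order one.\<close>

definition DL2 ::
    "'w measure \<Rightarrow> (real^'d \<Rightarrow> (real^'d) measure \<Rightarrow> real)
      \<Rightarrow> real^'d \<Rightarrow> (real^'d) measure \<Rightarrow> real^'d \<Rightarrow> real^'d \<Rightarrow> real^'d^'d" where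
  "DL2 P f x \<mu> y y' = (\<chi> j. DL P (\<lambda>(x, y) \<mu>. DL P f x \<mu> y $ j) (x, y) \<mu> y')"

definition twice_cont_differentiable :: "(real^'d \<Rightarrow> real) \<Rightarrow> bool" where
  "twice_cont_differentiable f \<longleftrightarrow>
     (\<exists>(g :: real^'d \<Rightarrow> real^'d) (h :: real^'d \<Rightarrow> real^'d^'d).
        (\<forall>x. (f has_derivative (\<lambda>v. g x \<bullet> v)) (at x)) \<and>
        (\<forall>x. (g has_derivative (\<lambda>v. h x *v v)) (at x)) \<and>
        continuous_on UNIV h)"

definition C2_21 :: "'w measure \<Rightarrow> (real^'d \<Rightarrow> (real^'d) measure \<Rightarrow> real) set" where
  "C2_21 P = {f.
     (\<forall>\<mu>\<in>P2. twice_cont_differentiable (\<lambda>x. f x \<mu>)) \<and>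
     (\<exists>D. cont_L_derivative P f D) \<and>
     (\<forall>x. \<forall>\<mu>\<in>P2. \<forall>y. DL P f x \<mu> differentiable (at y)) \<and>
     jointly_continuous (\<lambda>x \<mu> y. jacobian (DL P f x \<mu>) (at y)) \<and>
     (\<forall>j. \<exists>D. cont_L_derivative P (\<lambda>(x, y) \<mu>. DL P f x \<mu> y $ j) D)}"

section \<open>Derivatives of the diffusion coefficient as operators\<close>

text \<open>Matrices have type \<open>real^'m^'d\<close> (\<open>d\<close> rows, \<open>m\<close> columns); their \<^const>\<open>norm\<close> is the
  Hilbert--Schmidt norm.\<close>

definition grad_op ::
    "(real^'d \<Rightarrow> (real^'d) measure \<Rightarrow> real^'m^'d) \<Rightarrow> real^'d \<Rightarrow> (real^'d) measure \<Rightarrow> real^'d \<Rightarrow> real^'m^'d" where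
  "grad_op \<sigma> x \<mu> = frechet_derivative (\<lambda>z. \<sigma> z \<mu>) (at x)"

definition DL_op ::
    "'w measure \<Rightarrow> (real^'d \<Rightarrow> (real^'d) measure \<Rightarrow> real^'m^'d)
      \<Rightarrow> real^'d \<Rightarrow> (real^'d) measure \<Rightarrow> real^'d \<Rightarrow> real^'d \<Rightarrow> real^'m^'d" where
  "DL_op P \<sigma> x \<mu> y v = (\<chi> k l. DL P (\<lambda>x \<mu>. \<sigma> x \<mu> $ k $ l) x \<mu> y \<bullet> v)"

definition hs_norm :: "('a::euclidean_space \<Rightarrow> 'b::real_normed_vector) \<Rightarrow> real" where
  "hs_norm A = sqrt (\<Sum>e\<in>Basis. (norm (A e))\<^sup>2)"

section \<open>Brownian motion and the Ito integral on \<open>[0, T]\<close>\<close>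

definition filtration_on :: "real \<Rightarrow> 'w measure \<Rightarrow> (real \<Rightarrow> 'w measure) \<Rightarrow> bool" where
  "filtration_on T P F \<longleftrightarrow>
     (\<forall>t\<in>{0..T}. subalgebra P (F t)) \<and> (\<forall>s t. 0 \<le> s \<and> s \<le> t \<and> t \<le> T \<longrightarrow> subalgebra (F t) (F s))"

definition usual_conditions :: "real \<Rightarrow> 'w measure \<Rightarrow> (real \<Rightarrow> 'w measure) \<Rightarrow> bool" where
  "usual_conditions T P F \<longleftrightarrow>
     complete_measure P \<and> null_sets P \<subseteq> sets (F 0) \<and>
     (\<forall>t\<in>{0..<T}. sets (F t) = (\<Inter>s\<in>{t<..T}. sets (F s)))"

definition brownian_motion ::
    "real \<Rightarrow> 'w measure \<Rightarrow> (real \<Rightarrow> 'w measure) \<Rightarrow> (real \<Rightarrow> 'w \<Rightarrow> real^'m) \<Rightarrow> bool" where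
  "brownian_motion T P F W \<longleftrightarrow>
     (\<forall>t\<in>{0..T}. W t \<in> borel_measurable (F t)) \<and>
     (AE \<omega> in P. W 0 \<omega> = 0) \<and>
     (\<forall>\<omega>\<in>space P. continuous_on {0..T} (\<lambda>t. W t \<omega>)) \<and>
     (\<forall>s t. 0 \<le> s \<and> s < t \<and> t \<le> T \<longrightarrow>
        prob_space.indep_set P (sets (F s))
          {(\<lambda>\<omega>. W t \<omega> - W s \<omega>) -` A \<inter> space P | A. A \<in> sets borel} \<and>
        prob_space.indep_vars P (\<lambda>_. borel) (\<lambda>k \<omega>. W t \<omega> $ k - W s \<omega> $ k) UNIV \<and>
        (\<forall>k. distributed P lborel (\<lambda>\<omega>. W t \<omega> $ k - W s \<omega> $ k) (normal_density 0 (sqrt (t - s)))))"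

definition sample_path :: "real \<Rightarrow> (real \<Rightarrow> 'w \<Rightarrow> 'a) \<Rightarrow> 'w \<Rightarrow> real \<Rightarrow> 'a" where
  "sample_path T W \<omega> = (\<lambda>t\<in>{0..T}. W t \<omega>)"

abbreviation path_space :: "real \<Rightarrow> (real \<Rightarrow> 'a::topological_space) measure" where
  "path_space T \<equiv> \<Pi>\<^sub>M t\<in>{0..T}. borel"

text \<open>\<open>(q, s, \<xi>)\<close> encodes the simple process with value \<open>\<xi> r\<close> on \<open>(s r, s (r + 1)]\<close> for \<open>r < q\<close>.\<close>

definition simple_integrand ::
    "'w measure \<Rightarrow> (real \<Rightarrow> 'w measure) \<Rightarrow> real \<Rightarrow> real \<Rightarrow> nat \<Rightarrow> (nat \<Rightarrow> real)
      \<Rightarrow> (nat \<Rightarrow> 'w \<Rightarrow> real^'m^'d) \<Rightarrow> bool" where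
  "simple_integrand P F a b q s \<xi> \<longleftrightarrow>
     s 0 = a \<and> s q = b \<and>
     (\<forall>r<q. s r < s (Suc r) \<and> \<xi> r \<in> borel_measurable (F (s r))) \<and>
     (\<exists>B. \<forall>r<q. \<forall>\<omega>\<in>space P. norm (\<xi> r \<omega>) \<le> B)"

definition simple_value ::
    "nat \<Rightarrow> (nat \<Rightarrow> real) \<Rightarrow> (nat \<Rightarrow> 'w \<Rightarrow> real^'m^'d) \<Rightarrow> real \<Rightarrow> 'w \<Rightarrow> real^'m^'d" where
  "simple_value q s \<xi> t \<omega> = (\<Sum>r<q. indicator {s r<..s (Suc r)} t *\<^sub>R \<xi> r \<omega>)"

definition simple_integral ::
    "(real \<Rightarrow> 'w \<Rightarrow> real^'m) \<Rightarrow> nat \<Rightarrow> (nat \<Rightarrow> real) \<Rightarrow> (nat \<Rightarrow> 'w \<Rightarrow> real^'m^'d) \<Rightarrow> 'w \<Rightarrow> real^'d" where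
  "simple_integral W q s \<xi> \<omega> = (\<Sum>r<q. \<xi> r \<omega> *v (W (s (Suc r)) \<omega> - W (s r) \<omega>))"

text \<open>\<open>I\<close> is a version of the Ito integral of the progressively measurable, square integrable
  matrix-valued process \<open>H\<close> over \<open>[a, b]\<close>: the L2 limit of integrals of simple processes that
  converge to \<open>H\<close> in L2 of \<open>dt \<otimes> dP\<close>. By the Ito isometry it is unique almost surely.\<close>

definition has_ito_integral ::
    "'w measure \<Rightarrow> (real \<Rightarrow> 'w measure) \<Rightarrow> (real \<Rightarrow> 'w \<Rightarrow> real^'m) \<Rightarrow> real \<Rightarrow> real
      \<Rightarrow> (real \<Rightarrow> 'w \<Rightarrow> real^'m^'d) \<Rightarrow> ('w \<Rightarrow> real^'d) \<Rightarrow> bool" where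
  "has_ito_integral P F W a b H I \<longleftrightarrow>
     (\<forall>t\<in>{a..b}. (\<lambda>(s, \<omega>). H s \<omega>) \<in> borel_measurable (restrict_space borel {a..t} \<Otimes>\<^sub>M F t)) \<and>
     I \<in> borel_measurable P \<and>
     (\<exists>q s \<xi>. (\<forall>k. simple_integrand P F a b (q k) (s k) (\<xi> k)) \<and>
       (\<lambda>k. \<integral>\<^sup>+\<omega>. (\<integral>\<^sup>+t\<in>{a..b}. ennreal ((norm (simple_value (q k) (s k) (\<xi> k) t \<omega> - H t \<omega>))\<^sup>2) \<partial>lborel) \<partial>P)
         \<longlonglongrightarrow> 0 \<and>
       (\<lambda>k. \<integral>\<^sup>+\<omega>. ennreal ((norm (simple_integral W (q k) (s k) (\<xi> k) \<omega> - I \<omega>))\<^sup>2) \<partial>P) \<longlonglongrightarrow> 0)"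

section \<open>The tamed Milstein scheme\<close>

definition tamed :: "real \<Rightarrow> ('a \<Rightarrow> 'b \<Rightarrow> 'c::real_normed_vector) \<Rightarrow> 'a \<Rightarrow> 'b \<Rightarrow> 'c" where
  "tamed \<delta> b x \<mu> = (1 / (1 + \<delta> * norm (b x \<mu>))) *\<^sub>R b x \<mu>"

text \<open>\<open>Y i n\<close> stands for the \<open>i\<close>-th particle at time \<open>t\<^sub>n\<close>. The inner integral of \<open>dW\<close> from
  \<open>t\<^sub>n\<close> to \<open>s\<close> is the increment of \<open>W\<close>. As stochastic integrals are only determined almost
  surely, so are the equations.\<close>

definition tamed_milstein_scheme ::
    "'w measure \<Rightarrow> (real \<Rightarrow> 'w measure) \<Rightarrow> real \<Rightarrow> nat \<Rightarrow> nat
      \<Rightarrow> (real^'d \<Rightarrow> (real^'d) measure \<Rightarrow> real^'d) \<Rightarrow> (real^'d \<Rightarrow> (real^'d) measure \<Rightarrow> real^'m^'d)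
      \<Rightarrow> (nat \<Rightarrow> real \<Rightarrow> 'w \<Rightarrow> real^'m) \<Rightarrow> (nat \<Rightarrow> 'w \<Rightarrow> real^'d)
      \<Rightarrow> (nat \<Rightarrow> nat \<Rightarrow> 'w \<Rightarrow> real^'d) \<Rightarrow> bool" where
  "tamed_milstein_scheme P F T M N b \<sigma> W X0 Y \<longleftrightarrow>
    (let \<delta> = T / real M;
         t = (\<lambda>n. real n * \<delta>);
         \<mu> = (\<lambda>n \<omega>. empirical N (\<lambda>j. Y j n \<omega>))
     in (\<forall>i\<in>{1..N}. \<forall>n\<le>M. Y i n \<in> borel_measurable P) \<and>
        (\<forall>i\<in>{1..N}. AE \<omega> in P. Y i 0 \<omega> = X0 i \<omega>) \<and>
        (\<forall>i\<in>{1..N}. \<forall>n<M. \<exists>I J.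
           has_ito_integral P F (W i) (t n) (t (Suc n))
             (\<lambda>s \<omega>. grad_op \<sigma> (Y i n \<omega>) (\<mu> n \<omega>)
                (\<sigma> (Y i n \<omega>) (\<mu> n \<omega>) *v (W i s \<omega> - W i (t n) \<omega>))) I \<and>
           has_ito_integral P F (W i) (t n) (t (Suc n))
             (\<lambda>s \<omega>. (1 / real N) *\<^sub>R (\<Sum>j\<in>{1..N}.
                DL_op P \<sigma> (Y i n \<omega>) (\<mu> n \<omega>) (Y j n \<omega>)
                  (\<sigma> (Y j n \<omega>) (\<mu> n \<omega>) *v (W j s \<omega> - W j (t n) \<omega>)))) J \<and>
           (AE \<omega> in P. Y i (Suc n) \<omega> =
              Y i n \<omega> + \<delta> *\<^sub>R tamed \<delta> b (Y i n \<omega>) (\<mu> n \<omega>)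
              + \<sigma> (Y i n \<omega>) (\<mu> n \<omega>) *v (W i (t (Suc n)) \<omega> - W i (t n) \<omega>)
              + I \<omega> + J \<omega>)))"

end

theory Submission
  imports Defs
begin

text \<open>
  Taming only gives \<open>\<delta> \<bar>b\<^sub>\<delta>\<bar> \<le> 1\<close>, so the square of a drift step is not \<open>O(\<delta>)\<close> and a direct
  Gronwall argument breaks down where the drift is large. Hence a particle is stopped as soon as
  \<open>\<bar>Y\<bar>^(2q) > 1 + 1/\<delta>\<close>, where \<open>q \<ge> \<alpha>\<^sub>1\<close>. Before that time \<open>\<delta> \<bar>b(Y)\<bar>\<^sup>2 \<le> C (1 + \<bar>Y\<bar>\<^sup>2)\<close>, and
  \<open>1 + \<bar>Y\<bar>\<^sup>2\<close> grows by a factor \<open>1 + C \<delta>\<close> per step; all moments of the stopped process are thus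
  bounded. With \<open>1/\<delta>\<^sup>2 + \<bar>Y\<bar>\<^sup>2\<close> in place of \<open>1 + \<bar>Y\<bar>\<^sup>2\<close> the same estimate needs no stopping and
  gives moments that are polynomial in \<open>1/\<delta>\<close>. As the stopped process has high moments, the
  stopping event has probability of any order in \<open>\<delta>\<close>, which absorbs this polynomial factor.

  The noise of one step is a sum of Ito integrals whose integrands are linear in the Brownian
  increments, with coefficients bounded by \<open>L (1 + \<bar>Y\<bar>)\<close>. Their moments are those of Riemann sums
  along refinements of the partitions of the approximating simple processes, to which a discrete
  Gronwall argument and Fatou's lemma apply.
\<close>

section \<open>Elementary inequalities\<close>

text \<open>The bounds used on \<open>\<sigma> 0 \<mu>\<close>, on \<open>b 0 \<mu>\<close> and on
  the Lions derivative applied to \<open>\<sigma>\<close> are uniform in the measure. So the other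
  particles enter the estimate of one particle only through their Brownian increments, and its
  moments satisfy a closed recursion. A step costs a factor 1 + O(\<delta>) and not 1 + O(sqrt
  \<delta>), because the term linear in the noise is kept exactly and has mean zero. Stopping must
  not spoil this, so the one-step estimates hold on any event B known at the left end of the step.
  The weight 1/\<delta>^2 is forced: (|Y| + 1)^2 <= (1 + \<delta>) |Y|^2 + 1 + 1/\<delta>, and the
  additive error has to be at most a multiple of \<delta> times the weight. An Ito integral is given
  only as an L2 limit of simple integrals, whose higher moments are not controlled. The simple
  integrands are exchanged for values of the true integrand; their partitions are refined first,
  since they may be coarse. At the end the two moment bounds are joined by a pointwise splitting in
  place of Hoelder's inequality.\<close>

text \<open>Model case: u = |x|^2, s = <x,y> and w = |y|^2, so that u + 2s + w = |x + y|^2 and the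
  hypothesis on s is Cauchy-Schwarz. The linear term keeps its exact coefficient because it is the
  one that later has mean zero.\<close>

lemma power_binomial_bound:
  assumes "k \<ge> 1"
  shows "\<exists>c\<ge>0. \<forall>u s w :: real. u \<ge> 0 \<longrightarrow> w \<ge> 0 \<longrightarrow> s\<^sup>2 \<le> u * w \<longrightarrow>
    (u + 2 * s + w) ^ k \<le> u ^ k + 2 * real k * u ^ (k - 1) * s + c * (u ^ (k - 1) * w + w ^ k)"
  using assms
proof (induction k rule: dec_induct)
  case base
  show ?case by (rule exI[of _ 1]) auto
next
  case (step k)
  then obtain c where c: "c \<ge> 0" "\<And>u s w :: real. u \<ge> 0 \<Longrightarrow> w \<ge> 0 \<Longrightarrow> s\<^sup>2 \<le> u * w \<Longrightarrow>
    (u + 2 * s + w) ^ k \<le> u ^ k + 2 * real k * u ^ (k - 1) * s + c * (u ^ (k - 1) * w + w ^ k)"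
    by blast
  obtain l where l: "k = Suc l" using \<open>1 \<le> k\<close> by (cases k) auto
  show ?case
  \<comment> \<open>Multiplying the induction hypothesis by u + 2s + w gives the coefficients 1 + 5k
    + 2c of u^k w, k + 2c of u^(k-1) w^2, and 2c of both u w^k and w^(k+1). The two mixed monomials
    are split by \<open>mix2\<close> and \<open>mix1\<close>, which raises the coefficient of u^k w
    to 1 + 6k + 6c.\<close>
  proof (rule exI[of _ "1 + 6 * real k + 6 * c"], intro conjI allI impI)
    show "0 \<le> 1 + 6 * real k + 6 * c" using c by simp
    fix u s w :: real assume u: "u \<ge> 0" "w \<ge> 0" "s\<^sup>2 \<le> u * w"
    have s: "\<bar>s\<bar> \<le> (u + w) / 2"
    proof (rule power2_le_imp_le)
      have "0 \<le> (u - w)\<^sup>2" by simp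
      then show "\<bar>s\<bar>\<^sup>2 \<le> ((u + w) / 2)\<^sup>2"
        using u by (simp add: power2_eq_square field_simps)
    qed (use u in simp)
    define q where "q = u + 2 * s + w"
    have q: "0 \<le> q" "q \<le> 2 * (u + w)" using s by (auto simp: q_def)
    have mix1: "u * w ^ k \<le> u ^ k * w + w * w ^ k"
    proof (cases "u \<le> w")
      case True
      then have "u * w ^ k \<le> w * w ^ k" using u by (intro mult_right_mono) auto
      then show ?thesis using u by (simp add: add_increasing)
    next
      case False
      then have "w ^ l \<le> u ^ l" using u by (intro power_mono) auto
      then have "(u * w) * w ^ l \<le> (u * w) * u ^ l" using u by (intro mult_left_mono) auto
      then show ?thesis using u by (simp add: l algebra_simps add_increasing2)
    qed
    have mix2: "u ^ l * (w * w) \<le> u ^ k * w + w * w ^ k"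
    proof (cases "u \<le> w")
      case True
      then have "u ^ l \<le> w ^ l" using u by (intro power_mono) auto
      then have "u ^ l * (w * w) \<le> w ^ l * (w * w)" using u by (intro mult_right_mono) auto
      then show ?thesis using u by (simp add: l algebra_simps add_increasing)
    next
      case False
      then have "(u ^ l * w) * w \<le> (u ^ l * w) * u" using u by (intro mult_left_mono) auto
      then show ?thesis using u by (simp add: l algebra_simps add_increasing2)
    qed
    have "(u + 2 * s + w) ^ Suc k = q * q ^ k" by (simp add: q_def)
    also have "\<dots> \<le> q * (u ^ k + 2 * real k * u ^ l * s + c * (u ^ l * w + w ^ k))"
      using c(2)[OF u] q l by (intro mult_left_mono) (auto simp: q_def)
    also have "\<dots> = u * u ^ k + 2 * s * u ^ k + w * u ^ k + 2 * real k * u ^ l * (u * s + 2 * s\<^sup>2 + s * w)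
        + c * (u ^ l * w + w ^ k) * q"
      by (simp add: q_def algebra_simps power2_eq_square)
    also have "\<dots> \<le> u * u ^ k + 2 * s * u ^ k + w * u ^ k
        + 2 * real k * u ^ l * (u * s + 2 * (u * w) + (u + w) / 2 * w)
        + c * (u ^ l * w + w ^ k) * (2 * (u + w))"
    proof -
      have "s * w \<le> (u + w) / 2 * w" using s u by (intro mult_right_mono) auto
      then show ?thesis
        using u q c(1) by (intro add_mono mult_left_mono order.refl) auto
    qed
    also have "\<dots> = u ^ Suc k + 2 * real (Suc k) * u ^ k * s + (1 + 5 * real k + 2 * c) * (u ^ k * w)
        + (real k + 2 * c) * (u ^ l * (w * w)) + 2 * c * (u * w ^ k) + 2 * c * (w * w ^ k)"
      by (simp add: l field_simps)
    also have "\<dots> \<le> u ^ Suc k + 2 * real (Suc k) * u ^ k * s + (1 + 5 * real k + 2 * c) * (u ^ k * w)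
        + (real k + 2 * c) * (u ^ k * w + w * w ^ k) + 2 * c * (u ^ k * w + w * w ^ k) + 2 * c * (w * w ^ k)"
      using mix1 mix2 c(1) by (intro add_mono mult_left_mono order.refl) auto
    also have "\<dots> \<le> u ^ Suc k + 2 * real (Suc k) * u ^ k * s + (1 + 6 * real k + 6 * c) * (u ^ k * w + w ^ Suc k)"
      using u by (simp add: algebra_simps)
    finally show "(u + 2 * s + w) ^ Suc k \<le> u ^ Suc k + 2 * real (Suc k) * u ^ (Suc k - 1) * s
        + (1 + 6 * real k + 6 * c) * (u ^ (Suc k - 1) * w + w ^ Suc k)"
      by simp
  qed
qed

text \<open>If w = |H \<Delta>W|^2, then w^k has mean of order h^k, so the last term is of order h:
  the form needed for a Gronwall argument. The mixed term u^(k-1) w is split by comparing w with h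
  u, and h <= D turns w^k into a multiple of w^k / h^(k-1).\<close>

lemma power_increment_bound:
  assumes "k \<ge> 1" "D > 0"
  shows "\<exists>c\<ge>0. \<forall>h u s w :: real. 0 < h \<longrightarrow> h \<le> D \<longrightarrow> u \<ge> 0 \<longrightarrow> w \<ge> 0 \<longrightarrow> s\<^sup>2 \<le> u * w \<longrightarrow>
    (u + 2 * s + w) ^ k \<le> (1 + c * h) * u ^ k + 2 * real k * (u ^ (k - 1) * s) + c * (w ^ k / h ^ (k - 1))"
proof -
  obtain c where c: "c \<ge> 0" "\<And>u s w :: real. u \<ge> 0 \<Longrightarrow> w \<ge> 0 \<Longrightarrow> s\<^sup>2 \<le> u * w \<Longrightarrow>
    (u + 2 * s + w) ^ k \<le> u ^ k + 2 * real k * u ^ (k - 1) * s + c * (u ^ (k - 1) * w + w ^ k)"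
    using power_binomial_bound[OF assms(1)] by blast
  obtain l where l: "k = Suc l" using \<open>1 \<le> k\<close> by (cases k) auto
  show ?thesis
  proof (rule exI[of _ "c * (1 + D ^ l)"], intro conjI allI impI)
    show "0 \<le> c * (1 + D ^ l)" using c assms by simp
    fix h u s w :: real assume h: "0 < h" "h \<le> D" and u: "u \<ge> 0" "w \<ge> 0" "s\<^sup>2 \<le> u * w"
    have young: "u ^ l * w \<le> h * u ^ k + w ^ k / h ^ l"
    proof (cases "w \<le> h * u")
      case True
      then have "u ^ l * w \<le> u ^ l * (h * u)" using u by (intro mult_left_mono) auto
      then show ?thesis using u h by (simp add: l algebra_simps add_increasing2)
    next
      case False
      then have "u \<le> w / h" using h by (simp add: field_simps)
      then have "u ^ l \<le> (w / h) ^ l" using u by (intro power_mono) auto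
      then have "u ^ l * w \<le> (w / h) ^ l * w" using u by (intro mult_right_mono) auto
      also have "\<dots> = w ^ k / h ^ l" by (simp add: l power_divide)
      finally show ?thesis using u h by (simp add: add_increasing)
    qed
    have "h ^ l \<le> D ^ l" using h by (intro power_mono) auto
    then have "w ^ k * h ^ l \<le> D ^ l * w ^ k"
      using u by (simp add: mult.commute mult_right_mono)
    then have w: "w ^ k \<le> D ^ l * (w ^ k / h ^ l)" using h by (simp add: field_simps)
    have "(u + 2 * s + w) ^ k \<le> u ^ k + 2 * real k * u ^ l * s + c * (u ^ l * w + w ^ k)"
      using c(2)[OF u] l by simp
    also have "\<dots> \<le> u ^ k + 2 * real k * u ^ l * s + c * ((h * u ^ k + w ^ k / h ^ l) + D ^ l * (w ^ k / h ^ l))"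
      using young w c by (intro add_mono mult_left_mono order.refl)
    also have "\<dots> = (1 + c * h) * u ^ k + 2 * real k * (u ^ l * s) + c * (1 + D ^ l) * (w ^ k / h ^ l)"
      by (simp add: algebra_simps add_divide_distrib)
    also have "\<dots> \<le> (1 + c * (1 + D ^ l) * h) * u ^ k + 2 * real k * (u ^ l * s) + c * (1 + D ^ l) * (w ^ k / h ^ l)"
    proof -
      have "c * h \<le> c * (1 + D ^ l) * h"
        using c(1) h assms by (simp add: algebra_simps)
      then have "(1 + c * h) * u ^ k \<le> (1 + c * (1 + D ^ l) * h) * u ^ k"
        using u by (intro mult_right_mono) auto
      then show ?thesis by linarith
    qed
    finally show "(u + 2 * s + w) ^ k \<le> (1 + c * (1 + D ^ l) * h) * u ^ k + 2 * real k * (u ^ (k - 1) * s)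
        + c * (1 + D ^ l) * (w ^ k / h ^ (k - 1))"
      by (simp add: l)
  qed
qed

text \<open>Comparison with the largest summand. Convexity would give the exponent k - 1 of the
  cardinality, but the size of the constant does not matter here.\<close>

lemma sum_power_le:
  fixes x :: "'i \<Rightarrow> real"
  assumes "finite A" "\<And>a. a \<in> A \<Longrightarrow> 0 \<le> x a" "A \<noteq> {}"
  shows "(\<Sum>a\<in>A. x a) ^ k \<le> real (card A) ^ k * (\<Sum>a\<in>A. x a ^ k)"
proof -
  define m where "m = Max (x ` A)"
  have "m \<in> x ` A" using assms by (auto simp: m_def intro!: Max_in)
  then obtain a where a: "a \<in> A" "m = x a" by blast
  have "(\<Sum>a\<in>A. x a) \<le> real (card A) * m"
    using assms by (intro sum_bounded_above) (auto simp: m_def)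
  then have "(\<Sum>a\<in>A. x a) ^ k \<le> (real (card A) * m) ^ k"
    using assms by (intro power_mono sum_nonneg) auto
  also have "\<dots> = real (card A) ^ k * x a ^ k" by (simp add: power_mult_distrib a)
  also have "\<dots> \<le> real (card A) ^ k * (\<Sum>a\<in>A. x a ^ k)"
    using assms a by (intro mult_left_mono member_le_sum) auto
  finally show ?thesis .
qed

lemma norm_matrix_vector_mult_le: "norm (A *v x) \<le> norm A * norm x"
  for A :: "real^'m^'d" and x :: "real^'m"
proof -
  have "norm (A *v x) = L2_set (\<lambda>i. norm ((A *v x) $ i)) UNIV" by (simp add: norm_vec_def)
  also have "\<dots> \<le> L2_set (\<lambda>i. norm (A $ i) * norm x) UNIV"
  proof (rule L2_set_mono)
    fix i
    have "(A *v x) $ i = A $ i \<bullet> x" by (simp add: matrix_vector_mult_def inner_vec_def)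
    then show "norm ((A *v x) $ i) \<le> norm (A $ i) * norm x"
      using Cauchy_Schwarz_ineq2[of "A $ i" x] by simp
  qed auto
  also have "\<dots> = norm A * norm x"
    by (simp add: norm_vec_def[of A] L2_set_left_distrib)
  finally show ?thesis .
qed

lemma power_le_one_add_power:
  fixes x :: real assumes "0 \<le> x" "k \<le> n" shows "x ^ k \<le> 1 + x ^ n"
proof (cases "x \<le> 1")
  case True
  then have "x ^ k \<le> 1" using assms by (simp add: power_le_one)
  then show ?thesis using assms by (simp add: add_increasing2)
next
  case False
  then have "x ^ k \<le> x ^ n" using assms by (intro power_increasing) auto
  then show ?thesis by simp
qed

lemma mult_power_le_add_power:
  fixes x y :: real assumes "0 \<le> x" "0 \<le> y" shows "x ^ a * y ^ b \<le> x ^ (a + b) + y ^ (a + b)"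
proof (cases "x \<le> y")
  case True
  then have "x ^ a * y ^ b \<le> y ^ a * y ^ b" using assms by (intro mult_right_mono power_mono) auto
  then show ?thesis using assms by (simp add: power_add add_increasing)
next
  case False
  then have "x ^ a * y ^ b \<le> x ^ a * x ^ b" using assms by (intro mult_left_mono power_mono) auto
  then show ?thesis using assms by (simp add: power_add add_increasing2)
qed

section \<open>Filtered probability spaces and changes on null sets\<close>

locale filtered_space = prob_space P for P :: "'w measure" +
  fixes F :: "real \<Rightarrow> 'w measure" and T :: real
  assumes T_pos: "T > 0"
    and filtration: "filtration_on T P F"
    and usual: "usual_conditions T P F"
begin

lemma measurable_filtration: "0 \<le> t \<Longrightarrow> t \<le> T \<Longrightarrow> f \<in> measurable (F t) N \<Longrightarrow> f \<in> measurable P N"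
  using filtration measurable_from_subalg unfolding filtration_on_def by (metis atLeastAtMost_iff)

lemma measurable_filtration_mono:
  "0 \<le> s \<Longrightarrow> s \<le> t \<Longrightarrow> t \<le> T \<Longrightarrow> f \<in> measurable (F s) N \<Longrightarrow> f \<in> measurable (F t) N"
  using filtration measurable_from_subalg unfolding filtration_on_def by metis

lemma space_filtration: "0 \<le> t \<Longrightarrow> t \<le> T \<Longrightarrow> space (F t) = space P"
  using filtration unfolding filtration_on_def subalgebra_def by auto

lemma sets_filtration: "0 \<le> t \<Longrightarrow> t \<le> T \<Longrightarrow> sets (F t) \<subseteq> sets P"
  using filtration unfolding filtration_on_def subalgebra_def by auto

text \<open>Here the usual conditions enter: \<open>F 0\<close> contains all null sets, so a change
  on a null set does not destroy adaptedness. This is needed because Ito integrals and the scheme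
  are fixed only almost surely.\<close>

lemma measurable_filtration_AE:
  fixes X Y :: "'w \<Rightarrow> 'b::topological_space"
  assumes t: "0 \<le> t" "t \<le> T" and X: "X \<in> borel_measurable P" and Y: "Y \<in> borel_measurable (F t)"
    and eq: "AE \<omega> in P. X \<omega> = Y \<omega>"
  shows "X \<in> borel_measurable (F t)"
proof (rule measurableI)
  fix A :: "'b set" assume A: "A \<in> sets borel"
  have sp: "space (F t) = space P" using t by (rule space_filtration)
  have YP: "Y \<in> borel_measurable P" using t Y by (rule measurable_filtration)
  have null: "null_sets P \<subseteq> sets (F t)"
  proof -
    have "subalgebra (F t) (F 0)" using filtration t unfolding filtration_on_def by auto
    then show ?thesis using usual unfolding usual_conditions_def subalgebra_def by auto
  qed
  obtain N where N: "{\<omega> \<in> space P. X \<omega> \<noteq> Y \<omega>} \<subseteq> N" "N \<in> null_sets P"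
    using eq by (auto elim!: AE_E3)
  have *: "(X -` A \<inter> space P) - (Y -` A \<inter> space P) \<in> null_sets P"
          "(Y -` A \<inter> space P) - (X -` A \<inter> space P) \<in> null_sets P"
    using N(1) measurable_sets[OF X A] measurable_sets[OF YP A] by (auto intro!: null_sets_subset[OF N(2)])
  have eq': "X -` A \<inter> space P = ((Y -` A \<inter> space P) - ((Y -` A \<inter> space P) - (X -` A \<inter> space P)))
      \<union> ((X -` A \<inter> space P) - (Y -` A \<inter> space P))" by auto
  also have "\<dots> \<in> sets (F t)"
    using * null measurable_sets[OF Y A, unfolded sp] by blast
  finally show "X -` A \<inter> space (F t) \<in> sets (F t)" by (simp add: sp)
qed simp

end

section \<open>Brownian increments\<close>

text \<open>The hypothesis concerns nonnegative integrals, so finitely many of them may be infinite.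
  Dropping the terms before the index m from which all are below 1 leaves integrable functions, to
  which the L1 statement applies.\<close>

lemma L2_tendsto_AE_subseq:
  fixes X :: "'w \<Rightarrow> 'b::{banach, second_countable_topology}"
  assumes lim: "(\<lambda>n. \<integral>\<^sup>+\<omega>. ennreal ((norm (S n \<omega> - X \<omega>))\<^sup>2) \<partial>M) \<longlonglongrightarrow> 0"
    and X: "X \<in> borel_measurable M" and S: "\<And>n. S n \<in> borel_measurable M"
  shows "\<exists>r::nat \<Rightarrow> nat. strict_mono r \<and> (AE \<omega> in M. (\<lambda>n. S (r n) \<omega>) \<longlonglongrightarrow> X \<omega>)"
proof -
  let ?f = "\<lambda>n. \<integral>\<^sup>+\<omega>. ennreal ((norm (S n \<omega> - X \<omega>))\<^sup>2) \<partial>M"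
  have "eventually (\<lambda>n. ?f n < 1) sequentially"
    using lim by (auto simp: order_tendsto_iff)
  then obtain m where m: "\<And>n. n \<ge> m \<Longrightarrow> ?f n < 1" unfolding eventually_sequentially by blast
  define u where "u n \<omega> = (norm (S (n + m) \<omega> - X \<omega>))\<^sup>2" for n \<omega>
  have meas: "u n \<in> borel_measurable M" for n using X S unfolding u_def by measurable
  have int: "integrable M (u n)" for n
    using m[of "n + m"] meas[of n] by (intro integrableI_bounded) (auto simp: u_def intro: less_le_trans)
  have "(\<lambda>n. ?f (n + m)) \<longlonglongrightarrow> 0" using lim by (rule LIMSEQ_ignore_initial_segment)
  moreover have "?f (n + m) = ennreal (\<integral>x. norm (u n x) \<partial>M)" for n
    using int[of n, unfolded u_def[abs_def]] by (subst nn_integral_eq_integral[symmetric]) (auto simp: u_def)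
  ultimately have "(\<lambda>n. ennreal (\<integral>x. norm (u n x) \<partial>M)) \<longlonglongrightarrow> ennreal 0" by simp
  then have "(\<lambda>n. \<integral>x. norm (u n x) \<partial>M) \<longlonglongrightarrow> 0" by (subst (asm) tendsto_ennreal_iff) auto
  from tendsto_L1_AE_subseq[OF int this] obtain r :: "nat \<Rightarrow> nat"
    where r: "strict_mono r" "AE x in M. (\<lambda>n. u (r n) x) \<longlonglongrightarrow> 0" by blast
  have "AE x in M. (\<lambda>n. S (r n + m) x) \<longlonglongrightarrow> X x"
    using r(2)
  proof eventually_elim
    case (elim x)
    then have "(\<lambda>n. sqrt (u (r n) x)) \<longlonglongrightarrow> sqrt 0" by (rule tendsto_real_sqrt)
    then have "(\<lambda>n. norm (S (r n + m) x - X x)) \<longlonglongrightarrow> 0" by (simp add: u_def)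
    then show ?case by (simp add: tendsto_norm_zero_iff LIM_zero_iff)
  qed
  moreover have "strict_mono (\<lambda>n. r n + m)" using r(1) by (simp add: strict_mono_def)
  ultimately show ?thesis by blast
qed

context filtered_space begin

lemma indep_increment:
  fixes W :: "real \<Rightarrow> 'w \<Rightarrow> real^'m"
  assumes W: "brownian_motion T P F W" and st: "0 \<le> s" "s < t" "t \<le> T"
    and X: "X \<in> borel_measurable (F s)" and g: "g \<in> borel_measurable borel"
  shows "indep_var borel (X :: 'w \<Rightarrow> real) borel (\<lambda>\<omega>. g (W t \<omega> - W s \<omega>) :: real)"
proof -
  let ?D = "\<lambda>\<omega>. W t \<omega> - W s \<omega>"
  let ?B = "{?D -` A \<inter> space P | A. A \<in> sets borel}"
  have ind: "indep_set (sets (F s)) ?B" using W st unfolding brownian_motion_def by blast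
  have sp: "space (F s) = space P" using st by (intro space_filtration) auto
  have Wm: "W u \<in> borel_measurable P" if "0 \<le> u" "u \<le> T" for u
    using W that unfolding brownian_motion_def by (intro measurable_filtration[OF that]) auto
  have D: "?D \<in> borel_measurable P" using Wm st by (intro borel_measurable_diff) auto
  have XP: "X \<in> borel_measurable P" using st X by (intro measurable_filtration[of s]) auto
  have sig: "sigma_sets (space P) {X -` A \<inter> space P | A. A \<in> sets borel} \<subseteq> sets (F s)"
    using measurable_sets[OF X] by (subst sp[symmetric], intro sets.sigma_sets_subset) (auto simp: sp)
  \<comment> \<open>\<open>?B\<close> is a preimage algebra and hence already a sigma-algebra. So it
    also contains the sigma-algebra generated by \<open>g\<close> of the increment, which is what
    \<open>indep_var_eq\<close> asks for.\<close>
  have V: "sets (vimage_algebra (space P) ?D borel) = ?B"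
    by (rule sets_vimage_algebra2) auto
  have sB: "sigma_sets (space P) ?B = ?B"
    using sets.sigma_sets_eq[of "vimage_algebra (space P) ?D borel"] unfolding V space_vimage_algebra .
  have "{(\<lambda>\<omega>. g (?D \<omega>)) -` A \<inter> space P | A. A \<in> sets borel} \<subseteq> ?B"
  proof safe
    fix A :: "real set" assume "A \<in> sets borel"
    then have "g -` A \<in> sets borel" using measurable_sets[OF g] by simp
    then show "\<exists>Aa. (\<lambda>\<omega>. g (?D \<omega>)) -` A \<inter> space P = ?D -` Aa \<inter> space P \<and> Aa \<in> sets borel"
      by (intro exI[of _ "g -` A"]) auto
  qed
  from sigma_sets_mono'[OF this, of "space P"] have sg: "sigma_sets (space P) {(\<lambda>\<omega>. g (?D \<omega>)) -` A \<inter> space P | A. A \<in> sets borel} \<subseteq> ?B"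
    unfolding sB .
  have "indep_set (sigma_sets (space P) {X -` A \<inter> space P | A. A \<in> sets borel})
     (sigma_sets (space P) {(\<lambda>\<omega>. g (?D \<omega>)) -` A \<inter> space P | A. A \<in> sets borel})"
    unfolding indep_set_def
  proof (rule indep_sets_mono_sets[OF ind[unfolded indep_set_def]])
    fix j :: bool
    show "(case j of True \<Rightarrow> sigma_sets (space P) {X -` A \<inter> space P | A. A \<in> sets borel}
       | False \<Rightarrow> sigma_sets (space P) {(\<lambda>\<omega>. g (?D \<omega>)) -` A \<inter> space P | A. A \<in> sets borel})
      \<subseteq> (case j of True \<Rightarrow> sets (F s) | False \<Rightarrow> ?B)"
      using sig sg by (cases j) (simp_all only: bool.case)
  qed
  then show ?thesis unfolding indep_var_eq using XP D g by auto
qed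

lemma increment_component_moment:
  fixes W :: "real \<Rightarrow> 'w \<Rightarrow> real^'m"
  assumes W: "brownian_motion T P F W" and st: "0 \<le> s" "s < t" "t \<le> T"
  shows "integrable P (\<lambda>\<omega>. (W t \<omega> $ l - W s \<omega> $ l) ^ (2 * k))"
    and "expectation (\<lambda>\<omega>. (W t \<omega> $ l - W s \<omega> $ l) ^ (2 * k)) = fact (2 * k) / (2 ^ k * fact k) * (t - s) ^ k"
    and "integrable P (\<lambda>\<omega>. W t \<omega> $ l - W s \<omega> $ l)"
    and "expectation (\<lambda>\<omega>. W t \<omega> $ l - W s \<omega> $ l) = 0"
proof -
  have D: "distributed P lborel (\<lambda>\<omega>. W t \<omega> $ l - W s \<omega> $ l) (normal_density 0 (sqrt (t - s)))"
    using W st unfolding brownian_motion_def by blast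
  have sq: "0 < sqrt (t - s)" using st by simp
  note m = normal_moment_even[OF sq, of 0 k]
  have "integrable P (\<lambda>\<omega>. (W t \<omega> $ l - W s \<omega> $ l) ^ (2 * k)) \<longleftrightarrow>
     integrable lborel (\<lambda>x. normal_density 0 (sqrt (t - s)) x * x ^ (2 * k))"
    by (subst distributed_integrable[OF D]) auto
  then show "integrable P (\<lambda>\<omega>. (W t \<omega> $ l - W s \<omega> $ l) ^ (2 * k))"
    using m by (auto dest: integrable.intros)
  have "expectation (\<lambda>\<omega>. (W t \<omega> $ l - W s \<omega> $ l) ^ (2 * k)) =
     (\<integral>x. normal_density 0 (sqrt (t - s)) x * x ^ (2 * k) \<partial>lborel)"
    by (subst distributed_integral[OF D, symmetric]) auto
  also have "\<dots> = fact (2 * k) / (2 ^ k * fact k) * (t - s) ^ k"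
    using has_bochner_integral_integral_eq[OF m] st by (simp add: power_divide)
  finally show "expectation (\<lambda>\<omega>. (W t \<omega> $ l - W s \<omega> $ l) ^ (2 * k)) = fact (2 * k) / (2 ^ k * fact k) * (t - s) ^ k" .
  show "expectation (\<lambda>\<omega>. W t \<omega> $ l - W s \<omega> $ l) = 0"
    using normal_distributed_expectation[OF sq D] .
  have "integrable lborel (\<lambda>x. normal_density 0 (sqrt (t - s)) x * x ^ 1)"
    using integrable_normal_moment[OF sq, of 0 1] by simp
  then show "integrable P (\<lambda>\<omega>. W t \<omega> $ l - W s \<omega> $ l)"
    by (subst distributed_integrable[OF D, symmetric, of "\<lambda>x. x"]) auto
qed

text \<open>(2k)! / (2^k k!) is the 2k-th moment of a standard normal variable; the powers of the
  dimension come from splitting |x|^2 into coordinates with \<open>sum_power_le\<close>. The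
  \<open>itself\<close> argument carries the dimension.\<close>

definition gauss_bound :: "'m::finite itself \<Rightarrow> nat \<Rightarrow> real" where
  "gauss_bound _ k = real CARD('m) ^ k * (real CARD('m) * (fact (2 * k) / (2 ^ k * fact k)))"

lemma increment_moment:
  fixes W :: "real \<Rightarrow> 'w \<Rightarrow> real^'m"
  assumes W: "brownian_motion T P F W" and st: "0 \<le> s" "s < t" "t \<le> T"
  shows "integrable P (\<lambda>\<omega>. norm (W t \<omega> - W s \<omega>) ^ (2 * k))"
    and "expectation (\<lambda>\<omega>. norm (W t \<omega> - W s \<omega>) ^ (2 * k)) \<le> gauss_bound TYPE('m) k * (t - s) ^ k"
proof -
  note m = increment_component_moment[OF assms]
  let ?D = "\<lambda>\<omega>. W t \<omega> - W s \<omega>"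
  have Wm: "W u \<in> borel_measurable P" if "0 \<le> u" "u \<le> T" for u
    using W that unfolding brownian_motion_def by (intro measurable_filtration[OF that]) auto
  have D[measurable]: "?D \<in> borel_measurable P" using Wm st by (intro borel_measurable_diff) auto
  let ?R = "\<lambda>\<omega>. real CARD('m) ^ k * (\<Sum>l\<in>UNIV. (W t \<omega> $ l - W s \<omega> $ l) ^ (2 * k))"
  have le: "norm (?D \<omega>) ^ (2 * k) \<le> ?R \<omega>" for \<omega>
  proof -
    have "(norm (?D \<omega>))\<^sup>2 = (\<Sum>l\<in>UNIV. (W t \<omega> $ l - W s \<omega> $ l)\<^sup>2)"
      by (simp add: norm_vec_def L2_set_def sum_nonneg)
    then show ?thesis
      using sum_power_le[of UNIV "\<lambda>l. (W t \<omega> $ l - W s \<omega> $ l)\<^sup>2" k] by (simp add: power_mult)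
  qed
  have R: "integrable P ?R" using m(1) by auto
  show int: "integrable P (\<lambda>\<omega>. norm (?D \<omega>) ^ (2 * k))"
    by (rule Bochner_Integration.integrable_bound[OF R]) (use le in \<open>auto intro!: AE_I2 intro: order_trans[OF _ abs_ge_self]\<close>)
  have "expectation (\<lambda>\<omega>. norm (?D \<omega>) ^ (2 * k)) \<le> expectation ?R"
    using int R le by (intro integral_mono) auto
  also have "\<dots> = gauss_bound TYPE('m) k * (t - s) ^ k"
    using m(1) by (simp add: m(2) gauss_bound_def)
  finally show "expectation (\<lambda>\<omega>. norm (W t \<omega> - W s \<omega>) ^ (2 * k)) \<le> gauss_bound TYPE('m) k * (t - s) ^ k" .
qed

lemma expectation_mult_increment:
  fixes W :: "real \<Rightarrow> 'w \<Rightarrow> real^'m"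
  assumes W: "brownian_motion T P F W" and st: "0 \<le> s" "s < t" "t \<le> T"
    and X: "X \<in> borel_measurable (F s)" "integrable P X"
  shows "integrable P (\<lambda>\<omega>. X \<omega> * norm (W t \<omega> - W s \<omega>) ^ (2 * k))"
    and "expectation (\<lambda>\<omega>. X \<omega> * norm (W t \<omega> - W s \<omega>) ^ (2 * k)) =
      expectation X * expectation (\<lambda>\<omega>. norm (W t \<omega> - W s \<omega>) ^ (2 * k))"
    and "integrable P (\<lambda>\<omega>. X \<omega> * (W t \<omega> $ l - W s \<omega> $ l))"
    and "expectation (\<lambda>\<omega>. X \<omega> * (W t \<omega> $ l - W s \<omega> $ l)) = 0"
proof -
  have i1: "indep_var borel X borel (\<lambda>\<omega>. norm (W t \<omega> - W s \<omega>) ^ (2 * k))"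
    by (rule indep_increment[OF W st X(1), of "\<lambda>v. norm v ^ (2 * k)"]) simp
  have i2: "indep_var borel X borel (\<lambda>\<omega>. W t \<omega> $ l - W s \<omega> $ l)"
    using indep_increment[OF W st X(1), of "\<lambda>v. v $ l"] by simp
  note n = increment_moment(1)[OF W st, of k] and c = increment_component_moment(3,4)[OF W st, of l]
  show "integrable P (\<lambda>\<omega>. X \<omega> * norm (W t \<omega> - W s \<omega>) ^ (2 * k))"
    by (rule indep_var_integrable[OF i1 X(2) n])
  show "expectation (\<lambda>\<omega>. X \<omega> * norm (W t \<omega> - W s \<omega>) ^ (2 * k)) =
      expectation X * expectation (\<lambda>\<omega>. norm (W t \<omega> - W s \<omega>) ^ (2 * k))"
    by (rule indep_var_lebesgue_integral[OF i1 X(2) n])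
  show "integrable P (\<lambda>\<omega>. X \<omega> * (W t \<omega> $ l - W s \<omega> $ l))"
    by (rule indep_var_integrable[OF i2 X(2) c(1)])
  show "expectation (\<lambda>\<omega>. X \<omega> * (W t \<omega> $ l - W s \<omega> $ l)) = 0"
    using indep_var_lebesgue_integral[OF i2 X(2) c(1)] c(2) by simp
qed

end

lemma finite_chain_le:
  fixes s :: "nat \<Rightarrow> real"
  assumes "\<And>r. r < q \<Longrightarrow> s r \<le> s (Suc r)" "i \<le> j" "j \<le> q"
  shows "s i \<le> s j"
  using assms(2,3)
proof (induction j rule: dec_induct)
  case (step n)
  then show ?case using assms(1)[of n] by simp
qed simp

lemma borel_measurable_vec_nth [measurable (raw)]:
  fixes f :: "'w \<Rightarrow> ('b::real_normed_vector)^'n"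
  assumes "f \<in> borel_measurable M" shows "(\<lambda>x. f x $ i) \<in> borel_measurable M"
  using borel_measurable_continuous_on[OF _ assms, of "\<lambda>v. v $ i"]
  by (simp add: continuous_on_component continuous_on_id)

lemma borel_measurable_matrix_vector_mult [measurable (raw)]:
  fixes A :: "'w \<Rightarrow> real^'m^'d"
  assumes "A \<in> borel_measurable M" "x \<in> borel_measurable M"
  shows "(\<lambda>\<omega>. A \<omega> *v x \<omega>) \<in> borel_measurable M"
  using assms
  by (rule borel_measurable_continuous_Pair)
    (auto simp: matrix_vector_mult_def intro!: continuous_on_vec_lambda continuous_intros)

context filtered_space begin

lemma BM_measurable:
  fixes W :: "real \<Rightarrow> 'w \<Rightarrow> real^'m"
  assumes W: "brownian_motion T P F W" and st: "0 \<le> s" "s \<le> t" "t \<le> T"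
  shows "W s \<in> borel_measurable (F t)"
proof (rule measurable_filtration_mono[OF st])
  show "W s \<in> borel_measurable (F s)" using W st unfolding brownian_motion_def by simp
qed

text \<open>In coordinates each summand is an \<open>F s\<close>-measurable scalar times a scalar
  increment, so independence applies term by term. The product of the norms dominates every
  coefficient.\<close>

lemma expectation_inner_increment:
  fixes W :: "real \<Rightarrow> 'w \<Rightarrow> real^'m" and Z :: "'w \<Rightarrow> real^'d"
  assumes W: "brownian_motion T P F W" and st: "0 \<le> s" "s < t" "t \<le> T"
    and Z: "Z \<in> borel_measurable (F s)" and H: "H \<in> borel_measurable (F s)"
    and int: "integrable P (\<lambda>\<omega>. norm (Z \<omega>) * norm (H \<omega>))"
  shows "integrable P (\<lambda>\<omega>. Z \<omega> \<bullet> (H \<omega> *v (W t \<omega> - W s \<omega>)))"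
    and "expectation (\<lambda>\<omega>. Z \<omega> \<bullet> (H \<omega> *v (W t \<omega> - W s \<omega>))) = 0"
proof -
  have eq: "Z \<omega> \<bullet> (H \<omega> *v (W t \<omega> - W s \<omega>)) =
      (\<Sum>k\<in>UNIV. \<Sum>l\<in>UNIV. (Z \<omega> $ k * H \<omega> $ k $ l) * (W t \<omega> $ l - W s \<omega> $ l))" for \<omega>
    by (simp add: inner_vec_def matrix_vector_mult_def sum_distrib_left mult.assoc)
  have X: "(\<lambda>\<omega>. Z \<omega> $ k * H \<omega> $ k $ l) \<in> borel_measurable (F s)" for k l
    using Z H by measurable
  have XP: "(\<lambda>\<omega>. Z \<omega> $ k * H \<omega> $ k $ l) \<in> borel_measurable P" for k l
    using X st by (intro measurable_filtration[of s]) auto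
  have i: "integrable P (\<lambda>\<omega>. Z \<omega> $ k * H \<omega> $ k $ l)" for k l
  proof (rule Bochner_Integration.integrable_bound[OF int XP], rule AE_I2)
    fix \<omega>
    have "\<bar>Z \<omega> $ k\<bar> \<le> norm (Z \<omega>)" by (rule component_le_norm_cart)
    moreover have "\<bar>H \<omega> $ k $ l\<bar> \<le> norm (H \<omega>)"
      using component_le_norm_cart[of "H \<omega> $ k" l] Finite_Cartesian_Product.norm_nth_le[of "H \<omega>" k] by simp
    ultimately show "norm (Z \<omega> $ k * H \<omega> $ k $ l) \<le> norm (norm (Z \<omega>) * norm (H \<omega>))"
      by (simp add: abs_mult mult_mono)
  qed
  note m = expectation_mult_increment(3,4)[OF W st X i]
  show "integrable P (\<lambda>\<omega>. Z \<omega> \<bullet> (H \<omega> *v (W t \<omega> - W s \<omega>)))"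
    unfolding eq by (intro Bochner_Integration.integrable_sum m)
  show "expectation (\<lambda>\<omega>. Z \<omega> \<bullet> (H \<omega> *v (W t \<omega> - W s \<omega>))) = 0"
    unfolding eq by (subst Bochner_Integration.integral_sum | simp add: m Bochner_Integration.integrable_sum)+
qed

section \<open>Moments of discrete stochastic integrals\<close>

text \<open>The term linear in the increment has mean zero by independence, so the old moment is
  multiplied by 1 + C (t - s) only. In the last term of \<open>power_increment_bound\<close> the
  moment of the increment, of order (t - s)^k, cancels the denominator up to one factor t -
  s.\<close>

lemma increment_step_moment:
  assumes k: "k \<ge> 1"
  obtains C where "C \<ge> 0" "\<And>(W :: real \<Rightarrow> 'w \<Rightarrow> real^'m) s t (S :: 'w \<Rightarrow> real^'d) H.
    brownian_motion T P F W \<Longrightarrow> 0 \<le> s \<Longrightarrow> s < t \<Longrightarrow> t \<le> T \<Longrightarrow>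
    S \<in> borel_measurable (F s) \<Longrightarrow> H \<in> borel_measurable (F s) \<Longrightarrow>
    integrable P (\<lambda>\<omega>. norm (S \<omega>) ^ (2 * k)) \<Longrightarrow> integrable P (\<lambda>\<omega>. norm (H \<omega>) ^ (2 * k)) \<Longrightarrow>
    integrable P (\<lambda>\<omega>. norm (S \<omega> + H \<omega> *v (W t \<omega> - W s \<omega>)) ^ (2 * k)) \<and>
    expectation (\<lambda>\<omega>. norm (S \<omega> + H \<omega> *v (W t \<omega> - W s \<omega>)) ^ (2 * k))
      \<le> (1 + C * (t - s)) * expectation (\<lambda>\<omega>. norm (S \<omega>) ^ (2 * k))
        + C * ((t - s) * expectation (\<lambda>\<omega>. norm (H \<omega>) ^ (2 * k)))"
proof -
  obtain c where c: "c \<ge> 0" "\<And>h u s w :: real. 0 < h \<Longrightarrow> h \<le> T \<Longrightarrow> u \<ge> 0 \<Longrightarrow> w \<ge> 0 \<Longrightarrow> s\<^sup>2 \<le> u * w \<Longrightarrow>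
    (u + 2 * s + w) ^ k \<le> (1 + c * h) * u ^ k + 2 * real k * (u ^ (k - 1) * s) + c * (w ^ k / h ^ (k - 1))"
    using power_increment_bound[OF k T_pos] by blast
  define G where "G = gauss_bound TYPE('m) k"
  have G: "G \<ge> 0" by (simp add: G_def gauss_bound_def)
  obtain l where l: "k = Suc l" using k by (cases k) auto
  show ?thesis
  \<comment> \<open>The estimate produces c in front of the old moment and c G in front of the new
    one; c (1 + G) dominates both.\<close>
  proof (rule that[of "c * (1 + G)"])
    show "0 \<le> c * (1 + G)" using c G by simp
  next
    fix W :: "real \<Rightarrow> 'w \<Rightarrow> real^'m" and s t and S :: "'w \<Rightarrow> real^'d" and H :: "'w \<Rightarrow> real^'m^'d"
    assume W: "brownian_motion T P F W" and st: "0 \<le> s" "s < t" "t \<le> T"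
      and S: "S \<in> borel_measurable (F s)" and H: "H \<in> borel_measurable (F s)"
      and iS: "integrable P (\<lambda>\<omega>. norm (S \<omega>) ^ (2 * k))" and iH: "integrable P (\<lambda>\<omega>. norm (H \<omega>) ^ (2 * k))"
    let ?D = "\<lambda>\<omega>. W t \<omega> - W s \<omega>"
    let ?h = "t - s"
    have SP[measurable]: "S \<in> borel_measurable P" and HP[measurable]: "H \<in> borel_measurable P"
      using S H st by (auto intro: measurable_filtration[of s])
    have "W s \<in> borel_measurable (F t)" "W t \<in> borel_measurable (F t)"
      using st BM_measurable[OF W] by auto
    then have [measurable]: "W s \<in> borel_measurable P" "W t \<in> borel_measurable P"
      using st by (auto intro: measurable_filtration[of t])
    \<comment> \<open>Up to the factor 2k this is the gradient of |x|^(2k) at S. Its inner product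
      with the noise is the linear term of \<open>power_increment_bound\<close>, as l = k -
      1.\<close>
    let ?Z = "\<lambda>\<omega>. norm (S \<omega>) ^ (2 * l) *\<^sub>R S \<omega>"
    have Z: "?Z \<in> borel_measurable (F s)" using S by measurable
    have ZH: "integrable P (\<lambda>\<omega>. norm (?Z \<omega>) * norm (H \<omega>))"
    proof (rule Bochner_Integration.integrable_bound[OF Bochner_Integration.integrable_add[OF iS iH]])
      show "(\<lambda>\<omega>. norm (?Z \<omega>) * norm (H \<omega>)) \<in> borel_measurable P" by measurable
      show "AE \<omega> in P. norm (norm (?Z \<omega>) * norm (H \<omega>)) \<le> norm (norm (S \<omega>) ^ (2 * k) + norm (H \<omega>) ^ (2 * k))"
      proof (rule AE_I2)
        fix \<omega>
        show "norm (norm (?Z \<omega>) * norm (H \<omega>)) \<le> norm (norm (S \<omega>) ^ (2 * k) + norm (H \<omega>) ^ (2 * k))"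
          using mult_power_le_add_power[of "norm (S \<omega>)" "norm (H \<omega>)" "Suc (2 * l)" 1]
          by (simp add: l algebra_simps)
      qed
    qed
    note Z0 = expectation_inner_increment[OF W st Z H ZH]
    have iHk: "(\<lambda>\<omega>. norm (H \<omega>) ^ (2 * k)) \<in> borel_measurable (F s)" using H by measurable
    note HD = expectation_mult_increment(1,2)[OF W st iHk iH, of k]
    let ?R = "\<lambda>\<omega>. (1 + c * ?h) * norm (S \<omega>) ^ (2 * k) + 2 * real k * (?Z \<omega> \<bullet> (H \<omega> *v ?D \<omega>))
        + c / ?h ^ l * (norm (H \<omega>) ^ (2 * k) * norm (?D \<omega>) ^ (2 * k))"
    have le: "norm (S \<omega> + H \<omega> *v ?D \<omega>) ^ (2 * k) \<le> ?R \<omega>" for \<omega>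
    proof -
      let ?x = "H \<omega> *v ?D \<omega>"
      have "norm (S \<omega> + ?x) ^ (2 * k) = ((norm (S \<omega>))\<^sup>2 + 2 * (S \<omega> \<bullet> ?x) + (norm ?x)\<^sup>2) ^ k"
        by (simp add: power_mult power2_norm_eq_inner inner_add_left inner_add_right inner_commute add_ac
            flip: mult_2)
      also have "\<dots> \<le> (1 + c * ?h) * ((norm (S \<omega>))\<^sup>2) ^ k + 2 * real k * (((norm (S \<omega>))\<^sup>2) ^ (k - 1) * (S \<omega> \<bullet> ?x))
          + c * (((norm ?x)\<^sup>2) ^ k / ?h ^ (k - 1))"
        using st by (intro c(2)) (auto simp: power2_norm_eq_inner Cauchy_Schwarz_ineq)
      also have "((norm ?x)\<^sup>2) ^ k \<le> norm (H \<omega>) ^ (2 * k) * norm (?D \<omega>) ^ (2 * k)"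
        using power_mono[OF norm_matrix_vector_mult_le[of "H \<omega>" "?D \<omega>"], of "2 * k"]
        by (simp add: power_mult power_mult_distrib)
      finally show ?thesis using c(1) st
        by (simp add: l power_mult divide_right_mono mult_left_mono power2_eq_square mult.assoc)
    qed
    have iR: "integrable P ?R" using iS Z0(1) HD(1) by auto
    have int: "integrable P (\<lambda>\<omega>. norm (S \<omega> + H \<omega> *v ?D \<omega>) ^ (2 * k))"
    proof (rule Bochner_Integration.integrable_bound[OF iR])
      show "(\<lambda>\<omega>. norm (S \<omega> + H \<omega> *v ?D \<omega>) ^ (2 * k)) \<in> borel_measurable P" by measurable
      show "AE \<omega> in P. norm (norm (S \<omega> + H \<omega> *v ?D \<omega>) ^ (2 * k)) \<le> norm (?R \<omega>)"
      proof (rule AE_I2)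
        fix \<omega> show "norm (norm (S \<omega> + H \<omega> *v ?D \<omega>) ^ (2 * k)) \<le> norm (?R \<omega>)"
          using order_trans[OF le[of \<omega>] abs_ge_self] by simp
      qed
    qed
    have "expectation (\<lambda>\<omega>. norm (S \<omega> + H \<omega> *v ?D \<omega>) ^ (2 * k)) \<le> expectation ?R"
      using int iR le by (intro integral_mono) auto
    also have "\<dots> = (1 + c * ?h) * expectation (\<lambda>\<omega>. norm (S \<omega>) ^ (2 * k))
        + c / ?h ^ l * (expectation (\<lambda>\<omega>. norm (H \<omega>) ^ (2 * k)) * expectation (\<lambda>\<omega>. norm (?D \<omega>) ^ (2 * k)))"
      using iS Z0 HD by simp
    also have "\<dots> \<le> (1 + c * ?h) * expectation (\<lambda>\<omega>. norm (S \<omega>) ^ (2 * k))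
        + c / ?h ^ l * (expectation (\<lambda>\<omega>. norm (H \<omega>) ^ (2 * k)) * (G * ?h ^ k))"
      using increment_moment(2)[OF W st, of k] c st
      by (intro add_left_mono mult_left_mono) (auto simp: G_def)
    also have "\<dots> = (1 + c * ?h) * expectation (\<lambda>\<omega>. norm (S \<omega>) ^ (2 * k))
        + (c * G) * (?h * expectation (\<lambda>\<omega>. norm (H \<omega>) ^ (2 * k)))"
      using st by (simp add: l)
    also have "\<dots> \<le> (1 + c * (1 + G) * ?h) * expectation (\<lambda>\<omega>. norm (S \<omega>) ^ (2 * k))
        + (c * (1 + G)) * (?h * expectation (\<lambda>\<omega>. norm (H \<omega>) ^ (2 * k)))"
    proof -
      have "1 + c * ?h \<le> 1 + c * (1 + G) * ?h" "c * G \<le> c * (1 + G)"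
        using mult_nonneg_nonneg[of "c * G" ?h] c(1) G st by (auto simp: algebra_simps)
      moreover have "0 \<le> ?h * expectation (\<lambda>\<omega>. norm (H \<omega>) ^ (2 * k))"
        using st by (intro mult_nonneg_nonneg integral_nonneg) auto
      ultimately show ?thesis
        by (intro add_mono mult_right_mono[of "1 + _"] mult_right_mono[of "c * G"]) auto
    qed
    finally show "integrable P (\<lambda>\<omega>. norm (S \<omega> + H \<omega> *v ?D \<omega>) ^ (2 * k)) \<and>
      expectation (\<lambda>\<omega>. norm (S \<omega> + H \<omega> *v ?D \<omega>) ^ (2 * k))
      \<le> (1 + c * (1 + G) * ?h) * expectation (\<lambda>\<omega>. norm (S \<omega>) ^ (2 * k))
        + c * (1 + G) * (?h * expectation (\<lambda>\<omega>. norm (H \<omega>) ^ (2 * k)))"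
      using int by simp
  qed
qed

lemma simple_integral_measurable:
  fixes W :: "real \<Rightarrow> 'w \<Rightarrow> real^'m" and \<xi> :: "nat \<Rightarrow> 'w \<Rightarrow> real^'m^'d"
  assumes W: "brownian_motion T P F W"
    and s: "\<And>r. r < q \<Longrightarrow> s r < s (Suc r)" "0 \<le> s 0" "s q \<le> t" "t \<le> T"
    and \<xi>: "\<And>r. r < q \<Longrightarrow> \<xi> r \<in> borel_measurable (F (s r))"
  shows "simple_integral W q s \<xi> \<in> borel_measurable (F t)"
  unfolding simple_integral_def
proof (rule borel_measurable_sum)
  fix r assume "r \<in> {..<q}"
  then have r: "r < q" by simp
  have 1: "0 \<le> s r" "s r \<le> s (Suc r)" "s (Suc r) \<le> t"
    using finite_chain_le[of q s 0 r, OF less_imp_le[OF s(1)]] finite_chain_le[of q s "Suc r" q, OF less_imp_le[OF s(1)]]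
      less_imp_le[OF s(1)[OF r]] s r by auto
  have [measurable]: "\<xi> r \<in> borel_measurable (F t)"
    using \<xi>[OF r] by (rule measurable_filtration_mono[rotated 3]) (use 1 s in auto)
  have [measurable]: "W (s r) \<in> borel_measurable (F t)" "W (s (Suc r)) \<in> borel_measurable (F t)"
    using 1 s by (auto intro!: BM_measurable[OF W])
  show "(\<lambda>\<omega>. \<xi> r \<omega> *v (W (s (Suc r)) \<omega> - W (s r) \<omega>)) \<in> borel_measurable (F t)"
    by measurable
qed

text \<open>A discrete Gronwall argument over the partition. Burkholder's inequality would gain a
  power of the length of the interval; here it only matters that the constant does not depend on the
  partition, so that limits can be taken.\<close>

lemma simple_integral_moment:
  assumes k: "k \<ge> 1"
  obtains C where "C \<ge> 0" "\<And>(W :: real \<Rightarrow> 'w \<Rightarrow> real^'m) q s (\<xi> :: nat \<Rightarrow> 'w \<Rightarrow> real^'m^'d).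
    brownian_motion T P F W \<Longrightarrow> \<forall>r<q. s r < s (Suc r) \<Longrightarrow> 0 \<le> s 0 \<Longrightarrow> s q \<le> T \<Longrightarrow>
    \<forall>r<q. \<xi> r \<in> borel_measurable (F (s r)) \<and> integrable P (\<lambda>\<omega>. norm (\<xi> r \<omega>) ^ (2 * k)) \<Longrightarrow>
    integrable P (\<lambda>\<omega>. norm (simple_integral W q s \<xi> \<omega>) ^ (2 * k)) \<and>
    expectation (\<lambda>\<omega>. norm (simple_integral W q s \<xi> \<omega>) ^ (2 * k))
      \<le> C * (\<Sum>r<q. (s (Suc r) - s r) * expectation (\<lambda>\<omega>. norm (\<xi> r \<omega>) ^ (2 * k)))"
proof -
  obtain C where C: "C \<ge> 0" "\<And>(W :: real \<Rightarrow> 'w \<Rightarrow> real^'m) s t (S :: 'w \<Rightarrow> real^'d) H.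
    brownian_motion T P F W \<Longrightarrow> 0 \<le> s \<Longrightarrow> s < t \<Longrightarrow> t \<le> T \<Longrightarrow>
    S \<in> borel_measurable (F s) \<Longrightarrow> H \<in> borel_measurable (F s) \<Longrightarrow>
    integrable P (\<lambda>\<omega>. norm (S \<omega>) ^ (2 * k)) \<Longrightarrow> integrable P (\<lambda>\<omega>. norm (H \<omega>) ^ (2 * k)) \<Longrightarrow>
    integrable P (\<lambda>\<omega>. norm (S \<omega> + H \<omega> *v (W t \<omega> - W s \<omega>)) ^ (2 * k)) \<and>
    expectation (\<lambda>\<omega>. norm (S \<omega> + H \<omega> *v (W t \<omega> - W s \<omega>)) ^ (2 * k))
      \<le> (1 + C * (t - s)) * expectation (\<lambda>\<omega>. norm (S \<omega>) ^ (2 * k))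
        + C * ((t - s) * expectation (\<lambda>\<omega>. norm (H \<omega>) ^ (2 * k)))"
    by (rule increment_step_moment[OF k]) (rule that, assumption, blast)
  show ?thesis
  proof (rule that[of "exp (C * T) * C"])
    show "0 \<le> exp (C * T) * C" using C by simp
  next
    fix W :: "real \<Rightarrow> 'w \<Rightarrow> real^'m" and q s and \<xi> :: "nat \<Rightarrow> 'w \<Rightarrow> real^'m^'d"
    assume W: "brownian_motion T P F W" and s: "\<forall>r<q. s r < s (Suc r)" "0 \<le> s 0" "s q \<le> T"
      and \<xi>: "\<forall>r<q. \<xi> r \<in> borel_measurable (F (s r)) \<and> integrable P (\<lambda>\<omega>. norm (\<xi> r \<omega>) ^ (2 * k))"
    let ?S = "\<lambda>n. simple_integral W n s \<xi>"
    let ?e = "\<lambda>n. \<Sum>r<n. (s (Suc r) - s r) * expectation (\<lambda>\<omega>. norm (\<xi> r \<omega>) ^ (2 * k))"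
    have sle: "s i \<le> s j" if "i \<le> j" "j \<le> q" for i j
      using s(1) that by (intro finite_chain_le[of q s i j]) (auto intro: less_imp_le)
    have e0: "0 \<le> ?e n" if "n \<le> q" for n
      using that s(1) by (intro sum_nonneg mult_nonneg_nonneg integral_nonneg) (auto intro: less_imp_le)
    \<comment> \<open>The exponential carries the elapsed time s n - s 0, so 1 + C h <= exp (C h)
      closes the induction for every partition.\<close>
    have ind: "integrable P (\<lambda>\<omega>. norm (?S n \<omega>) ^ (2 * k)) \<and>
      expectation (\<lambda>\<omega>. norm (?S n \<omega>) ^ (2 * k)) \<le> exp (C * (s n - s 0)) * (C * ?e n)" if "n \<le> q" for n
      using that
    proof (induction n)
      case 0
      then show ?case using k by (cases k) (simp_all add: simple_integral_def)
    next
      case (Suc n)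
      have n: "n < q" using Suc by simp
      have st: "0 \<le> s n" "s n < s (Suc n)" "s (Suc n) \<le> T"
        using sle[of 0 n] sle[of "Suc n" q] s n by auto
      have Sm: "?S n \<in> borel_measurable (F (s n))"
        by (rule simple_integral_measurable[OF W]) (use st s \<xi> n in auto)
      have step: "?S (Suc n) \<omega> = ?S n \<omega> + \<xi> n \<omega> *v (W (s (Suc n)) \<omega> - W (s n) \<omega>)" for \<omega>
        by (simp add: simple_integral_def)
      have IH: "integrable P (\<lambda>\<omega>. norm (?S n \<omega>) ^ (2 * k))"
        "expectation (\<lambda>\<omega>. norm (?S n \<omega>) ^ (2 * k)) \<le> exp (C * (s n - s 0)) * (C * ?e n)"
        using Suc by auto
      have \<xi>n: "\<xi> n \<in> borel_measurable (F (s n))" "integrable P (\<lambda>\<omega>. norm (\<xi> n \<omega>) ^ (2 * k))"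
        using \<xi> n by auto
      note c = C(2)[OF W st Sm \<xi>n(1) IH(1) \<xi>n(2)]
      let ?h = "s (Suc n) - s n" and ?x = "expectation (\<lambda>\<omega>. norm (\<xi> n \<omega>) ^ (2 * k))"
      have "expectation (\<lambda>\<omega>. norm (?S (Suc n) \<omega>) ^ (2 * k)) \<le>
         (1 + C * ?h) * expectation (\<lambda>\<omega>. norm (?S n \<omega>) ^ (2 * k)) + C * (?h * ?x)"
        using c unfolding step by simp
      also have "\<dots> \<le> exp (C * ?h) * (exp (C * (s n - s 0)) * (C * ?e n)) + exp (C * (s (Suc n) - s 0)) * (C * (?h * ?x))"
      proof (rule add_mono)
        show "(1 + C * ?h) * expectation (\<lambda>\<omega>. norm (?S n \<omega>) ^ (2 * k))
            \<le> exp (C * ?h) * (exp (C * (s n - s 0)) * (C * ?e n))"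
          by (intro mult_mono IH(2) exp_ge_add_one_self integral_nonneg) auto
        have "1 \<le> exp (C * (s (Suc n) - s 0))" using C(1) sle[of 0 "Suc n"] Suc by simp
        moreover have "0 \<le> C * (?h * ?x)" using C(1) st by (intro mult_nonneg_nonneg integral_nonneg) auto
        ultimately show "C * (?h * ?x) \<le> exp (C * (s (Suc n) - s 0)) * (C * (?h * ?x))"
          using mult_right_mono[of 1 "exp (C * (s (Suc n) - s 0))" "C * (?h * ?x)"] by simp
      qed
      also have "\<dots> = exp (C * (s (Suc n) - s 0)) * (C * ?e (Suc n))"
      proof -
        have "exp (C * ?h) * exp (C * (s n - s 0)) = exp (C * (s (Suc n) - s 0))"
          by (simp add: mult_exp_exp algebra_simps)
        then show ?thesis by (simp add: algebra_simps)
      qed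
      finally show ?case using c unfolding step by simp
    qed
    have "expectation (\<lambda>\<omega>. norm (?S q \<omega>) ^ (2 * k)) \<le> exp (C * (s q - s 0)) * (C * ?e q)" using ind by simp
    also have "\<dots> \<le> exp (C * T) * (C * ?e q)"
      using C(1) e0 s by (intro mult_right_mono) (auto intro!: mult_left_mono)
    finally show "integrable P (\<lambda>\<omega>. norm (?S q \<omega>) ^ (2 * k)) \<and>
      expectation (\<lambda>\<omega>. norm (?S q \<omega>) ^ (2 * k)) \<le> exp (C * T) * C * ?e q"
      using ind by simp
  qed
qed

end

section \<open>Moments of Ito integrals\<close>

text \<open>Each cell is cut into K equal pieces. This leaves the simple integral unchanged and
  brings the mesh below the total length divided by K, whereas the partitions supplied by
  \<open>has_ito_integral\<close> come without control of their mesh.\<close>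

definition refine_grid :: "nat \<Rightarrow> (nat \<Rightarrow> real) \<Rightarrow> nat \<Rightarrow> real" where
  "refine_grid K s i = s (i div K) + real (i mod K) / real K * (s (Suc (i div K)) - s (i div K))"

lemma refine_grid_Suc:
  assumes "K \<ge> 1"
  shows "refine_grid K s (Suc i) - refine_grid K s i = (s (Suc (i div K)) - s (i div K)) / real K"
proof (cases "Suc (i mod K) = K")
  case True
  then have K: "Suc i mod K = 0" "Suc i div K = Suc (i div K)" by (auto simp: mod_Suc div_Suc)
  have "real K = real (i mod K) + 1" using True by linarith
  then show ?thesis using assms by (simp add: refine_grid_def K field_simps)
next
  case False
  then have K: "Suc i mod K = Suc (i mod K)" "Suc i div K = i div K" by (auto simp: mod_Suc div_Suc)
  show ?thesis using assms by (simp add: refine_grid_def K field_simps)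
qed

text \<open>At the last index r = q the formula reads \<open>s (Suc q)\<close>, which lies beyond
  the partition, but with the factor 0.\<close>

lemma refine_grid_mult: "K \<ge> 1 \<Longrightarrow> refine_grid K s (r * K) = s r"
  by (simp add: refine_grid_def)

lemma refine_grid_bounds:
  assumes "K \<ge> 1" "s (i div K) \<le> s (Suc (i div K))"
  shows "s (i div K) \<le> refine_grid K s i" "refine_grid K s (Suc i) \<le> s (Suc (i div K))"
proof -
  let ?d = "s (Suc (i div K)) - s (i div K)"
  show "s (i div K) \<le> refine_grid K s i" using assms by (simp add: refine_grid_def)
  have "real (i mod K) + 1 \<le> real K"
    using assms by (metis Suc_eq_plus1 Suc_leI less_le_trans mod_less_divisor of_nat_1 of_nat_add of_nat_mono zero_less_one)
  then have "(real (i mod K) + 1) / real K * ?d \<le> 1 * ?d"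
    using assms by (intro mult_right_mono) auto
  moreover have "refine_grid K s (Suc i) = s (i div K) + (real (i mod K) + 1) / real K * ?d"
  proof -
    have "refine_grid K s (Suc i) = refine_grid K s i + ?d / real K"
      using refine_grid_Suc[OF assms(1), of s i] by simp
    then show ?thesis by (simp only: refine_grid_def add_divide_distrib distrib_right) simp
  qed
  ultimately show "refine_grid K s (Suc i) \<le> s (Suc (i div K))" by simp
qed

text \<open>Within one old cell the coefficient is constant, so the refined increments
  telescope.\<close>

lemma simple_integral_refine:
  fixes W :: "real \<Rightarrow> 'w \<Rightarrow> real^'m" and \<xi> :: "nat \<Rightarrow> 'w \<Rightarrow> real^'m^'d"
  assumes K: "K \<ge> 1"
  shows "simple_integral W (q * K) (refine_grid K s) (\<lambda>i. \<xi> (i div K)) \<omega> = simple_integral W q s \<xi> \<omega>"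
proof -
  let ?p = "refine_grid K s"
  let ?f = "\<lambda>i. \<xi> (i div K) \<omega> *v (W (?p (Suc i)) \<omega> - W (?p i) \<omega>)"
  have "sum ?f {r * K..<r * K + K} = \<xi> r \<omega> *v (W (s (Suc r)) \<omega> - W (s r) \<omega>)" for r
  proof -
    have "i div K = r" if "i \<in> {r * K..<r * K + K}" for i
      using that K by (intro div_nat_eqI) (auto simp: mult.commute)
    then have "sum ?f {r * K..<r * K + K} =
        (\<Sum>i = r * K..<r * K + K. \<xi> r \<omega> *v (W (?p (Suc i)) \<omega> - W (?p i) \<omega>))"
      by (intro sum.cong) auto
    also have "\<dots> = \<xi> r \<omega> *v (\<Sum>i = r * K..<r * K + K. W (?p (Suc i)) \<omega> - W (?p i) \<omega>)"
      by (simp add: linear_sum[OF matrix_vector_mul_linear])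
    also have "(\<Sum>i = r * K..<r * K + K. W (?p (Suc i)) \<omega> - W (?p i) \<omega>) =
        W (?p (r * K + K)) \<omega> - W (?p (r * K)) \<omega>"
      by (subst sum_Suc_diff') auto
    finally show ?thesis
      using refine_grid_mult[OF K, of s r] refine_grid_mult[OF K, of s "Suc r"] by (simp add: add.commute)
  qed
  then show ?thesis
    unfolding simple_integral_def by (subst sum.nat_group[symmetric]) simp
qed

lemma sum_indicator_grid:
  fixes s :: "nat \<Rightarrow> real"
  assumes "\<And>r. r < q \<Longrightarrow> s r \<le> s (Suc r)"
  shows "(\<Sum>r<q. indicator {s r<..s (Suc r)} t) = (indicator {s 0<..s q} t :: 'b::semiring_1)"
  using assms
proof (induction q)
  case (Suc q)
  have "s 0 \<le> s q" using Suc.prems by (intro finite_chain_le[of q s 0 q]) auto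
  moreover have "s q \<le> s (Suc q)" using Suc.prems by auto
  moreover have "(\<Sum>r<q. indicator {s r<..s (Suc r)} t) = (indicator {s 0<..s q} t :: 'b)"
    by (rule Suc.IH) (use Suc.prems in auto)
  ultimately show ?case unfolding sum.lessThan_Suc by (auto simp: indicator_def)
qed simp

lemma simple_value_eq:
  fixes \<xi> :: "nat \<Rightarrow> 'w \<Rightarrow> real^'m^'d"
  assumes s: "\<And>r. r < q \<Longrightarrow> s r \<le> s (Suc r)" and r: "r < q" "t \<in> {s r<..s (Suc r)}"
  shows "simple_value q s \<xi> t \<omega> = \<xi> r \<omega>"
proof -
  have "indicator {s n<..s (Suc n)} t = (if n = r then 1 else 0 :: real)" if "n < q" for n
  proof -
    have "t \<notin> {s n<..s (Suc n)}" if "n \<noteq> r"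
    proof
      assume t: "t \<in> {s n<..s (Suc n)}"
      consider "Suc n \<le> r" | "Suc r \<le> n" using \<open>n \<noteq> r\<close> by linarith
      then show False
      proof cases
        case 1
        have "s (Suc n) \<le> s r" using 1 r(1) finite_chain_le[of q s "Suc n" r, OF s] by simp
        then show False using t r(2) by simp
      next
        case 2
        have "s (Suc r) \<le> s n" using 2 \<open>n < q\<close> finite_chain_le[of q s "Suc r" n, OF s] by simp
        then show False using t r(2) by simp
      qed
    qed
    then show ?thesis using r by (cases "n = r") simp_all
  qed
  then have "simple_value q s \<xi> t \<omega> = (\<Sum>n<q. (if n = r then 1 else 0 :: real) *\<^sub>R \<xi> n \<omega>)"
    unfolding simple_value_def by (intro sum.cong) auto
  also have "\<dots> = (\<Sum>n<q. if n = r then \<xi> n \<omega> else 0)" by (intro sum.cong) auto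
  also have "\<dots> = \<xi> r \<omega>" using r by simp
  finally show ?thesis .
qed

section \<open>Square integrability and martingale property of Ito integrals\<close>

context filtered_space begin

lemma simple_integrand_D:
  assumes "simple_integrand P F a b q s \<xi>" "0 \<le> a" "b \<le> T"
  shows "s 0 = a" "s q = b" "\<And>r. r < q \<Longrightarrow> s r < s (Suc r)"
    "\<And>r. r \<le> q \<Longrightarrow> a \<le> s r" "\<And>r. r \<le> q \<Longrightarrow> s r \<le> b"
    "\<And>r. r < q \<Longrightarrow> \<xi> r \<in> borel_measurable (F (s r))"
    "\<And>r. r < q \<Longrightarrow> integrable P (\<lambda>\<omega>. norm (\<xi> r \<omega>) ^ k)"
proof -
  obtain B where B: "\<And>r \<omega>. r < q \<Longrightarrow> \<omega> \<in> space P \<Longrightarrow> norm (\<xi> r \<omega>) \<le> B"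
    using assms(1) unfolding simple_integrand_def by blast
  show s: "s 0 = a" "s q = b" "\<And>r. r < q \<Longrightarrow> s r < s (Suc r)"
    and m: "\<And>r. r < q \<Longrightarrow> \<xi> r \<in> borel_measurable (F (s r))"
    using assms(1) unfolding simple_integrand_def by auto
  show sa: "a \<le> s r" if "r \<le> q" for r
    using finite_chain_le[of q s 0 r, OF less_imp_le[OF s(3)]] that s(1) by simp
  show sb: "s r \<le> b" if "r \<le> q" for r
    using finite_chain_le[of q s r q, OF less_imp_le[OF s(3)]] that s(2) by simp
  show "integrable P (\<lambda>\<omega>. norm (\<xi> r \<omega>) ^ k)" if "r < q" for r
  proof (rule integrable_const_bound[of _ "B ^ k"])
    have "\<xi> r \<in> borel_measurable P"
      using m[OF that] sa[of r] sb[of r] that assms by (intro measurable_filtration[of "s r"]) auto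
    then show "(\<lambda>\<omega>. norm (\<xi> r \<omega>) ^ k) \<in> borel_measurable P" by measurable
    show "AE \<omega> in P. norm (norm (\<xi> r \<omega>) ^ k) \<le> B ^ k"
      using B[OF that] by (auto intro!: AE_I2 power_mono)
  qed
qed

lemma expectation_inner_simple_integral:
  fixes W :: "real \<Rightarrow> 'w \<Rightarrow> real^'m" and Z :: "'w \<Rightarrow> real^'d"
  assumes W: "brownian_motion T P F W" and ab: "0 \<le> a" "b \<le> T"
    and si: "simple_integrand P F a b q s \<xi>"
    and Z: "Z \<in> borel_measurable (F a)" "integrable P (\<lambda>\<omega>. (norm (Z \<omega>))\<^sup>2)"
  shows "integrable P (\<lambda>\<omega>. Z \<omega> \<bullet> simple_integral W q s \<xi> \<omega>)"
    and "expectation (\<lambda>\<omega>. Z \<omega> \<bullet> simple_integral W q s \<xi> \<omega>) = 0"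
proof -
  note s = simple_integrand_D[OF si ab]
  have eq: "Z \<omega> \<bullet> simple_integral W q s \<xi> \<omega> =
      (\<Sum>r<q. Z \<omega> \<bullet> (\<xi> r \<omega> *v (W (s (Suc r)) \<omega> - W (s r) \<omega>)))" for \<omega>
    by (simp add: simple_integral_def inner_sum_right)
  have r: "integrable P (\<lambda>\<omega>. Z \<omega> \<bullet> (\<xi> r \<omega> *v (W (s (Suc r)) \<omega> - W (s r) \<omega>)))"
    "expectation (\<lambda>\<omega>. Z \<omega> \<bullet> (\<xi> r \<omega> *v (W (s (Suc r)) \<omega> - W (s r) \<omega>))) = 0" if r: "r < q" for r
  proof -
    have st: "0 \<le> s r" "s r < s (Suc r)" "s (Suc r) \<le> T" "a \<le> s r"
      using s(3,4)[of r] s(5)[of "Suc r"] r ab by auto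
    have Zr: "Z \<in> borel_measurable (F (s r))"
      using Z(1) st ab by (intro measurable_filtration_mono[of a "s r"]) auto
    note \<xi>r = s(6)[OF r]
    have [measurable]: "Z \<in> borel_measurable P" "\<xi> r \<in> borel_measurable P"
      using Zr \<xi>r st by (auto intro: measurable_filtration[of "s r"])
    have "integrable P (\<lambda>\<omega>. norm (Z \<omega>) * norm (\<xi> r \<omega>))"
    proof (rule Bochner_Integration.integrable_bound[OF Bochner_Integration.integrable_add[OF Z(2) s(7)[OF r, of 2]]])
      show "(\<lambda>\<omega>. norm (Z \<omega>) * norm (\<xi> r \<omega>)) \<in> borel_measurable P" by measurable
      show "AE \<omega> in P. norm (norm (Z \<omega>) * norm (\<xi> r \<omega>)) \<le> norm ((norm (Z \<omega>))\<^sup>2 + (norm (\<xi> r \<omega>))\<^sup>2)"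
      proof (rule AE_I2)
        fix \<omega> show "norm (norm (Z \<omega>) * norm (\<xi> r \<omega>)) \<le> norm ((norm (Z \<omega>))\<^sup>2 + (norm (\<xi> r \<omega>))\<^sup>2)"
          using mult_power_le_add_power[of "norm (Z \<omega>)" "norm (\<xi> r \<omega>)" 1 1] by (simp add: power2_eq_square)
      qed
    qed
    then show "integrable P (\<lambda>\<omega>. Z \<omega> \<bullet> (\<xi> r \<omega> *v (W (s (Suc r)) \<omega> - W (s r) \<omega>)))"
      "expectation (\<lambda>\<omega>. Z \<omega> \<bullet> (\<xi> r \<omega> *v (W (s (Suc r)) \<omega> - W (s r) \<omega>))) = 0"
      using expectation_inner_increment[OF W st(1-3) Zr \<xi>r] by auto
  qed
  show "integrable P (\<lambda>\<omega>. Z \<omega> \<bullet> simple_integral W q s \<xi> \<omega>)"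
    unfolding eq using r by (intro Bochner_Integration.integrable_sum) auto
  show "expectation (\<lambda>\<omega>. Z \<omega> \<bullet> simple_integral W q s \<xi> \<omega>) = 0"
    unfolding eq using r by (subst Bochner_Integration.integral_sum) auto
qed

lemma simple_integrand_integral_square_integrable:
  fixes W :: "real \<Rightarrow> 'w \<Rightarrow> real^'m" and \<xi> :: "nat \<Rightarrow> 'w \<Rightarrow> real^'m^'d"
  assumes W: "brownian_motion T P F W" and ab: "0 \<le> a" "b \<le> T"
    and si: "simple_integrand P F a b q s \<xi>"
  shows "simple_integral W q s \<xi> \<in> borel_measurable (F b)"
    and "integrable P (\<lambda>\<omega>. (norm (simple_integral W q s \<xi> \<omega>))\<^sup>2)"
proof -
  note s = simple_integrand_D[OF si ab]
  show "simple_integral W q s \<xi> \<in> borel_measurable (F b)"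
    by (rule simple_integral_measurable[OF W]) (use s ab in auto)
  obtain C where C: "\<And>(W :: real \<Rightarrow> 'w \<Rightarrow> real^'m) q s (\<xi> :: nat \<Rightarrow> 'w \<Rightarrow> real^'m^'d).
    brownian_motion T P F W \<Longrightarrow> \<forall>r<q. s r < s (Suc r) \<Longrightarrow> 0 \<le> s 0 \<Longrightarrow> s q \<le> T \<Longrightarrow>
    \<forall>r<q. \<xi> r \<in> borel_measurable (F (s r)) \<and> integrable P (\<lambda>\<omega>. norm (\<xi> r \<omega>) ^ (2 * 1)) \<Longrightarrow>
    integrable P (\<lambda>\<omega>. norm (simple_integral W q s \<xi> \<omega>) ^ (2 * 1)) \<and>
    expectation (\<lambda>\<omega>. norm (simple_integral W q s \<xi> \<omega>) ^ (2 * 1))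
      \<le> C * (\<Sum>r<q. (s (Suc r) - s r) * expectation (\<lambda>\<omega>. norm (\<xi> r \<omega>) ^ (2 * 1)))"
    by (rule simple_integral_moment[of 1]) (simp, rule that, blast)
  have "\<forall>r<q. \<xi> r \<in> borel_measurable (F (s r)) \<and> integrable P (\<lambda>\<omega>. norm (\<xi> r \<omega>) ^ (2 * 1))"
    using s(6,7) by blast
  from C[OF W _ _ _ this]
  show "integrable P (\<lambda>\<omega>. (norm (simple_integral W q s \<xi> \<omega>))\<^sup>2)"
    using s ab by simp
qed

text \<open>Square integrability and orthogonality to variables known at time a hold for simple
  integrals and pass to their L2 limit. Measurability at time b comes from a subsequence that
  converges almost surely.\<close>

lemma ito_integral_square_integrable:
  fixes W :: "real \<Rightarrow> 'w \<Rightarrow> real^'m" and I :: "'w \<Rightarrow> real^'d"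
  assumes W: "brownian_motion T P F W" and ab: "0 \<le> a" "a \<le> b" "b \<le> T"
    and I: "has_ito_integral P F W a b H I"
  shows "I \<in> borel_measurable (F b)" "integrable P (\<lambda>\<omega>. (norm (I \<omega>))\<^sup>2)"
    and "\<And>Z :: 'w \<Rightarrow> real^'d. Z \<in> borel_measurable (F a) \<Longrightarrow> integrable P (\<lambda>\<omega>. (norm (Z \<omega>))\<^sup>2) \<Longrightarrow>
        integrable P (\<lambda>\<omega>. Z \<omega> \<bullet> I \<omega>) \<and> expectation (\<lambda>\<omega>. Z \<omega> \<bullet> I \<omega>) = 0"
proof -
  obtain q s \<xi> where si: "\<And>k. simple_integrand P F a b (q k) (s k) (\<xi> k)"
    and lim: "(\<lambda>k. \<integral>\<^sup>+\<omega>. ennreal ((norm (simple_integral W (q k) (s k) (\<xi> k) \<omega> - I \<omega>))\<^sup>2) \<partial>P) \<longlonglongrightarrow> 0"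
    using I unfolding has_ito_integral_def by blast
  define S where "S k = simple_integral W (q k) (s k) (\<xi> k)" for k
  have IP[measurable]: "I \<in> borel_measurable P" using I unfolding has_ito_integral_def by blast
  have S: "S k \<in> borel_measurable (F b)" "integrable P (\<lambda>\<omega>. (norm (S k \<omega>))\<^sup>2)" for k
    using simple_integrand_integral_square_integrable[OF W ab(1,3) si] by (auto simp: S_def)
  have SP[measurable]: "S k \<in> borel_measurable P" for k
    using S(1) ab by (intro measurable_filtration[of b]) auto
  obtain r :: "nat \<Rightarrow> nat" where r: "AE \<omega> in P. (\<lambda>n. S (r n) \<omega>) \<longlonglongrightarrow> I \<omega>"
    using L2_tendsto_AE_subseq[OF lim[folded S_def] IP SP] by blast
  show "I \<in> borel_measurable (F b)"
  proof (rule measurable_filtration_AE[OF _ _ IP])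
    \<comment> \<open>\<open>lim\<close> is total, so this is an \<open>F b\<close>-measurable
      function on the whole space; it agrees with I wherever the subsequence converges.\<close>
    show "(\<lambda>\<omega>. lim (\<lambda>n. S (r n) \<omega>)) \<in> borel_measurable (F b)"
      using S(1) by (intro borel_measurable_lim_metric)
    show "AE \<omega> in P. I \<omega> = lim (\<lambda>n. S (r n) \<omega>)"
      using r by eventually_elim (simp add: limI)
  qed (use ab in auto)
  have small: "\<exists>k. integrable P (\<lambda>\<omega>. (norm (S k \<omega> - I \<omega>))\<^sup>2) \<and> expectation (\<lambda>\<omega>. (norm (S k \<omega> - I \<omega>))\<^sup>2) \<le> e"
    if "e > 0" for e :: real
  proof -
    have "eventually (\<lambda>k. (\<integral>\<^sup>+\<omega>. ennreal ((norm (S k \<omega> - I \<omega>))\<^sup>2) \<partial>P) < ennreal e) sequentially"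
      using lim[folded S_def] that by (auto simp: order_tendsto_iff)
    then obtain k where k: "(\<integral>\<^sup>+\<omega>. ennreal ((norm (S k \<omega> - I \<omega>))\<^sup>2) \<partial>P) < ennreal e"
      by (auto simp: eventually_sequentially)
    have i: "integrable P (\<lambda>\<omega>. (norm (S k \<omega> - I \<omega>))\<^sup>2)"
    proof (rule integrableI_bounded)
      show "(\<lambda>\<omega>. (norm (S k \<omega> - I \<omega>))\<^sup>2) \<in> borel_measurable P" by measurable
      show "(\<integral>\<^sup>+\<omega>. ennreal (norm ((norm (S k \<omega> - I \<omega>))\<^sup>2)) \<partial>P) < \<infinity>"
        using k by (simp add: less_top) (metis ennreal_less_top less_trans)
    qed
    have "ennreal (expectation (\<lambda>\<omega>. (norm (S k \<omega> - I \<omega>))\<^sup>2)) < ennreal e"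
      using k nn_integral_eq_integral[OF i] by simp
    then show ?thesis using i that by (auto simp: ennreal_less_iff intro!: exI[of _ k])
  qed
  show I2: "integrable P (\<lambda>\<omega>. (norm (I \<omega>))\<^sup>2)"
  proof -
    obtain k where k: "integrable P (\<lambda>\<omega>. (norm (S k \<omega> - I \<omega>))\<^sup>2)" using small[of 1] by auto
    have "integrable P (\<lambda>\<omega>. 2 * (norm (S k \<omega>))\<^sup>2 + 2 * (norm (S k \<omega> - I \<omega>))\<^sup>2)"
      using k S by auto
    then show ?thesis
    proof (rule Bochner_Integration.integrable_bound)
      show "(\<lambda>\<omega>. (norm (I \<omega>))\<^sup>2) \<in> borel_measurable P" by measurable
      show "AE \<omega> in P. norm ((norm (I \<omega>))\<^sup>2) \<le> norm (2 * (norm (S k \<omega>))\<^sup>2 + 2 * (norm (S k \<omega> - I \<omega>))\<^sup>2)"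
      proof (rule AE_I2)
        fix \<omega>
        have "norm (I \<omega>) \<le> norm (S k \<omega>) + norm (S k \<omega> - I \<omega>)"
          using norm_triangle_ineq4[of "S k \<omega>" "S k \<omega> - I \<omega>"] by simp
        then have "(norm (I \<omega>))\<^sup>2 \<le> (norm (S k \<omega>) + norm (S k \<omega> - I \<omega>))\<^sup>2" by (intro power_mono) auto
        also have "\<dots> \<le> 2 * (norm (S k \<omega>))\<^sup>2 + 2 * (norm (S k \<omega> - I \<omega>))\<^sup>2"
          using zero_le_power2[of "norm (S k \<omega>) - norm (S k \<omega> - I \<omega>)"] by (simp add: power2_eq_square algebra_simps)
        finally show "norm ((norm (I \<omega>))\<^sup>2) \<le> norm (2 * (norm (S k \<omega>))\<^sup>2 + 2 * (norm (S k \<omega> - I \<omega>))\<^sup>2)"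
          by simp
      qed
    qed
  qed
  fix Z :: "'w \<Rightarrow> real^'d"
  assume Z: "Z \<in> borel_measurable (F a)" "integrable P (\<lambda>\<omega>. (norm (Z \<omega>))\<^sup>2)"
  have [measurable]: "Z \<in> borel_measurable P" using Z ab by (intro measurable_filtration[of a]) auto
  have ZX: "integrable P (\<lambda>\<omega>. Z \<omega> \<bullet> X \<omega>)" if [measurable]: "X \<in> borel_measurable P"
    and X: "integrable P (\<lambda>\<omega>. (norm (X \<omega>))\<^sup>2)" for X
  proof (rule Bochner_Integration.integrable_bound[OF Bochner_Integration.integrable_add[OF Z(2) X]])
    show "(\<lambda>\<omega>. Z \<omega> \<bullet> X \<omega>) \<in> borel_measurable P" by measurable
    show "AE \<omega> in P. norm (Z \<omega> \<bullet> X \<omega>) \<le> norm ((norm (Z \<omega>))\<^sup>2 + (norm (X \<omega>))\<^sup>2)"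
    proof (rule AE_I2)
      fix \<omega> show "norm (Z \<omega> \<bullet> X \<omega>) \<le> norm ((norm (Z \<omega>))\<^sup>2 + (norm (X \<omega>))\<^sup>2)"
        using order_trans[OF Cauchy_Schwarz_ineq2[of "Z \<omega>" "X \<omega>"]]
          mult_power_le_add_power[of "norm (Z \<omega>)" "norm (X \<omega>)" 1 1] by (simp add: power2_eq_square)
    qed
  qed
  have i: "integrable P (\<lambda>\<omega>. Z \<omega> \<bullet> I \<omega>)" by (rule ZX[OF IP I2])
  let ?A = "expectation (\<lambda>\<omega>. (norm (Z \<omega>))\<^sup>2)"
  have A: "?A \<ge> 0" by simp
  have bound: "\<bar>expectation (\<lambda>\<omega>. Z \<omega> \<bullet> I \<omega>)\<bar> \<le> 0 + e" if "e > 0" for e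
  proof -
    \<comment> \<open>Chosen so that the weighted inequality |Z| |x| <= h |Z|^2 + |x|^2 / h, with
      the mean of |x|^2 at most h^2, sums up to h (\<open>?A\<close> + 1) = e. The summand 1 covers
      the case \<open>?A\<close> = 0.\<close>
    define h where "h = e / (?A + 1)"
    have A1: "?A + 1 > 0" using A by linarith
    have h: "h > 0" unfolding h_def using that A1 by (rule divide_pos_pos)
    obtain k where k: "integrable P (\<lambda>\<omega>. (norm (S k \<omega> - I \<omega>))\<^sup>2)"
      "expectation (\<lambda>\<omega>. (norm (S k \<omega> - I \<omega>))\<^sup>2) \<le> h\<^sup>2" using small[of "h\<^sup>2"] h by auto
    have ZS: "integrable P (\<lambda>\<omega>. Z \<omega> \<bullet> S k \<omega>)" "expectation (\<lambda>\<omega>. Z \<omega> \<bullet> S k \<omega>) = 0"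
      using expectation_inner_simple_integral[OF W ab(1,3) si Z] by (auto simp: S_def)
    have "\<bar>expectation (\<lambda>\<omega>. Z \<omega> \<bullet> I \<omega>)\<bar> = \<bar>expectation (\<lambda>\<omega>. Z \<omega> \<bullet> (S k \<omega> - I \<omega>))\<bar>"
      using i ZS by (simp add: inner_diff_right)
    also have "\<dots> \<le> expectation (\<lambda>\<omega>. \<bar>Z \<omega> \<bullet> (S k \<omega> - I \<omega>)\<bar>)"
      by (rule integral_abs_bound)
    also have "\<dots> \<le> expectation (\<lambda>\<omega>. h * (norm (Z \<omega>))\<^sup>2 + (norm (S k \<omega> - I \<omega>))\<^sup>2 / h)"
    proof (rule integral_mono)
      show "integrable P (\<lambda>\<omega>. \<bar>Z \<omega> \<bullet> (S k \<omega> - I \<omega>)\<bar>)"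
        using ZX[OF _ k(1)] by (intro integrable_abs) auto
      show "integrable P (\<lambda>\<omega>. h * (norm (Z \<omega>))\<^sup>2 + (norm (S k \<omega> - I \<omega>))\<^sup>2 / h)"
        using Z k by auto
      fix \<omega>
      let ?z = "norm (Z \<omega>)" and ?x = "norm (S k \<omega> - I \<omega>)"
      have "?z * ?x \<le> h * ?z\<^sup>2 + ?x\<^sup>2 / h"
      proof (cases "?x \<le> h * ?z")
        case True
        then have "?z * ?x \<le> ?z * (h * ?z)" by (intro mult_left_mono) auto
        moreover have "0 \<le> ?x\<^sup>2 / h" using h by simp
        ultimately show ?thesis by (simp add: power2_eq_square algebra_simps)
      next
        case False
        then have "?z \<le> ?x / h" using h by (simp add: field_simps)
        then have "?z * ?x \<le> (?x / h) * ?x" by (intro mult_right_mono) auto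
        moreover have "0 \<le> h * ?z\<^sup>2" using h by simp
        ultimately show ?thesis by (simp add: power2_eq_square algebra_simps)
      qed
      then show "\<bar>Z \<omega> \<bullet> (S k \<omega> - I \<omega>)\<bar> \<le> h * (norm (Z \<omega>))\<^sup>2 + (norm (S k \<omega> - I \<omega>))\<^sup>2 / h"
        using Cauchy_Schwarz_ineq2[of "Z \<omega>" "S k \<omega> - I \<omega>"] by simp
    qed
    also have "\<dots> = h * ?A + expectation (\<lambda>\<omega>. (norm (S k \<omega> - I \<omega>))\<^sup>2) / h"
      using Z k by simp
    also have "\<dots> \<le> h * ?A + h\<^sup>2 / h" using k(2) h by (intro add_left_mono divide_right_mono) auto
    also have "\<dots> = h * (?A + 1)" using h by (simp add: power2_eq_square algebra_simps)
    also have "\<dots> = 0 + e" using A1 by (simp add: h_def)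
    finally show ?thesis .
  qed
  have "\<bar>expectation (\<lambda>\<omega>. Z \<omega> \<bullet> I \<omega>)\<bar> \<le> 0" by (rule field_le_epsilon) (rule bound)
  then show "integrable P (\<lambda>\<omega>. Z \<omega> \<bullet> I \<omega>) \<and> expectation (\<lambda>\<omega>. Z \<omega> \<bullet> I \<omega>) = 0"
    using i by simp
qed

end

lemma norm_add_square_le: "(norm (x + y))\<^sup>2 \<le> 2 * (norm x)\<^sup>2 + 2 * (norm y)\<^sup>2"
  for x y :: "'a::real_normed_vector"
proof -
  have "(norm (x + y))\<^sup>2 \<le> (norm x + norm y)\<^sup>2" by (intro power_mono norm_triangle_ineq) auto
  also have "\<dots> \<le> 2 * (norm x)\<^sup>2 + 2 * (norm y)\<^sup>2"
    using zero_le_power2[of "norm x - norm y"] by (simp add: power2_eq_square algebra_simps)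
  finally show ?thesis .
qed

lemma nn_integral_power_liminf:
  fixes X :: "'w \<Rightarrow> 'b::{banach, second_countable_topology}"
  assumes X: "X \<in> borel_measurable M" and S: "\<And>n. S n \<in> borel_measurable M"
    and lim: "AE \<omega> in M. (\<lambda>n. S n \<omega>) \<longlonglongrightarrow> X \<omega>"
    and bound: "\<And>n. (\<integral>\<^sup>+\<omega>. ennreal (norm (S n \<omega>) ^ k) \<partial>M) \<le> c"
  shows "(\<integral>\<^sup>+\<omega>. ennreal (norm (X \<omega>) ^ k) \<partial>M) \<le> c"
proof -
  have "(\<integral>\<^sup>+\<omega>. ennreal (norm (X \<omega>) ^ k) \<partial>M) = (\<integral>\<^sup>+\<omega>. liminf (\<lambda>n. ennreal (norm (S n \<omega>) ^ k)) \<partial>M)"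
  proof (rule nn_integral_cong_AE)
    show "AE \<omega> in M. ennreal (norm (X \<omega>) ^ k) = liminf (\<lambda>n. ennreal (norm (S n \<omega>) ^ k))"
      using lim
    proof eventually_elim
      case (elim \<omega>)
      then have "(\<lambda>n. ennreal (norm (S n \<omega>) ^ k)) \<longlonglongrightarrow> ennreal (norm (X \<omega>) ^ k)"
        by (intro tendsto_intros)
      from lim_imp_Liminf[OF _ this] show ?case by simp
    qed
  qed
  also have "\<dots> \<le> liminf (\<lambda>n. \<integral>\<^sup>+\<omega>. ennreal (norm (S n \<omega>) ^ k) \<partial>M)"
    using S by (intro nn_integral_liminf) measurable
  also have "\<dots> \<le> c"
    using Liminf_mono[of "\<lambda>n. \<integral>\<^sup>+\<omega>. ennreal (norm (S n \<omega>) ^ k) \<partial>M" "\<lambda>_. c" sequentially] bound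
    by (simp add: Liminf_const)
  finally show ?thesis .
qed

section \<open>Integrands controlled by the Brownian increments of all particles\<close>

locale interacting_noise = filtered_space P F T
  for P :: "'w measure" and F :: "real \<Rightarrow> 'w measure" and T :: real +
  fixes N :: nat and Ws :: "nat \<Rightarrow> real \<Rightarrow> 'w \<Rightarrow> real^'m"
  assumes N: "N \<ge> 1"
    and BM: "\<And>i. i \<in> {1..N} \<Longrightarrow> brownian_motion T P F (Ws i)"
begin

text \<open>All particles are included because the interaction integrand of one particle contains
  the increments of every other one.\<close>

definition noise :: "real \<Rightarrow> real \<Rightarrow> 'w \<Rightarrow> real" where
  "noise s t \<omega> = (\<Sum>j\<in>{1..N}. norm (Ws j t \<omega> - Ws j s \<omega>))"

text \<open>The powers of N stem from \<open>sum_power_le\<close>. Dependence on N is harmless, as N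
  is fixed before the constant of the theorem is chosen.\<close>

definition noise_bound :: "nat \<Rightarrow> real" where
  "noise_bound k = real N ^ (2 * k) * (real N * gauss_bound TYPE('m) k)"

lemma noise_bound_nonneg: "0 \<le> noise_bound k"
  by (simp add: noise_bound_def gauss_bound_def)

lemma noise_nonneg: "0 \<le> noise s t \<omega>"
  by (simp add: noise_def sum_nonneg)

lemma noise_measurable:
  assumes "0 \<le> s" "s \<le> u" "0 \<le> t" "t \<le> u" "u \<le> T"
  shows "noise s t \<in> borel_measurable (F u)"
proof -
  have [measurable]: "Ws j s \<in> borel_measurable (F u)" "Ws j t \<in> borel_measurable (F u)" if "j \<in> {1..N}" for j
    using BM_measurable[OF BM[OF that]] assms by auto
  show ?thesis unfolding noise_def by (intro borel_measurable_sum) measurable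
qed

lemma noise_moment:
  assumes st: "0 \<le> s" "s \<le> t" "t \<le> T" and k: "k \<ge> 1"
    and X: "X \<in> borel_measurable (F s)" "integrable P X" "\<And>\<omega>. \<omega> \<in> space P \<Longrightarrow> 0 \<le> X \<omega>"
  shows "integrable P (\<lambda>\<omega>. X \<omega> * noise s t \<omega> ^ (2 * k))"
    and "expectation (\<lambda>\<omega>. X \<omega> * noise s t \<omega> ^ (2 * k)) \<le> noise_bound k * (t - s) ^ k * expectation X"
proof -
  have "integrable P (\<lambda>\<omega>. X \<omega> * noise s t \<omega> ^ (2 * k)) \<and>
     expectation (\<lambda>\<omega>. X \<omega> * noise s t \<omega> ^ (2 * k)) \<le> noise_bound k * (t - s) ^ k * expectation X"
  \<comment> \<open>\<open>brownian_motion\<close> gives the Gaussian law only for s < t. For s = t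
    both sides vanish, since k >= 1.\<close>
  proof (cases "s = t")
    case True
    then show ?thesis using k by (cases k) (auto simp: noise_def)
  next
    case False
    then have lt: "s < t" using st by simp
    have XP[measurable]: "X \<in> borel_measurable P" using X st by (intro measurable_filtration[of s]) auto
    have [measurable]: "noise s t \<in> borel_measurable P"
      using noise_measurable[of s t t] st by (intro measurable_filtration[of t]) auto
    let ?R = "\<lambda>\<omega>. real N ^ (2 * k) * (\<Sum>j\<in>{1..N}. X \<omega> * norm (Ws j t \<omega> - Ws j s \<omega>) ^ (2 * k))"
    have m: "integrable P (\<lambda>\<omega>. X \<omega> * norm (Ws j t \<omega> - Ws j s \<omega>) ^ (2 * k))"
      "expectation (\<lambda>\<omega>. X \<omega> * norm (Ws j t \<omega> - Ws j s \<omega>) ^ (2 * k))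
         \<le> expectation X * (gauss_bound TYPE('m) k * (t - s) ^ k)" if "j \<in> {1..N}" for j
      using expectation_mult_increment(1,2)[OF BM[OF that] st(1) lt st(3) X(1,2), of k]
        increment_moment(2)[OF BM[OF that] st(1) lt st(3), of k] X(3)
      by (auto intro!: mult_left_mono integral_nonneg_AE AE_I2)
    have le: "X \<omega> * noise s t \<omega> ^ (2 * k) \<le> ?R \<omega>" if "\<omega> \<in> space P" for \<omega>
    proof -
      have "noise s t \<omega> ^ (2 * k) \<le> real N ^ (2 * k) * (\<Sum>j\<in>{1..N}. norm (Ws j t \<omega> - Ws j s \<omega>) ^ (2 * k))"
        unfolding noise_def using sum_power_le[of "{1..N}" "\<lambda>j. norm (Ws j t \<omega> - Ws j s \<omega>)" "2 * k"] N by simp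
      then have "X \<omega> * noise s t \<omega> ^ (2 * k)
          \<le> X \<omega> * (real N ^ (2 * k) * (\<Sum>j\<in>{1..N}. norm (Ws j t \<omega> - Ws j s \<omega>) ^ (2 * k)))"
        using X(3)[OF that] by (intro mult_left_mono)
      then show ?thesis by (simp add: sum_distrib_left mult_ac)
    qed
    have R: "integrable P ?R" using m(1) by (intro integrable_mult_right Bochner_Integration.integrable_sum)
    have int: "integrable P (\<lambda>\<omega>. X \<omega> * noise s t \<omega> ^ (2 * k))"
    proof (rule Bochner_Integration.integrable_bound[OF R])
      show "(\<lambda>\<omega>. X \<omega> * noise s t \<omega> ^ (2 * k)) \<in> borel_measurable P" by measurable
      show "AE \<omega> in P. norm (X \<omega> * noise s t \<omega> ^ (2 * k)) \<le> norm (?R \<omega>)"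
      proof (rule AE_I2)
        fix \<omega> assume \<omega>: "\<omega> \<in> space P"
        have "norm (X \<omega> * noise s t \<omega> ^ (2 * k)) = X \<omega> * noise s t \<omega> ^ (2 * k)"
          using X(3)[OF \<omega>] noise_nonneg[of s t \<omega>] by simp
        also have "\<dots> \<le> norm (?R \<omega>)" using order_trans[OF le[OF \<omega>] abs_ge_self] by simp
        finally show "norm (X \<omega> * noise s t \<omega> ^ (2 * k)) \<le> norm (?R \<omega>)" .
      qed
    qed
    have "expectation (\<lambda>\<omega>. X \<omega> * noise s t \<omega> ^ (2 * k)) \<le> expectation ?R"
      using int R le by (intro integral_mono) auto
    also have "\<dots> = real N ^ (2 * k) * (\<Sum>j\<in>{1..N}. expectation (\<lambda>\<omega>. X \<omega> * norm (Ws j t \<omega> - Ws j s \<omega>) ^ (2 * k)))"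
      using m(1) by (subst integral_mult_right_zero, subst Bochner_Integration.integral_sum) auto
    also have "\<dots> \<le> real N ^ (2 * k) * (\<Sum>j\<in>{1..N}. expectation X * (gauss_bound TYPE('m) k * (t - s) ^ k))"
      using m(2) by (intro mult_left_mono sum_mono) auto
    also have "\<dots> = noise_bound k * (t - s) ^ k * expectation X"
      by (simp add: noise_bound_def)
    finally show ?thesis using int by simp
  qed
  then show "integrable P (\<lambda>\<omega>. X \<omega> * noise s t \<omega> ^ (2 * k))"
    and "expectation (\<lambda>\<omega>. X \<omega> * noise s t \<omega> ^ (2 * k)) \<le> noise_bound k * (t - s) ^ k * expectation X"
    by auto
qed

text \<open>A common description of the two Ito integrands of the scheme, which are linear in
  Brownian increments with coefficients fixed at time a. The zero at time a lets bounds on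
  increments of H serve as bounds on H itself.\<close>

definition noise_lipschitz :: "real \<Rightarrow> real \<Rightarrow> ('w \<Rightarrow> real) \<Rightarrow> (real \<Rightarrow> 'w \<Rightarrow> real^'m^'d) \<Rightarrow> bool" where
  "noise_lipschitz a b g H \<longleftrightarrow> (\<forall>\<omega>\<in>space P. H a \<omega> = 0 \<and> 0 \<le> g \<omega> \<and>
     (\<forall>r\<in>{a..b}. \<forall>s\<in>{a..b}. norm (H s \<omega> - H r \<omega>) \<le> g \<omega> * noise r s \<omega>))"

lemma ito_integrand_measurable:
  assumes I: "has_ito_integral P F W a b H I" and t: "t \<in> {a..b}"
  shows "H t \<in> borel_measurable (F t)"
proof -
  have m: "(\<lambda>(s, \<omega>). H s \<omega>) \<in> borel_measurable (restrict_space borel {a..t} \<Otimes>\<^sub>M F t)"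
    using I t unfolding has_ito_integral_def by blast
  have "(\<lambda>\<omega>. (t, \<omega>)) \<in> measurable (F t) (restrict_space borel {a..t} \<Otimes>\<^sub>M F t)"
    using t by (intro measurable_Pair measurable_const measurable_ident) (auto simp: space_restrict_space)
  from measurable_compose[OF this m] show ?thesis by simp
qed

text \<open>Clamping the time to [a, b] extends the integrand to the whole line without changing it
  on [a, b], so that Fubini with \<open>lborel\<close> can be used.\<close>

lemma ito_integrand_jointly_measurable:
  assumes I: "has_ito_integral P F W a b H I" and ab: "0 \<le> a" "a \<le> b" "b \<le> T"
  shows "(\<lambda>(t, \<omega>). H (max a (min b t)) \<omega>) \<in> borel_measurable (borel \<Otimes>\<^sub>M P)"
proof -
  have m: "(\<lambda>(s, \<omega>). H s \<omega>) \<in> borel_measurable (restrict_space borel {a..b} \<Otimes>\<^sub>M F b)"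
    using I ab unfolding has_ito_integral_def by auto
  have id: "(\<lambda>\<omega>. \<omega>) \<in> measurable P (F b)"
    using ab by (intro measurable_filtration[of b] measurable_ident) auto
  have 1: "(\<lambda>x :: real \<times> 'w. max a (min b (fst x))) \<in> measurable (borel \<Otimes>\<^sub>M P) (restrict_space borel {a..b})"
    using ab by (intro measurable_restrict_space2) (auto simp: min_def)
  have 2: "(\<lambda>x :: real \<times> 'w. snd x) \<in> measurable (borel \<Otimes>\<^sub>M P) (F b)"
    by (rule measurable_compose[OF measurable_snd id])
  from measurable_compose[OF measurable_Pair[OF 1 2] m] show ?thesis
    by (simp add: case_prod_beta)
qed

text \<open>As g is known at time a, it is also known at time r and can serve as the independent
  weight in \<open>noise_moment\<close>.\<close>

lemma noise_lipschitz_moment: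
  fixes H :: "real \<Rightarrow> 'w \<Rightarrow> real^'m^'d"
  assumes ab: "0 \<le> a" "b \<le> T" and k: "k \<ge> 1"
    and H: "\<And>t. t \<in> {a..b} \<Longrightarrow> H t \<in> borel_measurable (F t)" and lip: "noise_lipschitz a b g H"
    and g: "g \<in> borel_measurable (F a)" "integrable P (\<lambda>\<omega>. g \<omega> ^ (2 * k))"
    and rs: "a \<le> r" "r \<le> s" "s \<le> b"
  shows "integrable P (\<lambda>\<omega>. norm (H s \<omega> - H r \<omega>) ^ (2 * k))"
    and "expectation (\<lambda>\<omega>. norm (H s \<omega> - H r \<omega>) ^ (2 * k))
      \<le> noise_bound k * (s - r) ^ k * expectation (\<lambda>\<omega>. g \<omega> ^ (2 * k))"
proof -
  have g0: "0 \<le> g \<omega>" if "\<omega> \<in> space P" for \<omega> using lip that unfolding noise_lipschitz_def by auto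
  have gr: "(\<lambda>\<omega>. g \<omega> ^ (2 * k)) \<in> borel_measurable (F r)"
  proof -
    have "g \<in> borel_measurable (F r)"
      using g(1) rs ab by (intro measurable_filtration_mono[of a r]) auto
    then show ?thesis by measurable
  qed
  have "0 \<le> r" "s \<le> T" using rs ab by auto
  note n = noise_moment[OF \<open>0 \<le> r\<close> rs(2) \<open>s \<le> T\<close> k gr g(2)]
  have [measurable]: "H s \<in> borel_measurable P" "H r \<in> borel_measurable P"
    by (rule measurable_filtration[OF _ _ H[of s]], use rs ab in auto)
      (rule measurable_filtration[OF _ _ H[of r]], use rs ab in auto)
  have le: "norm (H s \<omega> - H r \<omega>) ^ (2 * k) \<le> g \<omega> ^ (2 * k) * noise r s \<omega> ^ (2 * k)" if "\<omega> \<in> space P" for \<omega>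
  proof -
    have "norm (H s \<omega> - H r \<omega>) \<le> g \<omega> * noise r s \<omega>"
      using lip that rs unfolding noise_lipschitz_def by auto
    then have "norm (H s \<omega> - H r \<omega>) ^ (2 * k) \<le> (g \<omega> * noise r s \<omega>) ^ (2 * k)" by (intro power_mono) auto
    then show ?thesis by (simp add: power_mult_distrib)
  qed
  show int: "integrable P (\<lambda>\<omega>. norm (H s \<omega> - H r \<omega>) ^ (2 * k))"
  proof (rule Bochner_Integration.integrable_bound[OF n(1)])
    show "(\<lambda>\<omega>. norm (H s \<omega> - H r \<omega>) ^ (2 * k)) \<in> borel_measurable P" by measurable
    show "AE \<omega> in P. norm (norm (H s \<omega> - H r \<omega>) ^ (2 * k)) \<le> norm (g \<omega> ^ (2 * k) * noise r s \<omega> ^ (2 * k))"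
      using order_trans[OF le abs_ge_self] by (intro AE_I2) simp
  qed (use g0 in auto)
  have "expectation (\<lambda>\<omega>. norm (H s \<omega> - H r \<omega>) ^ (2 * k)) \<le> expectation (\<lambda>\<omega>. g \<omega> ^ (2 * k) * noise r s \<omega> ^ (2 * k))"
    using int n(1) le g0 by (intro integral_mono) auto
  also have "\<dots> \<le> noise_bound k * (s - r) ^ k * expectation (\<lambda>\<omega>. g \<omega> ^ (2 * k))"
    using n(2) g0 by simp
  finally show "expectation (\<lambda>\<omega>. norm (H s \<omega> - H r \<omega>) ^ (2 * k))
      \<le> noise_bound k * (s - r) ^ k * expectation (\<lambda>\<omega>. g \<omega> ^ (2 * k))" .
qed

section \<open>Approximation of Ito integrals by Riemann sums of the integrand\<close>

text \<open>In the cell that begins at p i the two values are compared through H t for every t of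
  the cell: |\<xi> - H (p i)|^2 <= 2 |\<xi> - H t|^2 + 2 |H t - H (p i)|^2. Integration over the
  cells yields the L2 distance between simple process and integrand, and an error of the order of
  the mesh because H is Lipschitz in the noise.\<close>

lemma simple_minus_riemann_bound:
  fixes H :: "real \<Rightarrow> 'w \<Rightarrow> real^'m^'d"
  assumes W: "brownian_motion T P F W" and ab: "0 \<le> a" "a < b" "b \<le> T"
    and I: "has_ito_integral P F W a b H I" and lip: "noise_lipschitz a b g H"
    and g: "g \<in> borel_measurable (F a)" "integrable P (\<lambda>\<omega>. (g \<omega>)\<^sup>2)"
    and si: "simple_integrand P F a b q s \<xi>" and K: "K \<ge> 1"
    and p: "p = refine_grid K s" and D: "D = (\<lambda>i \<omega>. \<xi> (i div K) \<omega> - H (p i) \<omega>)"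
  shows "p 0 = a" "p (q * K) = b" "\<And>i. i < q * K \<Longrightarrow> p i < p (Suc i)"
    "\<And>i. i \<le> q * K \<Longrightarrow> p i \<in> {a..b}"
    "\<And>i. i < q * K \<Longrightarrow> D i \<in> borel_measurable (F (p i)) \<and> integrable P (\<lambda>\<omega>. norm (D i \<omega>) ^ (2 * 1))"
    "ennreal (\<Sum>i<q * K. (p (Suc i) - p i) * expectation (\<lambda>\<omega>. norm (D i \<omega>) ^ (2 * 1))) \<le>
       2 * (\<integral>\<^sup>+\<omega>. (\<integral>\<^sup>+t\<in>{a..b}. ennreal ((norm (simple_value q s \<xi> t \<omega> - H t \<omega>))\<^sup>2) \<partial>lborel) \<partial>P)
       + ennreal (2 * (noise_bound 1 * ((b - a) / real K) * expectation (\<lambda>\<omega>. (g \<omega>)\<^sup>2)) * (b - a))"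
proof -
  note s = simple_integrand_D[OF si ab(1,3)]
  have idx: "i div K < q" if "i < q * K" for i
    using that by (simp add: less_mult_imp_div_less)
  show p0: "p 0 = a" using refine_grid_mult[OF K, of s 0] s(1) by (simp add: p)
  show pq: "p (q * K) = b" using refine_grid_mult[OF K, of s q] s(2) by (simp add: p)
  have pstep: "p (Suc i) - p i = (s (Suc (i div K)) - s (i div K)) / real K" for i
    unfolding p by (rule refine_grid_Suc[OF K])
  show pinc: "p i < p (Suc i)" if "i < q * K" for i
  proof -
    have "0 < (s (Suc (i div K)) - s (i div K)) / real K"
      using s(3)[OF idx[OF that]] K by simp
    then show ?thesis using pstep[of i] by linarith
  qed
  have psmall: "p (Suc i) - p i \<le> (b - a) / real K" if "i < q * K" for i
    unfolding pstep using s(4)[of "i div K"] s(5)[of "Suc (i div K)"] idx[OF that]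
    by (intro divide_right_mono) auto
  show pab: "p i \<in> {a..b}" if "i \<le> q * K" for i
    using finite_chain_le[of "q * K" p 0 i, OF less_imp_le[OF pinc]]
      finite_chain_le[of "q * K" p i "q * K", OF less_imp_le[OF pinc]] that p0 pq by simp
  have ps: "s (i div K) \<le> p i" "p (Suc i) \<le> s (Suc (i div K))" if "i < q * K" for i
    unfolding p using refine_grid_bounds[OF K] s(3)[OF idx[OF that]] by (auto intro: less_imp_le)
  have Hm: "H t \<in> borel_measurable (F t)" if "t \<in> {a..b}" for t
    using ito_integrand_measurable[OF I that] .
  have lipm: "integrable P (\<lambda>\<omega>. (norm (H v \<omega> - H u \<omega>))\<^sup>2)"
    "expectation (\<lambda>\<omega>. (norm (H v \<omega> - H u \<omega>))\<^sup>2) \<le> noise_bound 1 * (v - u) * expectation (\<lambda>\<omega>. (g \<omega>)\<^sup>2)"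
    if "a \<le> u" "u \<le> v" "v \<le> b" for u v
    using noise_lipschitz_moment[OF ab(1,3) _ Hm lip g(1), of 1 u v] g(2) that by auto
  show Dm: "D i \<in> borel_measurable (F (p i)) \<and> integrable P (\<lambda>\<omega>. norm (D i \<omega>) ^ (2 * 1))" if i: "i < q * K" for i
  proof -
    have pi: "a \<le> p i" "p i \<le> b" using pab[of i] i by auto
    have \<xi>m: "\<xi> (i div K) \<in> borel_measurable (F (p i))"
      using s(6)[OF idx[OF i]] s(4)[of "i div K"] idx[OF i] ps(1)[OF i] pi ab
      by (intro measurable_filtration_mono[of "s (i div K)" "p i"]) auto
    have HP: "H (p i) \<in> borel_measurable (F (p i))" using Hm pi by auto
    have m: "D i \<in> borel_measurable (F (p i))" unfolding D using \<xi>m HP by measurable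
    have [measurable]: "D i \<in> borel_measurable P"
      using m pi ab by (intro measurable_filtration[of "p i"]) auto
    \<comment> \<open>Since H vanishes at a, the second moment of H (p i) is that of its increment
      from a.\<close>
    have Ha: "H a \<omega> = 0" if "\<omega> \<in> space P" for \<omega> using lip that unfolding noise_lipschitz_def by auto
    have "integrable P (\<lambda>\<omega>. 2 * norm (\<xi> (i div K) \<omega>) ^ 2 + 2 * (norm (H (p i) \<omega> - H a \<omega>))\<^sup>2)"
      using s(7)[OF idx[OF i], of 2] lipm(1)[of a "p i"] pi by auto
    then have "integrable P (\<lambda>\<omega>. norm (D i \<omega>) ^ (2 * 1))"
    proof (rule Bochner_Integration.integrable_bound)
      show "(\<lambda>\<omega>. norm (D i \<omega>) ^ (2 * 1)) \<in> borel_measurable P" by measurable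
      show "AE \<omega> in P. norm (norm (D i \<omega>) ^ (2 * 1))
          \<le> norm (2 * norm (\<xi> (i div K) \<omega>) ^ 2 + 2 * (norm (H (p i) \<omega> - H a \<omega>))\<^sup>2)"
      proof (rule AE_I2)
        fix \<omega> assume "\<omega> \<in> space P"
        then show "norm (norm (D i \<omega>) ^ (2 * 1))
          \<le> norm (2 * norm (\<xi> (i div K) \<omega>) ^ 2 + 2 * (norm (H (p i) \<omega> - H a \<omega>))\<^sup>2)"
          using norm_add_square_le[of "\<xi> (i div K) \<omega>" "- H (p i) \<omega>"] Ha by (simp add: D)
      qed
    qed
    then show ?thesis using m by simp
  qed
  define Hc where "Hc t = H (max a (min b t))" for t
  have Hc: "Hc t = H t" if "t \<in> {a..b}" for t using that by (simp add: Hc_def)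
  have Hcm[measurable]: "(\<lambda>x. Hc (fst x) (snd x)) \<in> borel_measurable (borel \<Otimes>\<^sub>M P)"
    using ito_integrand_jointly_measurable[OF I ab(1) less_imp_le[OF ab(2)] ab(3)]
    by (simp add: Hc_def case_prod_beta)
  have \<xi>P: "\<xi> r \<in> borel_measurable P" if "r < q" for r
    using s(6)[OF that] s(4,5)[of r] that ab by (intro measurable_filtration[of "s r"]) auto
  have svm[measurable]: "(\<lambda>x. simple_value q s \<xi> (fst x) (snd x)) \<in> borel_measurable (borel \<Otimes>\<^sub>M P)"
    unfolding simple_value_def
  proof (rule borel_measurable_sum)
    fix r assume "r \<in> {..<q}"
    then have [measurable]: "\<xi> r \<in> borel_measurable P" using \<xi>P by simp
    show "(\<lambda>x. indicator {s r<..s (Suc r)} (fst x) *\<^sub>R \<xi> r (snd x)) \<in> borel_measurable (borel \<Otimes>\<^sub>M P)"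
      by measurable
  qed
  have Hpm[measurable]: "H t \<in> borel_measurable P" if "t \<in> {a..b}" for t
    using Hm[OF that] that ab by (intro measurable_filtration[of t]) auto
  define f where "f t \<omega> = ennreal ((norm (simple_value q s \<xi> t \<omega> - Hc t \<omega>))\<^sup>2)" for t \<omega>
  define \<phi> where "\<phi> i t \<omega> = ennreal ((norm (Hc t \<omega> - H (p i) \<omega>))\<^sup>2)" for i t \<omega>
  define ind where "ind i t = (indicator {p i<..p (Suc i)} t :: ennreal)" for i t
  have indm[measurable]: "ind i \<in> borel_measurable borel" for i
    unfolding ind_def by measurable
  have fm[measurable]: "(\<lambda>x. f (fst x) (snd x)) \<in> borel_measurable (borel \<Otimes>\<^sub>M P)"
    unfolding f_def by measurable
  have \<phi>m: "(\<lambda>x. \<phi> i (fst x) (snd x)) \<in> borel_measurable (borel \<Otimes>\<^sub>M P)" if "i \<le> q * K" for i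
    unfolding \<phi>_def using Hpm[OF pab[OF that]] by measurable
  interpret L: pair_sigma_finite lborel P ..
  have swap: "(\<integral>\<^sup>+\<omega>. \<integral>\<^sup>+t. h t \<omega> \<partial>lborel \<partial>P) = (\<integral>\<^sup>+t. \<integral>\<^sup>+\<omega>. h t \<omega> \<partial>P \<partial>lborel)"
    if "(\<lambda>x. h (fst x) (snd x)) \<in> borel_measurable (borel \<Otimes>\<^sub>M P)" for h :: "real \<Rightarrow> 'w \<Rightarrow> ennreal"
  proof (rule L.Fubini')
    have "case_prod h = (\<lambda>x. h (fst x) (snd x))" by (simp add: fun_eq_iff)
    then show "case_prod h \<in> borel_measurable (lborel \<Otimes>\<^sub>M P)"
      using that measurable_cong_sets[OF sets_pair_measure_cong[OF sets_lborel refl] refl] by simp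
  qed
  \<comment> \<open>Bounds the mean of |H t - H (p i)|^2 for t in the cell, whose length is at most
    (b - a) / K.\<close>
  define c where "c = noise_bound 1 * ((b - a) / real K) * expectation (\<lambda>\<omega>. (g \<omega>)\<^sup>2)"
  have c0: "c \<ge> 0" using ab noise_bound_nonneg by (simp add: c_def)
  have summand: "ennreal ((p (Suc i) - p i) * expectation (\<lambda>\<omega>. norm (D i \<omega>) ^ (2 * 1))) \<le>
      2 * (\<integral>\<^sup>+t. (\<integral>\<^sup>+\<omega>. f t \<omega> \<partial>P) * ind i t \<partial>lborel) + 2 * ennreal (c * (p (Suc i) - p i))" if i: "i < q * K" for i
  proof -
    have hi: "0 \<le> p (Suc i) - p i" using pinc[OF i] by simp
    have pi: "a \<le> p i" "p (Suc i) \<le> b" using pab[of i] pab[of "Suc i"] i by auto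
    have [measurable]: "H (p i) \<in> borel_measurable P" using Hpm pab[of i] i by auto
    have [measurable]: "(\<lambda>x. \<phi> i (fst x) (snd x)) \<in> borel_measurable (borel \<Otimes>\<^sub>M P)" using \<phi>m i by simp
    have ft[measurable]: "f t \<in> borel_measurable P" "\<phi> i t \<in> borel_measurable P" for t
      using measurable_compose[OF measurable_Pair1'[of t borel P], of "\<lambda>x. f (fst x) (snd x)"]
        measurable_compose[OF measurable_Pair1'[of t borel P], of "\<lambda>x. \<phi> i (fst x) (snd x)"] by auto
    have intD: "ennreal (expectation (\<lambda>\<omega>. norm (D i \<omega>) ^ (2 * 1))) = (\<integral>\<^sup>+\<omega>. ennreal ((norm (D i \<omega>))\<^sup>2) \<partial>P)"
      using Dm[OF i] by (subst nn_integral_eq_integral) auto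
    \<comment> \<open>The length of the cell is written as the integral of its indicator. The
      discrete error thereby becomes a time integral and can be compared with the simple process at
      each t.\<close>
    have "ennreal ((p (Suc i) - p i) * expectation (\<lambda>\<omega>. norm (D i \<omega>) ^ (2 * 1)))
        = (\<integral>\<^sup>+\<omega>. ennreal ((norm (D i \<omega>))\<^sup>2) \<partial>P) * (\<integral>\<^sup>+t. ind i t \<partial>lborel)"
      using hi intD by (simp add: ennreal_mult' ind_def mult.commute)
    also have "\<dots> = (\<integral>\<^sup>+t. (\<integral>\<^sup>+\<omega>. ennreal ((norm (D i \<omega>))\<^sup>2) \<partial>P) * ind i t \<partial>lborel)"
      by (rule nn_integral_cmult[symmetric]) simp
    also have "\<dots> \<le> (\<integral>\<^sup>+t. 2 * ((\<integral>\<^sup>+\<omega>. f t \<omega> \<partial>P) * ind i t) + 2 * (ennreal c * ind i t) \<partial>lborel)"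
    proof (rule nn_integral_mono)
      fix t
      show "(\<integral>\<^sup>+\<omega>. ennreal ((norm (D i \<omega>))\<^sup>2) \<partial>P) * ind i t
          \<le> 2 * ((\<integral>\<^sup>+\<omega>. f t \<omega> \<partial>P) * ind i t) + 2 * (ennreal c * ind i t)"
      proof (cases "t \<in> {p i<..p (Suc i)}")
        case False then show ?thesis by (simp add: ind_def)
      next
        case True
        then have t: "t \<in> {a..b}" using pi by auto
        \<comment> \<open>A refined cell lies inside one old cell, on which the simple process has a
          single value.\<close>
        have sv: "simple_value q s \<xi> t \<omega> = \<xi> (i div K) \<omega>" for \<omega>
          using simple_value_eq[of q s "i div K" t \<xi> \<omega>, OF less_imp_le[OF s(3)]] idx[OF i] True ps[OF i] by auto
        have "(\<integral>\<^sup>+\<omega>. ennreal ((norm (D i \<omega>))\<^sup>2) \<partial>P) \<le> (\<integral>\<^sup>+\<omega>. 2 * f t \<omega> + 2 * \<phi> i t \<omega> \<partial>P)"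
        proof (rule nn_integral_mono)
          fix \<omega>
          have "(norm (D i \<omega>))\<^sup>2 \<le> 2 * (norm (\<xi> (i div K) \<omega> - Hc t \<omega>))\<^sup>2 + 2 * (norm (Hc t \<omega> - H (p i) \<omega>))\<^sup>2"
            using norm_add_square_le[of "\<xi> (i div K) \<omega> - Hc t \<omega>" "Hc t \<omega> - H (p i) \<omega>"] by (simp add: D)
          then have "ennreal ((norm (D i \<omega>))\<^sup>2) \<le>
              ennreal (2 * (norm (\<xi> (i div K) \<omega> - Hc t \<omega>))\<^sup>2 + 2 * (norm (Hc t \<omega> - H (p i) \<omega>))\<^sup>2)"
            by (rule ennreal_leI)
          then show "ennreal ((norm (D i \<omega>))\<^sup>2) \<le> 2 * f t \<omega> + 2 * \<phi> i t \<omega>"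
            by (simp add: f_def \<phi>_def sv ennreal_plus ennreal_mult)
        qed
        also have "\<dots> = 2 * (\<integral>\<^sup>+\<omega>. f t \<omega> \<partial>P) + 2 * (\<integral>\<^sup>+\<omega>. \<phi> i t \<omega> \<partial>P)"
          by (simp add: nn_integral_add nn_integral_cmult)
        also have "(\<integral>\<^sup>+\<omega>. \<phi> i t \<omega> \<partial>P) \<le> ennreal c"
        proof -
          have "(\<integral>\<^sup>+\<omega>. \<phi> i t \<omega> \<partial>P) = ennreal (expectation (\<lambda>\<omega>. (norm (H t \<omega> - H (p i) \<omega>))\<^sup>2))"
            unfolding \<phi>_def Hc[OF t] using lipm(1)[of "p i" t] True pi by (subst nn_integral_eq_integral) auto
          also have "\<dots> \<le> ennreal (noise_bound 1 * (t - p i) * expectation (\<lambda>\<omega>. (g \<omega>)\<^sup>2))"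
            using lipm(2)[of "p i" t] True pi by (intro ennreal_leI) auto
          also have "\<dots> \<le> ennreal c"
            unfolding c_def using psmall[OF i] True noise_bound_nonneg
            by (intro ennreal_leI mult_right_mono mult_left_mono) auto
          finally show ?thesis .
        qed
        finally show ?thesis using True by (simp add: ind_def mult_left_mono add_left_mono)
      qed
    qed
    also have "\<dots> = 2 * (\<integral>\<^sup>+t. (\<integral>\<^sup>+\<omega>. f t \<omega> \<partial>P) * ind i t \<partial>lborel) + 2 * (ennreal c * (\<integral>\<^sup>+t. ind i t \<partial>lborel))"
    proof -
      have m1: "(\<lambda>t. \<integral>\<^sup>+\<omega>. f t \<omega> \<partial>P) \<in> borel_measurable lborel" by measurable
      show ?thesis using m1 indm[of i] by (simp add: nn_integral_add nn_integral_cmult)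
    qed
    also have "ennreal c * (\<integral>\<^sup>+t. ind i t \<partial>lborel) = ennreal (c * (p (Suc i) - p i))"
      using hi c0 by (simp add: ind_def ennreal_mult)
    finally show ?thesis .
  qed
  have "(\<Sum>i<q * K. (\<integral>\<^sup>+t. (\<integral>\<^sup>+\<omega>. f t \<omega> \<partial>P) * ind i t \<partial>lborel)) =
      (\<integral>\<^sup>+t. (\<Sum>i<q * K. (\<integral>\<^sup>+\<omega>. f t \<omega> \<partial>P) * ind i t) \<partial>lborel)"
    by (rule nn_integral_sum[symmetric]) measurable
  also have "\<dots> \<le> (\<integral>\<^sup>+t. (\<integral>\<^sup>+\<omega>. f t \<omega> * indicator {a..b} t \<partial>P) \<partial>lborel)"
  proof (rule nn_integral_mono)
    fix t
    have ft: "f t \<in> borel_measurable P"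
      using measurable_compose[OF measurable_Pair1'[of t borel P], of "\<lambda>x. f (fst x) (snd x)"] fm by simp
    have "(\<Sum>i<q * K. ind i t) = indicator {a<..b} t"
      unfolding ind_def using sum_indicator_grid[of "q * K" p, OF less_imp_le[OF pinc]] by (simp add: p0 pq)
    also have "\<dots> \<le> indicator {a..b} t" by (auto simp: indicator_def)
    finally show "(\<Sum>i<q * K. (\<integral>\<^sup>+\<omega>. f t \<omega> \<partial>P) * ind i t) \<le> (\<integral>\<^sup>+\<omega>. f t \<omega> * indicator {a..b} t \<partial>P)"
      using ft by (simp add: sum_distrib_left[symmetric] nn_integral_multc mult_left_mono)
  qed
  also have "\<dots> = (\<integral>\<^sup>+\<omega>. (\<integral>\<^sup>+t. f t \<omega> * indicator {a..b} t \<partial>lborel) \<partial>P)"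
    by (rule swap[symmetric]) measurable
  also have "\<dots> = (\<integral>\<^sup>+\<omega>. (\<integral>\<^sup>+t\<in>{a..b}. ennreal ((norm (simple_value q s \<xi> t \<omega> - H t \<omega>))\<^sup>2) \<partial>lborel) \<partial>P)"
    by (intro nn_integral_cong) (auto simp: f_def Hc indicator_def)
  finally have sum_le: "(\<Sum>i<q * K. (\<integral>\<^sup>+t. (\<integral>\<^sup>+\<omega>. f t \<omega> \<partial>P) * ind i t \<partial>lborel)) \<le>
      (\<integral>\<^sup>+\<omega>. (\<integral>\<^sup>+t\<in>{a..b}. ennreal ((norm (simple_value q s \<xi> t \<omega> - H t \<omega>))\<^sup>2) \<partial>lborel) \<partial>P)" .
  have "ennreal (\<Sum>i<q * K. (p (Suc i) - p i) * expectation (\<lambda>\<omega>. norm (D i \<omega>) ^ (2 * 1)))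
      = (\<Sum>i<q * K. ennreal ((p (Suc i) - p i) * expectation (\<lambda>\<omega>. norm (D i \<omega>) ^ (2 * 1))))"
    using less_imp_le[OF pinc] by (subst sum_ennreal) (auto intro!: mult_nonneg_nonneg)
  also have "\<dots> \<le> (\<Sum>i<q * K. 2 * (\<integral>\<^sup>+t. (\<integral>\<^sup>+\<omega>. f t \<omega> \<partial>P) * ind i t \<partial>lborel) + 2 * ennreal (c * (p (Suc i) - p i)))"
    using summand by (intro sum_mono) auto
  also have "\<dots> = 2 * (\<Sum>i<q * K. (\<integral>\<^sup>+t. (\<integral>\<^sup>+\<omega>. f t \<omega> \<partial>P) * ind i t \<partial>lborel))
      + 2 * (\<Sum>i<q * K. ennreal (c * (p (Suc i) - p i)))"
    by (simp add: sum.distrib sum_distrib_left)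
  also have "(\<Sum>i<q * K. ennreal (c * (p (Suc i) - p i))) = ennreal (c * (b - a))"
  proof -
    have "(\<Sum>i<q * K. ennreal (c * (p (Suc i) - p i))) = ennreal (\<Sum>i<q * K. c * (p (Suc i) - p i))"
      using less_imp_le[OF pinc] c0 by (subst sum_ennreal) (auto intro!: mult_nonneg_nonneg)
    also have "(\<Sum>i<q * K. c * (p (Suc i) - p i)) = c * (b - a)"
      using p0 pq by (simp add: sum_distrib_left[symmetric] sum_lessThan_telescope)
    finally show ?thesis .
  qed
  also have "2 * (\<Sum>i<q * K. (\<integral>\<^sup>+t. (\<integral>\<^sup>+\<omega>. f t \<omega> \<partial>P) * ind i t \<partial>lborel)) + 2 * ennreal (c * (b - a))
      \<le> 2 * (\<integral>\<^sup>+\<omega>. (\<integral>\<^sup>+t\<in>{a..b}. ennreal ((norm (simple_value q s \<xi> t \<omega> - H t \<omega>))\<^sup>2) \<partial>lborel) \<partial>P)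
      + 2 * ennreal (c * (b - a))"
    by (intro add_right_mono mult_left_mono sum_le) auto
  finally show "ennreal (\<Sum>i<q * K. (p (Suc i) - p i) * expectation (\<lambda>\<omega>. norm (D i \<omega>) ^ (2 * 1))) \<le>
       2 * (\<integral>\<^sup>+\<omega>. (\<integral>\<^sup>+t\<in>{a..b}. ennreal ((norm (simple_value q s \<xi> t \<omega> - H t \<omega>))\<^sup>2) \<partial>lborel) \<partial>P)
       + ennreal (2 * (noise_bound 1 * ((b - a) / real K) * expectation (\<lambda>\<omega>. (g \<omega>)\<^sup>2)) * (b - a))"
    unfolding c_def[symmetric] using c0 ab by (simp add: ennreal_mult mult.assoc)
qed

text \<open>The simple integrals of the definition converge, but their higher moments are unknown.
  On a common refined grid they differ from the Riemann sums of H by a simple integral with small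
  second moment. So the Riemann sums have the same L2 limit, and a subsequence converges almost
  surely.\<close>

lemma ito_riemann_sums:
  fixes H :: "real \<Rightarrow> 'w \<Rightarrow> real^'m^'d"
  assumes W: "brownian_motion T P F W" and ab: "0 \<le> a" "a < b" "b \<le> T"
    and I: "has_ito_integral P F W a b H I" and lip: "noise_lipschitz a b g H"
    and g: "g \<in> borel_measurable (F a)" "integrable P (\<lambda>\<omega>. (g \<omega>)\<^sup>2)"
  obtains n p where "\<forall>k. p k 0 = a \<and> p k (n k) = b \<and> (\<forall>i<n k. p k i < p k (Suc i)) \<and> (\<forall>i\<le>n k. p k i \<in> {a..b})"
    "AE \<omega> in P. (\<lambda>k. simple_integral W (n k) (p k) (\<lambda>i. H (p k i)) \<omega>) \<longlonglongrightarrow> I \<omega>"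
proof -
  obtain q s \<xi> where si: "\<And>k. simple_integrand P F a b (q k) (s k) (\<xi> k)"
    and lim1: "(\<lambda>k. \<integral>\<^sup>+\<omega>. (\<integral>\<^sup>+t\<in>{a..b}. ennreal ((norm (simple_value (q k) (s k) (\<xi> k) t \<omega> - H t \<omega>))\<^sup>2) \<partial>lborel) \<partial>P)
         \<longlonglongrightarrow> 0"
    and lim2: "(\<lambda>k. \<integral>\<^sup>+\<omega>. ennreal ((norm (simple_integral W (q k) (s k) (\<xi> k) \<omega> - I \<omega>))\<^sup>2) \<partial>P) \<longlonglongrightarrow> 0"
    using I unfolding has_ito_integral_def by blast
  have IP[measurable]: "I \<in> borel_measurable P" using I unfolding has_ito_integral_def by blast
  obtain C where C: "C \<ge> 0" "\<And>(W :: real \<Rightarrow> 'w \<Rightarrow> real^'m) q s (\<xi> :: nat \<Rightarrow> 'w \<Rightarrow> real^'m^'d).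
    brownian_motion T P F W \<Longrightarrow> \<forall>r<q. s r < s (Suc r) \<Longrightarrow> 0 \<le> s 0 \<Longrightarrow> s q \<le> T \<Longrightarrow>
    \<forall>r<q. \<xi> r \<in> borel_measurable (F (s r)) \<and> integrable P (\<lambda>\<omega>. norm (\<xi> r \<omega>) ^ (2 * 1)) \<Longrightarrow>
    integrable P (\<lambda>\<omega>. norm (simple_integral W q s \<xi> \<omega>) ^ (2 * 1)) \<and>
    expectation (\<lambda>\<omega>. norm (simple_integral W q s \<xi> \<omega>) ^ (2 * 1))
      \<le> C * (\<Sum>r<q. (s (Suc r) - s r) * expectation (\<lambda>\<omega>. norm (\<xi> r \<omega>) ^ (2 * 1)))"
    by (rule simple_integral_moment[of 1]) (simp, rule that, assumption, blast)
  \<comment> \<open>Any choice tending to infinity would do: the mesh error is c / K and must vanish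
    along the sequence.\<close>
  define K where "K k = Suc k" for k :: nat
  define p where "p k = refine_grid (K k) (s k)" for k
  define n where "n k = q k * K k" for k
  define D where "D k = (\<lambda>i \<omega>. \<xi> k (i div K k) \<omega> - H (p k i) \<omega>)" for k
  define R where "R k = simple_integral W (n k) (p k) (\<lambda>i. H (p k i))" for k
  define S where "S k = simple_integral W (q k) (s k) (\<xi> k)" for k
  have K1: "K k \<ge> 1" for k by (simp add: K_def)
  note rb = simple_minus_riemann_bound[OF W ab I lip g si K1 p_def D_def, folded n_def]
  have Rm: "R k \<in> borel_measurable (F b)" for k
    unfolding R_def
  proof (rule simple_integral_measurable[OF W])
    show "H (p k i) \<in> borel_measurable (F (p k i))" if "i < n k" for i
      using ito_integrand_measurable[OF I] rb(4)[of i k] that by simp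
  qed (use rb(1-3) ab in auto)
  have Sm: "S k \<in> borel_measurable (F b)" for k
    unfolding S_def using simple_integrand_integral_square_integrable[OF W ab(1,3) si] by simp
  have SR[measurable]: "S k \<in> borel_measurable P" "R k \<in> borel_measurable P" for k
    using Rm Sm ab by (auto intro: measurable_filtration[of b])
  let ?A = "\<lambda>k. \<integral>\<^sup>+\<omega>. (\<integral>\<^sup>+t\<in>{a..b}. ennreal ((norm (simple_value (q k) (s k) (\<xi> k) t \<omega> - H t \<omega>))\<^sup>2) \<partial>lborel) \<partial>P"
  define c where "c = 2 * (noise_bound 1 * (b - a) * expectation (\<lambda>\<omega>. (g \<omega>)\<^sup>2)) * (b - a)"
  \<comment> \<open>The simple integral is first rewritten on the refined grid, so that both sums
    use the same increments and can be subtracted term by term.\<close>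
  have diff: "S k \<omega> - R k \<omega> = simple_integral W (n k) (p k) (D k) \<omega>" for k \<omega>
    unfolding S_def R_def n_def p_def
    by (subst simple_integral_refine[OF K1, symmetric])
      (simp add: simple_integral_def D_def p_def sum_subtractf matrix_vector_mult_diff_rdistrib)
  have SRle: "(\<integral>\<^sup>+\<omega>. ennreal ((norm (S k \<omega> - R k \<omega>))\<^sup>2) \<partial>P) \<le> ennreal C * (2 * ?A k + ennreal (c / real (K k)))" for k
  proof -
    have m: "integrable P (\<lambda>\<omega>. norm (S k \<omega> - R k \<omega>) ^ (2 * 1)) \<and>
      expectation (\<lambda>\<omega>. norm (S k \<omega> - R k \<omega>) ^ (2 * 1))
        \<le> C * (\<Sum>r<n k. (p k (Suc r) - p k r) * expectation (\<lambda>\<omega>. norm (D k r \<omega>) ^ (2 * 1)))"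
      unfolding diff by (rule C(2)[OF W]) (use rb(1-3,5) ab in auto)
    have "(\<integral>\<^sup>+\<omega>. ennreal ((norm (S k \<omega> - R k \<omega>))\<^sup>2) \<partial>P) = ennreal (expectation (\<lambda>\<omega>. norm (S k \<omega> - R k \<omega>) ^ (2 * 1)))"
      using m by (subst nn_integral_eq_integral[symmetric]) auto
    also have "\<dots> \<le> ennreal (C * (\<Sum>r<n k. (p k (Suc r) - p k r) * expectation (\<lambda>\<omega>. norm (D k r \<omega>) ^ (2 * 1))))"
      using m by (intro ennreal_leI) auto
    also have "\<dots> = ennreal C * ennreal (\<Sum>r<n k. (p k (Suc r) - p k r) * expectation (\<lambda>\<omega>. norm (D k r \<omega>) ^ (2 * 1)))"
      using C(1) by (rule ennreal_mult')
    also have "\<dots> \<le> ennreal C * (2 * ?A k + ennreal (2 * (noise_bound 1 * ((b - a) / real (K k)) * expectation (\<lambda>\<omega>. (g \<omega>)\<^sup>2)) * (b - a)))"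
      by (intro mult_left_mono rb(6)) auto
    also have "2 * (noise_bound 1 * ((b - a) / real (K k)) * expectation (\<lambda>\<omega>. (g \<omega>)\<^sup>2)) * (b - a) = c / real (K k)"
      by (simp add: c_def)
    finally show ?thesis .
  qed
  have le: "(\<integral>\<^sup>+\<omega>. ennreal ((norm (R k \<omega> - I \<omega>))\<^sup>2) \<partial>P) \<le>
      2 * (ennreal C * (2 * ?A k + ennreal (c / real (K k)))) + 2 * (\<integral>\<^sup>+\<omega>. ennreal ((norm (S k \<omega> - I \<omega>))\<^sup>2) \<partial>P)" for k
  proof -
    have "(\<integral>\<^sup>+\<omega>. ennreal ((norm (R k \<omega> - I \<omega>))\<^sup>2) \<partial>P) \<le>
      (\<integral>\<^sup>+\<omega>. 2 * ennreal ((norm (S k \<omega> - R k \<omega>))\<^sup>2) + 2 * ennreal ((norm (S k \<omega> - I \<omega>))\<^sup>2) \<partial>P)"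
    proof (rule nn_integral_mono)
      fix \<omega>
      have "(norm (R k \<omega> - I \<omega>))\<^sup>2 \<le> 2 * (norm (S k \<omega> - R k \<omega>))\<^sup>2 + 2 * (norm (S k \<omega> - I \<omega>))\<^sup>2"
        using norm_add_square_le[of "R k \<omega> - S k \<omega>" "S k \<omega> - I \<omega>"] by (simp add: norm_minus_commute)
      then have "ennreal ((norm (R k \<omega> - I \<omega>))\<^sup>2) \<le> ennreal (2 * (norm (S k \<omega> - R k \<omega>))\<^sup>2 + 2 * (norm (S k \<omega> - I \<omega>))\<^sup>2)"
        by (rule ennreal_leI)
      then show "ennreal ((norm (R k \<omega> - I \<omega>))\<^sup>2) \<le> 2 * ennreal ((norm (S k \<omega> - R k \<omega>))\<^sup>2) + 2 * ennreal ((norm (S k \<omega> - I \<omega>))\<^sup>2)"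
        by (simp add: ennreal_plus ennreal_mult)
    qed
    also have "\<dots> = 2 * (\<integral>\<^sup>+\<omega>. ennreal ((norm (S k \<omega> - R k \<omega>))\<^sup>2) \<partial>P) + 2 * (\<integral>\<^sup>+\<omega>. ennreal ((norm (S k \<omega> - I \<omega>))\<^sup>2) \<partial>P)"
      by (simp add: nn_integral_add nn_integral_cmult)
    also have "\<dots> \<le> 2 * (ennreal C * (2 * ?A k + ennreal (c / real (K k)))) + 2 * (\<integral>\<^sup>+\<omega>. ennreal ((norm (S k \<omega> - I \<omega>))\<^sup>2) \<partial>P)"
      by (intro add_right_mono mult_left_mono SRle) auto
    finally show ?thesis .
  qed
  have "(\<lambda>k. c / real (K k)) \<longlonglongrightarrow> 0"
    unfolding K_def by (rule LIMSEQ_Suc[OF lim_const_over_n])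
  then have "(\<lambda>k. ennreal (c / real (K k))) \<longlonglongrightarrow> ennreal 0" by (rule tendsto_ennrealI)
  then have "(\<lambda>k. 2 * (ennreal C * (2 * ?A k + ennreal (c / real (K k)))) + 2 * (\<integral>\<^sup>+\<omega>. ennreal ((norm (S k \<omega> - I \<omega>))\<^sup>2) \<partial>P))
      \<longlonglongrightarrow> 2 * (ennreal C * (2 * 0 + ennreal 0)) + 2 * 0"
    using lim1 lim2[folded S_def] by (intro tendsto_add ennreal_tendsto_cmult) auto
  then have up: "(\<lambda>k. 2 * (ennreal C * (2 * ?A k + ennreal (c / real (K k)))) + 2 * (\<integral>\<^sup>+\<omega>. ennreal ((norm (S k \<omega> - I \<omega>))\<^sup>2) \<partial>P))
      \<longlonglongrightarrow> 0"
    by (simp only: ennreal_0 mult_zero_right add_0_right)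
  have "(\<lambda>k. \<integral>\<^sup>+\<omega>. ennreal ((norm (R k \<omega> - I \<omega>))\<^sup>2) \<partial>P) \<longlonglongrightarrow> 0"
    by (rule tendsto_sandwich[OF always_eventually[OF allI[OF zero_le]] always_eventually[OF allI[OF le]] tendsto_const up])
  from L2_tendsto_AE_subseq[OF this IP SR(2)] obtain r :: "nat \<Rightarrow> nat"
    where "AE \<omega> in P. (\<lambda>k. R (r k) \<omega>) \<longlonglongrightarrow> I \<omega>" by blast
  then have "AE \<omega> in P. (\<lambda>k. simple_integral W (n (r k)) (p (r k)) (\<lambda>i. H (p (r k) i)) \<omega>) \<longlonglongrightarrow> I \<omega>"
    unfolding R_def .
  moreover have "\<forall>k. p (r k) 0 = a \<and> p (r k) (n (r k)) = b \<and> (\<forall>i<n (r k). p (r k) i < p (r k) (Suc i))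
      \<and> (\<forall>i\<le>n (r k). p (r k) i \<in> {a..b})"
  proof (intro allI conjI impI)
    fix k
    show "p (r k) 0 = a" "p (r k) (n (r k)) = b" by (fact rb(1) rb(2))+
    show "p (r k) i < p (r k) (Suc i)" if "i < n (r k)" for i using that by (rule rb(3))
    show "p (r k) i \<in> {a..b}" if "i \<le> n (r k)" for i using that by (rule rb(4))
  qed
  ultimately show ?thesis by (rule that[rotated])
qed

text \<open>For the Riemann sums of H every integrand has 2k-th moment of order (b - a)^k, so
  \<open>simple_integral_moment\<close> bounds them uniformly; Fatou's lemma transfers the bound to
  the integral. Localisation to B is what the stopping argument needs.\<close>

lemma ito_integral_moment:
  assumes k: "k \<ge> 1"
  obtains C where "C \<ge> 0" "\<And>(W :: real \<Rightarrow> 'w \<Rightarrow> real^'m) a b (H :: real \<Rightarrow> 'w \<Rightarrow> real^'m^'d) I g B.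
    brownian_motion T P F W \<Longrightarrow> 0 \<le> a \<Longrightarrow> a < b \<Longrightarrow> b \<le> T \<Longrightarrow>
    has_ito_integral P F W a b H I \<Longrightarrow> noise_lipschitz a b g H \<Longrightarrow>
    g \<in> borel_measurable (F a) \<Longrightarrow> integrable P (\<lambda>\<omega>. (g \<omega>)\<^sup>2) \<Longrightarrow> B \<in> sets (F a) \<Longrightarrow>
    integrable P (\<lambda>\<omega>. g \<omega> ^ (2 * k)) \<Longrightarrow>
    integrable P (\<lambda>\<omega>. norm (I \<omega>) ^ (2 * k)) \<and>
    expectation (\<lambda>\<omega>. indicator B \<omega> * norm (I \<omega>) ^ (2 * k))
      \<le> C * ((b - a) ^ k * expectation (\<lambda>\<omega>. indicator B \<omega> * g \<omega> ^ (2 * k)))"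
proof -
  obtain C where C: "C \<ge> 0" "\<And>(W :: real \<Rightarrow> 'w \<Rightarrow> real^'m) q s (\<xi> :: nat \<Rightarrow> 'w \<Rightarrow> real^'m^'d).
    brownian_motion T P F W \<Longrightarrow> \<forall>r<q. s r < s (Suc r) \<Longrightarrow> 0 \<le> s 0 \<Longrightarrow> s q \<le> T \<Longrightarrow>
    \<forall>r<q. \<xi> r \<in> borel_measurable (F (s r)) \<and> integrable P (\<lambda>\<omega>. norm (\<xi> r \<omega>) ^ (2 * k)) \<Longrightarrow>
    integrable P (\<lambda>\<omega>. norm (simple_integral W q s \<xi> \<omega>) ^ (2 * k)) \<and>
    expectation (\<lambda>\<omega>. norm (simple_integral W q s \<xi> \<omega>) ^ (2 * k))
      \<le> C * (\<Sum>r<q. (s (Suc r) - s r) * expectation (\<lambda>\<omega>. norm (\<xi> r \<omega>) ^ (2 * k)))"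
    by (rule simple_integral_moment[OF k]) (rule that, assumption, blast)
  define C' where "C' = C * (T * noise_bound k)"
  have C': "C' \<ge> 0" using C(1) T_pos noise_bound_nonneg by (simp add: C'_def)
  have main: "integrable P (\<lambda>\<omega>. indicator B \<omega> * norm (I \<omega>) ^ (2 * k)) \<and>
    expectation (\<lambda>\<omega>. indicator B \<omega> * norm (I \<omega>) ^ (2 * k))
      \<le> C' * ((b - a) ^ k * expectation (\<lambda>\<omega>. indicator B \<omega> * g \<omega> ^ (2 * k)))"
    if W: "brownian_motion T P F W" and ab: "0 \<le> a" "a < b" "b \<le> T"
      and I: "has_ito_integral P F W a b H I" and lip: "noise_lipschitz a b g H"
      and g: "g \<in> borel_measurable (F a)" "integrable P (\<lambda>\<omega>. (g \<omega>)\<^sup>2)" and B: "B \<in> sets (F a)"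
      and gk: "integrable P (\<lambda>\<omega>. g \<omega> ^ (2 * k))"
    for W :: "real \<Rightarrow> 'w \<Rightarrow> real^'m" and a b and H :: "real \<Rightarrow> 'w \<Rightarrow> real^'m^'d" and I g B
  proof -
    obtain n p where p': "\<forall>j. p j 0 = a \<and> p j (n j) = b \<and> (\<forall>i<n j. p j i < p j (Suc i)) \<and> (\<forall>i\<le>n j. p j i \<in> {a..b})"
      and lim: "AE \<omega> in P. (\<lambda>j. simple_integral W (n j) (p j) (\<lambda>i. H (p j i)) \<omega>) \<longlonglongrightarrow> I \<omega>"
      by (rule ito_riemann_sums[OF W ab I lip g]) (rule that)
    have p: "p j 0 = a" "p j (n j) = b" "\<And>i. i < n j \<Longrightarrow> p j i < p j (Suc i)" "\<And>i. i \<le> n j \<Longrightarrow> p j i \<in> {a..b}" for j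
      using p' by auto
    let ?G = "expectation (\<lambda>\<omega>. indicator B \<omega> * g \<omega> ^ (2 * k))"
    let ?c = "C' * ((b - a) ^ k * ?G)"
    have BP[measurable]: "B \<in> sets P" using B sets_filtration[of a] ab by auto
    have Ha: "H a \<omega> = 0" if "\<omega> \<in> space P" for \<omega> using lip that unfolding noise_lipschitz_def by auto
    \<comment> \<open>B is known at time a, so its indicator can be moved into the integrand and
      into the Lipschitz factor alike.\<close>
    have lipB: "noise_lipschitz a b (\<lambda>\<omega>. indicator B \<omega> * g \<omega>) (\<lambda>t \<omega>. indicator B \<omega> *\<^sub>R H t \<omega>)"
      using lip unfolding noise_lipschitz_def by (auto simp: indicator_def)
    have Hm: "H t \<in> borel_measurable (F t)" if "t \<in> {a..b}" for t
      using ito_integrand_measurable[OF I that] .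
    have Bt: "B \<in> sets (F t)" if "t \<in> {a..b}" for t
    proof -
      have "subalgebra (F t) (F a)" using filtration that ab unfolding filtration_on_def by auto
      then show ?thesis using B unfolding subalgebra_def by auto
    qed
    have HBm: "(\<lambda>\<omega>. indicator B \<omega> *\<^sub>R H t \<omega>) \<in> borel_measurable (F t)" if "t \<in> {a..b}" for t
      using Hm[OF that] Bt[OF that] by measurable
    have gBm: "(\<lambda>\<omega>. indicator B \<omega> * g \<omega>) \<in> borel_measurable (F a)"
      using g(1) B by measurable
    have pow: "(indicator B \<omega> * x) ^ (2 * k) = indicator B \<omega> * x ^ (2 * k)" for \<omega> and x :: real
      using k by (auto simp: indicator_def)
    have gBk: "integrable P (\<lambda>\<omega>. (indicator B \<omega> * g \<omega>) ^ (2 * k))"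
      unfolding pow using gk integrable_mult_indicator[OF BP gk] by simp
    define R where "R j = simple_integral W (n j) (p j) (\<lambda>i \<omega>. indicator B \<omega> *\<^sub>R H (p j i) \<omega>)" for j
    have Rm: "R j \<in> borel_measurable (F b)" for j
      unfolding R_def
    proof (rule simple_integral_measurable[OF W])
      show "(\<lambda>\<omega>. indicator B \<omega> *\<^sub>R H (p j i) \<omega>) \<in> borel_measurable (F (p j i))" if "i < n j" for i
        using HBm p(4)[of i j] that by simp
    qed (use p ab in auto)
    have RP: "R j \<in> borel_measurable P" for j
      using Rm ab by (intro measurable_filtration[of b]) auto
    have Req: "R j \<omega> = indicator B \<omega> *\<^sub>R simple_integral W (n j) (p j) (\<lambda>i. H (p j i)) \<omega>" for j \<omega>
      unfolding R_def simple_integral_def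
      by (simp add: scaleR_sum_right scaleR_matrix_vector_assoc)
    have IP: "I \<in> borel_measurable P" using I unfolding has_ito_integral_def by blast
    have bound: "(\<integral>\<^sup>+\<omega>. ennreal (norm (R j \<omega>) ^ (2 * k)) \<partial>P) \<le> ennreal ?c" for j
    proof -
      have x: "(\<lambda>\<omega>. indicator B \<omega> *\<^sub>R H (p j i) \<omega>) \<in> borel_measurable (F (p j i)) \<and>
        integrable P (\<lambda>\<omega>. norm (indicator B \<omega> *\<^sub>R H (p j i) \<omega>) ^ (2 * k)) \<and>
        expectation (\<lambda>\<omega>. norm (indicator B \<omega> *\<^sub>R H (p j i) \<omega>) ^ (2 * k)) \<le> noise_bound k * (b - a) ^ k * ?G"
        if i: "i < n j" for i
      proof -
        have pi: "a \<le> p j i" "p j i \<le> b" using p(4)[of i j] i by auto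
        note m = noise_lipschitz_moment[OF ab(1,3) k HBm lipB gBm gBk, of a "p j i"]
        have eq: "norm (indicator B \<omega> *\<^sub>R H (p j i) \<omega> - indicator B \<omega> *\<^sub>R H a \<omega>) = norm (indicator B \<omega> *\<^sub>R H (p j i) \<omega>)"
          if "\<omega> \<in> space P" for \<omega> using Ha[OF that] by simp
        let ?d = "\<lambda>\<omega>. norm (indicator B \<omega> *\<^sub>R H (p j i) \<omega> - indicator B \<omega> *\<^sub>R H a \<omega>) ^ (2 * k)"
        let ?e = "\<lambda>\<omega>. norm (indicator B \<omega> *\<^sub>R H (p j i) \<omega>) ^ (2 * k)"
        have "integrable P ?d = integrable P ?e"
          by (rule Bochner_Integration.integrable_cong[OF refl]) (simp only: eq)
        then have int: "integrable P ?e" using m(1) pi by simp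
        have "expectation ?d = expectation ?e"
          by (rule Bochner_Integration.integral_cong[OF refl]) (simp only: eq)
        then have "expectation ?e \<le> noise_bound k * (p j i - a) ^ k * ?G"
          using m(2) pi unfolding pow by simp
        also have "\<dots> \<le> noise_bound k * (b - a) ^ k * ?G"
        proof (intro mult_right_mono mult_left_mono power_mono noise_bound_nonneg)
          show "0 \<le> ?G" by (intro Bochner_Integration.integral_nonneg) (auto simp: indicator_def)
        qed (use pi in auto)
        finally show ?thesis using int HBm pi by auto
      qed
      have m: "integrable P (\<lambda>\<omega>. norm (R j \<omega>) ^ (2 * k)) \<and>
        expectation (\<lambda>\<omega>. norm (R j \<omega>) ^ (2 * k))
          \<le> C * (\<Sum>r<n j. (p j (Suc r) - p j r) * expectation (\<lambda>\<omega>. norm (indicator B \<omega> *\<^sub>R H (p j r) \<omega>) ^ (2 * k)))"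
        unfolding R_def using x by (intro C(2)[OF W]) (use p(1-3) ab in auto)
      have "expectation (\<lambda>\<omega>. norm (R j \<omega>) ^ (2 * k)) \<le> C * (\<Sum>r<n j. (p j (Suc r) - p j r) * (noise_bound k * (b - a) ^ k * ?G))"
        using x p(3) C(1) by (intro order_trans[OF conjunct2[OF m]] mult_left_mono sum_mono) (auto intro: less_imp_le)
      also have "\<dots> = C * ((b - a) * (noise_bound k * (b - a) ^ k * ?G))"
        using p(1,2) by (simp add: sum_distrib_right[symmetric] sum_lessThan_telescope)
      \<comment> \<open>The cell lengths add up to b - a. This extra factor is given away as T,
        since (b - a)^k is already the order of \<open>\<sigma>\<close> times a Brownian
        increment.\<close>
      also have "\<dots> \<le> C * (T * (noise_bound k * (b - a) ^ k * ?G))"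
      proof (intro mult_left_mono mult_right_mono mult_nonneg_nonneg noise_bound_nonneg C(1))
        show "0 \<le> ?G" by (intro Bochner_Integration.integral_nonneg) (auto simp: indicator_def)
      qed (use ab in auto)
      also have "\<dots> = ?c" by (simp add: C'_def)
      finally show ?thesis using m by (subst nn_integral_eq_integral) (auto intro: ennreal_leI)
    qed
    have le: "(\<integral>\<^sup>+\<omega>. ennreal (norm (indicator B \<omega> *\<^sub>R I \<omega>) ^ (2 * k)) \<partial>P) \<le> ennreal ?c"
    proof (rule nn_integral_power_liminf[OF _ RP _ bound])
      show "(\<lambda>\<omega>. indicator B \<omega> *\<^sub>R I \<omega>) \<in> borel_measurable P" using IP by measurable
      show "AE \<omega> in P. (\<lambda>j. R j \<omega>) \<longlonglongrightarrow> indicator B \<omega> *\<^sub>R I \<omega>"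
        using lim unfolding Req by eventually_elim (intro tendsto_intros)
    qed
    have eq: "norm (indicator B \<omega> *\<^sub>R I \<omega>) ^ (2 * k) = indicator B \<omega> * norm (I \<omega>) ^ (2 * k)" for \<omega>
      using k by (auto simp: indicator_def)
    have int: "integrable P (\<lambda>\<omega>. indicator B \<omega> * norm (I \<omega>) ^ (2 * k))"
    proof (rule integrableI_bounded)
      show "(\<lambda>\<omega>. indicator B \<omega> * norm (I \<omega>) ^ (2 * k)) \<in> borel_measurable P" using IP by measurable
      have "(\<integral>\<^sup>+\<omega>. ennreal (norm (indicator B \<omega> * norm (I \<omega>) ^ (2 * k))) \<partial>P) \<le> ennreal ?c"
        using le unfolding eq by (simp add: abs_mult)
      also have "\<dots> < \<infinity>" by simp
      finally show "(\<integral>\<^sup>+\<omega>. ennreal (norm (indicator B \<omega> * norm (I \<omega>) ^ (2 * k))) \<partial>P) < \<infinity>" .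
    qed
    have c0: "0 \<le> ?c"
      using C' ab by (intro mult_nonneg_nonneg Bochner_Integration.integral_nonneg) (auto simp: indicator_def)
    have "ennreal (expectation (\<lambda>\<omega>. indicator B \<omega> * norm (I \<omega>) ^ (2 * k))) \<le> ennreal ?c"
      using le unfolding eq by (subst nn_integral_eq_integral[symmetric, OF int]) (auto simp: indicator_def)
    then show ?thesis using int c0 by simp
  qed
  show ?thesis
  proof (rule that[OF C'])
    fix W :: "real \<Rightarrow> 'w \<Rightarrow> real^'m" and a b and H :: "real \<Rightarrow> 'w \<Rightarrow> real^'m^'d" and I g B
    assume W: "brownian_motion T P F W" and ab: "0 \<le> a" "a < b" "b \<le> T"
      and I: "has_ito_integral P F W a b H I" and lip: "noise_lipschitz a b g H"
      and g: "g \<in> borel_measurable (F a)" "integrable P (\<lambda>\<omega>. (g \<omega>)\<^sup>2)" and B: "B \<in> sets (F a)"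
      and gk: "integrable P (\<lambda>\<omega>. g \<omega> ^ (2 * k))"
    \<comment> \<open>The unlocalised integrability is the case where B is the whole space.\<close>
    have S: "space P \<in> sets (F a)" using space_filtration[of a] ab sets.top[of "F a"] by auto
    have "integrable P (\<lambda>\<omega>. indicator (space P) \<omega> * norm (I \<omega>) ^ (2 * k))"
      using main[OF W ab I lip g S gk] by simp
    then have "integrable P (\<lambda>\<omega>. norm (I \<omega>) ^ (2 * k))"
      by (subst Bochner_Integration.integrable_cong[OF refl]) auto
    then show "integrable P (\<lambda>\<omega>. norm (I \<omega>) ^ (2 * k)) \<and>
      expectation (\<lambda>\<omega>. indicator B \<omega> * norm (I \<omega>) ^ (2 * k))
      \<le> C' * ((b - a) ^ k * expectation (\<lambda>\<omega>. indicator B \<omega> * g \<omega> ^ (2 * k)))"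
      using main[OF W ab I lip g B gk] by simp
  qed
qed

end

section \<open>Empirical measures and derivative bounds\<close>

lemma empirical_in_P2:
  fixes y :: "nat \<Rightarrow> 'a::euclidean_space"
  assumes N: "N \<ge> 1"
  shows "empirical N y \<in> P2"
proof -
  let ?U = "uniform_count_measure {1..N}"
  have y: "y \<in> measurable ?U borel"
    by (auto simp: measurable_def space_uniform_count_measure sets_uniform_count_measure)
  interpret U: prob_space ?U using N by (intro prob_space_uniform_count_measure) auto
  have "integrable ?U (\<lambda>j. (norm (y j))\<^sup>2)"
    unfolding uniform_count_measure_def by (rule integrable_point_measure_finite) simp
  then show ?thesis
    unfolding P2_def empirical_def using y U.prob_space_distr[OF y]
    by (simp add: integrable_distr_eq)
qed

text \<open>The coupling pairs points with equal index: it is the law of (y J, z J) for a uniformly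
  distributed index J. It need not be optimal, but its cost bounds the infimum.\<close>

lemma W2_empirical_le:
  fixes y z :: "nat \<Rightarrow> 'a::euclidean_space"
  assumes N: "N \<ge> 1"
  shows "W2 (empirical N y) (empirical N z) \<le> sqrt ((\<Sum>j\<in>{1..N}. (norm (y j - z j))\<^sup>2) / real N)"
proof -
  let ?U = "uniform_count_measure {1..N}"
  let ?f = "\<lambda>j. (y j, z j)"
  define \<pi> where "\<pi> = distr ?U (borel \<Otimes>\<^sub>M borel) ?f"
  have m: "?f \<in> measurable ?U (borel \<Otimes>\<^sub>M borel)"
    by (auto simp: measurable_def space_uniform_count_measure sets_uniform_count_measure space_pair_measure)
  have "\<pi> \<in> couplings (empirical N y) (empirical N z)"
    unfolding couplings_def \<pi>_def empirical_def using m by (simp add: distr_distr comp_def)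
  moreover have "(\<integral>w. (norm (fst w - snd w))\<^sup>2 \<partial>\<pi>) = (\<Sum>j\<in>{1..N}. (norm (y j - z j))\<^sup>2) / real N"
    unfolding \<pi>_def using m by (subst integral_distr) (auto simp: integral_uniform_count_measure)
  moreover have "bdd_below ((\<lambda>\<pi>. sqrt (\<integral>w. (norm (fst w - snd w))\<^sup>2 \<partial>\<pi>)) ` couplings (empirical N y) (empirical N z))"
    by (intro bdd_belowI2[of _ 0]) simp
  ultimately show ?thesis
    unfolding W2_def by (metis (no_types, lifting) cINF_lower)
qed

text \<open>Needed to make the coefficients, evaluated at a particle and the empirical measure,
  random variables. By \<open>W2_empirical_le\<close> the points whose empirical measure lies in an
  open set form an open set of the product topology, because only finitely many coordinates
  matter.\<close>

lemma measurable_empirical: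
  fixes y :: "nat \<Rightarrow> 'w \<Rightarrow> 'a::euclidean_space"
  assumes N: "N \<ge> 1" and y: "\<And>j. j \<in> {1..N} \<Longrightarrow> y j \<in> borel_measurable M"
  shows "(\<lambda>\<omega>. empirical N (\<lambda>j. y j \<omega>)) \<in> measurable M P2_borel"
  unfolding P2_borel_def
proof (rule measurable_measure_of)
  show "{U. openin P2_topology U} \<subseteq> Pow (P2 :: 'a measure set)" by (auto simp: openin_P2_topology)
  show "(\<lambda>\<omega>. empirical N (\<lambda>j. y j \<omega>)) \<in> space M \<rightarrow> P2" using empirical_in_P2[OF N] by auto
next
  fix U :: "'a measure set" assume "U \<in> {U. openin P2_topology U}"
  then have U: "\<And>\<mu>. \<mu> \<in> U \<Longrightarrow> \<exists>r>0. \<forall>\<nu>\<in>P2. W2 \<mu> \<nu> < r \<longrightarrow> \<nu> \<in> U"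
    by (auto simp: openin_P2_topology)
  let ?V = "{x :: nat \<Rightarrow> 'a. empirical N x \<in> U}"
  have "open ?V"
  proof (subst open_subopen, rule ballI)
    fix x assume "x \<in> ?V"
    then obtain r where r: "r > 0" "\<And>\<nu>. \<nu> \<in> P2 \<Longrightarrow> W2 (empirical N x) \<nu> < r \<Longrightarrow> \<nu> \<in> U"
      using U by blast
    let ?B = "\<Inter>j\<in>{1..N}. (\<lambda>z :: nat \<Rightarrow> 'a. z j) -` ball (x j) r"
    have "open ?B"
      by (intro open_INT ballI open_vimage) auto
    moreover have "x \<in> ?B" using r by simp
    moreover have "?B \<subseteq> ?V"
    proof
      fix z assume z: "z \<in> ?B"
      have "(\<Sum>j\<in>{1..N}. (norm (x j - z j))\<^sup>2) < (\<Sum>j\<in>{1..N}. r\<^sup>2)"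
        using z N by (intro sum_strict_mono) (auto simp: dist_norm intro!: power_strict_mono)
      then have "(\<Sum>j\<in>{1..N}. (norm (x j - z j))\<^sup>2) / real N < r\<^sup>2"
        using N by (simp add: field_simps)
      then have "sqrt ((\<Sum>j\<in>{1..N}. (norm (x j - z j))\<^sup>2) / real N) < sqrt (r\<^sup>2)"
        by (rule real_sqrt_less_mono)
      then have "W2 (empirical N x) (empirical N z) < r"
        using W2_empirical_le[OF N, of x z] r by simp
      then show "z \<in> ?V" using r(2)[OF empirical_in_P2[OF N]] by simp
    qed
    ultimately show "\<exists>T. open T \<and> x \<in> T \<and> T \<subseteq> ?V" by blast
  qed
  then have V: "?V \<in> sets borel" by simp
  \<comment> \<open>Nothing is assumed about \<open>y j\<close> outside 1..N. Those coordinates are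
    set to 0, which leaves the empirical measure unchanged.\<close>
  let ?g = "\<lambda>\<omega> j. if j \<in> {1..N} then y j \<omega> else 0"
  have "?g \<in> borel_measurable M"
  proof (rule measurable_coordinatewise_then_product)
    fix i show "(\<lambda>\<omega>. ?g \<omega> i) \<in> borel_measurable M"
    proof (cases "i \<in> {1..N}")
      case True
      then show ?thesis using y[OF True] by simp
    next
      case False
      then have "(\<lambda>\<omega>. ?g \<omega> i) = (\<lambda>\<omega>. 0)" by auto
      then show ?thesis by simp
    qed
  qed
  from measurable_sets[OF this V] have "?g -` ?V \<inter> space M \<in> sets M" .
  moreover have "empirical N (?g \<omega>) = empirical N (\<lambda>j. y j \<omega>)" for \<omega>
    unfolding empirical_def by (rule distr_cong) (auto simp: space_uniform_count_measure)
  ultimately show "(\<lambda>\<omega>. empirical N (\<lambda>j. y j \<omega>)) -` U \<inter> space M \<in> sets M"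
    by (simp add: vimage_def)
qed

section \<open>Bounds for derivatives as linear operators\<close>

text \<open>The derivative is tested along x + t v with small t > 0. In this way the gradient of
  \<open>\<sigma>\<close> inherits its bound from the Lipschitz condition.\<close>

lemma has_derivative_lipschitz_bound:
  fixes f :: "'a::real_normed_vector \<Rightarrow> 'b::real_normed_vector"
  assumes f: "(f has_derivative D) (at x)" and lip: "\<And>y. norm (f y - f x) \<le> L * norm (y - x)"
  shows "norm (D v) \<le> L * norm v"
proof (cases "v = 0")
  case True
  then show ?thesis using has_derivative_linear[OF f] by (simp add: linear_0)
next
  case False
  have lin: "linear D" using f by (rule has_derivative_linear)
  show ?thesis
  proof (rule field_le_epsilon)
    fix e :: real assume e: "e > 0"
    define \<eta> where "\<eta> = e / norm v"
    have \<eta>: "\<eta> > 0" using e False by (simp add: \<eta>_def)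
    obtain d where d: "d > 0"
      "\<And>x'. 0 < norm (x' - x) \<and> norm (x' - x) < d \<Longrightarrow> norm (f x' - f x - D (x' - x)) / norm (x' - x) < \<eta>"
      using f \<eta> unfolding has_derivative_at' by blast
    define t where "t = d / (2 * norm v)"
    have t: "t > 0" "t * norm v < d" using d False by (auto simp: t_def)
    have "norm (f (x + t *\<^sub>R v) - f x - D (t *\<^sub>R v)) / (t * norm v) < \<eta>"
      using d(2)[of "x + t *\<^sub>R v"] t False by simp
    then have "norm (f (x + t *\<^sub>R v) - f x - D (t *\<^sub>R v)) < \<eta> * (t * norm v)"
      using t False by (simp add: pos_divide_less_eq)
    moreover have "norm (f (x + t *\<^sub>R v) - f x) \<le> L * (t * norm v)"
      using lip[of "x + t *\<^sub>R v"] t by simp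
    moreover have "norm (D (t *\<^sub>R v)) \<le> norm (f (x + t *\<^sub>R v) - f x) + norm (f (x + t *\<^sub>R v) - f x - D (t *\<^sub>R v))"
      using norm_triangle_ineq4[of "f (x + t *\<^sub>R v) - f x" "f (x + t *\<^sub>R v) - f x - D (t *\<^sub>R v)"] by simp
    moreover have "norm (D (t *\<^sub>R v)) = t * norm (D v)" using t by (simp add: linear_cmul[OF lin])
    ultimately have "t * norm (D v) \<le> t * (L * norm v + \<eta> * norm v)" by (simp add: algebra_simps)
    then have "norm (D v) \<le> L * norm v + \<eta> * norm v" using t by simp
    then show "norm (D v) \<le> L * norm v + e" using False by (simp add: \<eta>_def)
  qed
qed

lemma norm_linear_le_hs_norm:
  fixes A :: "'a::euclidean_space \<Rightarrow> 'b::real_normed_vector"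
  assumes "linear A"
  shows "norm (A w) \<le> hs_norm A * norm w"
proof -
  have "A w = A (\<Sum>e\<in>Basis. (w \<bullet> e) *\<^sub>R e)" by (simp add: euclidean_representation)
  also have "\<dots> = (\<Sum>e\<in>Basis. (w \<bullet> e) *\<^sub>R A e)"
    by (simp add: linear_sum[OF assms] linear_cmul[OF assms])
  finally have "norm (A w) \<le> (\<Sum>e\<in>Basis. norm ((w \<bullet> e) *\<^sub>R A e))" by (metis norm_sum)
  also have "\<dots> = (\<Sum>e\<in>Basis. \<bar>norm (A e)\<bar> * \<bar>w \<bullet> e\<bar>)" by (simp add: mult.commute)
  also have "\<dots> \<le> L2_set (\<lambda>e. norm (A e)) Basis * L2_set (\<lambda>e. w \<bullet> e) Basis" by (rule L2_set_mult_ineq)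
  also have "L2_set (\<lambda>e. norm (A e)) Basis = hs_norm A" by (simp add: L2_set_def hs_norm_def)
  also have "L2_set (\<lambda>e. w \<bullet> e) Basis = norm w"
    by (simp add: L2_set_def norm_eq_sqrt_inner[of w] euclidean_inner[of w w] power2_eq_square)
  finally show ?thesis .
qed

lemma twice_cont_differentiable_imp_differentiable:
  fixes \<sigma> :: "real^'d \<Rightarrow> real^'m^'d"
  assumes "\<And>k l. twice_cont_differentiable (\<lambda>x. \<sigma> x $ k $ l)"
  shows "\<sigma> differentiable (at x)"
proof (rule differentiable_componentwise_within[THEN iffD2], rule ballI)
  fix i :: "real^'m^'d" assume "i \<in> Basis"
  then obtain k l where "i = axis k (axis l 1)" by (auto simp: Basis_vec_def)
  then have "(\<lambda>x. \<sigma> x \<bullet> i) = (\<lambda>x. \<sigma> x $ k $ l)" by (simp add: inner_axis)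
  then show "(\<lambda>x. \<sigma> x \<bullet> i) differentiable (at x)"
    using assms[of k l] unfolding twice_cont_differentiable_def differentiable_def by auto
qed

section \<open>One step of the scheme\<close>

lemma add_power_le:
  fixes x y :: real
  assumes "0 \<le> x" "0 \<le> y"
  shows "(x + y) ^ m \<le> 2 ^ m * (x ^ m + y ^ m)"
proof -
  have "(x + y) ^ m \<le> (2 * max x y) ^ m" using assms by (intro power_mono) auto
  also have "\<dots> = 2 ^ m * max x y ^ m" by (simp add: power_mult_distrib)
  also have "max x y ^ m \<le> x ^ m + y ^ m" using assms by (auto simp: max_def)
  finally show ?thesis by simp
qed

lemma norm_add_power_le: "norm (x + y) ^ m \<le> 2 ^ m * (norm x ^ m + norm y ^ m)"
  for x y :: "'a::real_normed_vector"
  by (rule order_trans[OF power_mono[OF norm_triangle_ineq]]) (auto intro: add_power_le)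

lemma integrable_bound_nonneg:
  fixes f g :: "'w \<Rightarrow> real"
  assumes "integrable M g" "f \<in> borel_measurable M"
    and "\<And>\<omega>. \<omega> \<in> space M \<Longrightarrow> 0 \<le> f \<omega>" "\<And>\<omega>. \<omega> \<in> space M \<Longrightarrow> f \<omega> \<le> g \<omega>"
  shows "integrable M f"
  using assms(1,2)
proof (rule Bochner_Integration.integrable_bound)
  show "AE \<omega> in M. norm (f \<omega>) \<le> norm (g \<omega>)"
  proof (rule AE_I2)
    fix \<omega> assume "\<omega> \<in> space M"
    then show "norm (f \<omega>) \<le> norm (g \<omega>)" using assms(3,4)[of \<omega>] by simp
  qed
qed

lemma integrable_norm_add_power:
  fixes X Y :: "'w \<Rightarrow> 'b::{second_countable_topology, real_normed_vector}"
  assumes "X \<in> borel_measurable M" "Y \<in> borel_measurable M"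
    and "integrable M (\<lambda>\<omega>. norm (X \<omega>) ^ m)" "integrable M (\<lambda>\<omega>. norm (Y \<omega>) ^ m)"
  shows "integrable M (\<lambda>\<omega>. norm (X \<omega> + Y \<omega>) ^ m)"
proof (rule integrable_bound_nonneg)
  show "integrable M (\<lambda>\<omega>. 2 ^ m * (norm (X \<omega>) ^ m + norm (Y \<omega>) ^ m))" using assms by auto
  show "(\<lambda>\<omega>. norm (X \<omega> + Y \<omega>) ^ m) \<in> borel_measurable M" using assms by measurable
qed (auto intro: norm_add_power_le)

lemma (in prob_space) integrable_norm_power_le:
  fixes X :: "'a \<Rightarrow> 'b::real_normed_vector"
  assumes "X \<in> borel_measurable M" "integrable M (\<lambda>\<omega>. norm (X \<omega>) ^ n)" "m \<le> n"
  shows "integrable M (\<lambda>\<omega>. norm (X \<omega>) ^ m)"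
proof (rule integrable_bound_nonneg)
  show "integrable M (\<lambda>\<omega>. 1 + norm (X \<omega>) ^ n)" using assms by auto
  show "(\<lambda>\<omega>. norm (X \<omega>) ^ m) \<in> borel_measurable M" using assms by measurable
qed (use assms in \<open>auto intro: power_le_one_add_power\<close>)

lemma (in prob_space) integrable_const_add_norm_square_power:
  fixes X :: "'a \<Rightarrow> 'b::real_normed_vector"
  assumes "X \<in> borel_measurable M" "integrable M (\<lambda>\<omega>. norm (X \<omega>) ^ (2 * k))" "e \<ge> 0"
  shows "integrable M (\<lambda>\<omega>. (e + (norm (X \<omega>))\<^sup>2) ^ k)"
proof (rule integrable_bound_nonneg)
  show "integrable M (\<lambda>\<omega>. 2 ^ k * (e ^ k + norm (X \<omega>) ^ (2 * k)))" using assms by auto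
  show "(\<lambda>\<omega>. (e + (norm (X \<omega>))\<^sup>2) ^ k) \<in> borel_measurable M" using assms by measurable
  fix \<omega>
  show "0 \<le> (e + (norm (X \<omega>))\<^sup>2) ^ k" using assms by simp
  show "(e + (norm (X \<omega>))\<^sup>2) ^ k \<le> 2 ^ k * (e ^ k + norm (X \<omega>) ^ (2 * k))"
    using add_power_le[of e "(norm (X \<omega>))\<^sup>2" k] assms by (simp add: power_mult)
qed

lemma linear_DL_op: "linear (DL_op P \<sigma> x \<mu> y)"
  by (rule linearI) (simp_all add: DL_op_def vec_eq_iff inner_add_right)

section \<open>Bounds on the coefficients and the noise of one step\<close>

text \<open>The hypotheses in the form the estimates use: at empirical measures of N points, with a
  single constant L and an integer exponent q. No bound depends on the points y of the measure,
  which is why the moments of different particles decouple.\<close>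

locale milstein_coefficients = interacting_noise P F T N Ws
  for P :: "'w measure" and F :: "real \<Rightarrow> 'w measure" and T :: real
    and N :: nat and Ws :: "nat \<Rightarrow> real \<Rightarrow> 'w \<Rightarrow> real^'m" +
  fixes b :: "real^'d \<Rightarrow> (real^'d) measure \<Rightarrow> real^'d"
    and \<sigma> :: "real^'d \<Rightarrow> (real^'d) measure \<Rightarrow> real^'m^'d"
    and X0s :: "nat \<Rightarrow> 'w \<Rightarrow> real^'d"
    and L :: real and q :: nat
  assumes X0_measurable: "\<And>i. i \<in> {1..N} \<Longrightarrow> X0s i \<in> borel_measurable (F 0)"
    and X0_moment: "\<And>i k. i \<in> {1..N} \<Longrightarrow> integrable P (\<lambda>\<omega>. norm (X0s i \<omega>) ^ k)"
    and b_measurable: "(\<lambda>(x, \<mu>). b x \<mu>) \<in> borel_measurable (borel \<Otimes>\<^sub>M P2_borel)"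
    and \<sigma>_measurable: "(\<lambda>(x, \<mu>). \<sigma> x \<mu>) \<in> borel_measurable (borel \<Otimes>\<^sub>M P2_borel)"
    and L_pos: "L > 0"
    and b_inner: "\<And>x y. x \<bullet> b x (empirical N y) \<le> L * (1 + (norm x)\<^sup>2)"
    and b_growth: "\<And>x y. norm (b x (empirical N y)) \<le> L * ((1 + norm x) * (1 + norm x ^ q))"
    and \<sigma>_growth: "\<And>x y. norm (\<sigma> x (empirical N y)) \<le> L * (1 + norm x)"
    and grad_linear: "\<And>x y. linear (grad_op \<sigma> x (empirical N y))"
    and grad_bound: "\<And>x y w. norm (grad_op \<sigma> x (empirical N y) (\<sigma> x (empirical N y) *v w)) \<le> L * (1 + norm x) * norm w"
    and DL_bound: "\<And>x y z w. norm (DL_op P \<sigma> x (empirical N y) z (\<sigma> z (empirical N y) *v w)) \<le> L * norm w"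
begin

text \<open>The moments demanded here are finite but not uniform in the number of steps. They
  justify splitting expectations and using the martingale property; uniform bounds are derived
  separately.\<close>

definition adapted :: "(nat \<Rightarrow> 'w \<Rightarrow> real^'d) \<Rightarrow> real \<Rightarrow> bool" where
  "adapted Y t \<longleftrightarrow> (\<forall>i\<in>{1..N}. Y i \<in> borel_measurable (F t) \<and> (\<forall>k. integrable P (\<lambda>\<omega>. norm (Y i \<omega>) ^ k)))"

abbreviation law :: "(nat \<Rightarrow> 'w \<Rightarrow> real^'d) \<Rightarrow> 'w \<Rightarrow> (real^'d) measure" where
  "law Y \<omega> \<equiv> empirical N (\<lambda>j. Y j \<omega>)"

abbreviation self_term :: "(nat \<Rightarrow> 'w \<Rightarrow> real^'d) \<Rightarrow> real \<Rightarrow> nat \<Rightarrow> real \<Rightarrow> 'w \<Rightarrow> real^'m^'d" where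
  "self_term Y a i s \<omega> \<equiv> grad_op \<sigma> (Y i \<omega>) (law Y \<omega>) (\<sigma> (Y i \<omega>) (law Y \<omega>) *v (Ws i s \<omega> - Ws i a \<omega>))"

abbreviation interaction_term :: "(nat \<Rightarrow> 'w \<Rightarrow> real^'d) \<Rightarrow> real \<Rightarrow> nat \<Rightarrow> real \<Rightarrow> 'w \<Rightarrow> real^'m^'d" where
  "interaction_term Y a i s \<omega> \<equiv> (1 / real N) *\<^sub>R (\<Sum>j\<in>{1..N}.
      DL_op P \<sigma> (Y i \<omega>) (law Y \<omega>) (Y j \<omega>) (\<sigma> (Y j \<omega>) (law Y \<omega>) *v (Ws j s \<omega> - Ws j a \<omega>)))"

lemma noise_lipschitz_self:
  assumes "i \<in> {1..N}"
  shows "noise_lipschitz a c (\<lambda>\<omega>. L * (1 + norm (Y i \<omega>))) (self_term Y a i)"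
  unfolding noise_lipschitz_def
proof (intro ballI conjI)
  fix \<omega> r s
  show "self_term Y a i a \<omega> = 0" by (simp add: linear_0[OF grad_linear])
  show "0 \<le> L * (1 + norm (Y i \<omega>))" using L_pos by simp
  have "self_term Y a i s \<omega> - self_term Y a i r \<omega> =
      grad_op \<sigma> (Y i \<omega>) (law Y \<omega>) (\<sigma> (Y i \<omega>) (law Y \<omega>) *v (Ws i s \<omega> - Ws i r \<omega>))"
    by (simp add: linear_diff[OF grad_linear, symmetric] matrix_vector_mult_diff_distrib[symmetric])
  also have "norm \<dots> \<le> L * (1 + norm (Y i \<omega>)) * norm (Ws i s \<omega> - Ws i r \<omega>)"
    by (rule grad_bound)
  also have "norm (Ws i s \<omega> - Ws i r \<omega>) \<le> noise r s \<omega>"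
    unfolding noise_def using assms by (intro member_le_sum) auto
  finally show "norm (self_term Y a i s \<omega> - self_term Y a i r \<omega>) \<le> L * (1 + norm (Y i \<omega>)) * noise r s \<omega>"
    using L_pos by (simp add: mult_left_mono)
qed

lemma noise_lipschitz_interaction:
  "noise_lipschitz a c (\<lambda>\<omega>. L * (1 + norm (Y i \<omega>))) (interaction_term Y a i)"
  unfolding noise_lipschitz_def
proof (intro ballI conjI)
  fix \<omega> r s
  show "interaction_term Y a i a \<omega> = 0" by (simp add: linear_0[OF linear_DL_op])
  show "0 \<le> L * (1 + norm (Y i \<omega>))" using L_pos by simp
  let ?D = "\<lambda>j. DL_op P \<sigma> (Y i \<omega>) (law Y \<omega>) (Y j \<omega>) (\<sigma> (Y j \<omega>) (law Y \<omega>) *v (Ws j s \<omega> - Ws j r \<omega>))"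
  have "interaction_term Y a i s \<omega> - interaction_term Y a i r \<omega> = (1 / real N) *\<^sub>R (\<Sum>j\<in>{1..N}. ?D j)"
    by (simp add: linear_diff[OF linear_DL_op, symmetric] matrix_vector_mult_diff_distrib[symmetric]
        scaleR_diff_right[symmetric] sum_subtractf[symmetric])
  \<comment> \<open>The average over the particles is estimated by the sum, since
    \<open>noise\<close> is a sum over all particles as well.\<close>
  also have "norm \<dots> \<le> 1 * norm (\<Sum>j\<in>{1..N}. ?D j)"
    unfolding norm_scaleR using N by (intro mult_right_mono) auto
  also have "\<dots> \<le> (\<Sum>j\<in>{1..N}. L * norm (Ws j s \<omega> - Ws j r \<omega>))"
    by (simp only: mult_1, intro order_trans[OF norm_sum] sum_mono DL_bound)
  also have "\<dots> = L * noise r s \<omega>" by (simp add: noise_def sum_distrib_left)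
  \<comment> \<open>The factor L would suffice here. It is enlarged so that both Ito integrals share
    the same random Lipschitz factor.\<close>
  also have "\<dots> \<le> (L * (1 + norm (Y i \<omega>))) * noise r s \<omega>"
    using L_pos noise_nonneg by (intro mult_right_mono) auto
  finally show "norm (interaction_term Y a i s \<omega> - interaction_term Y a i r \<omega>) \<le> L * (1 + norm (Y i \<omega>)) * noise r s \<omega>" .
qed

lemma coefficients_measurable:
  assumes "\<And>j. j \<in> {1..N} \<Longrightarrow> Y j \<in> borel_measurable M" "i \<in> {1..N}"
  shows "(\<lambda>\<omega>. b (Y i \<omega>) (law Y \<omega>)) \<in> borel_measurable M" "(\<lambda>\<omega>. \<sigma> (Y i \<omega>) (law Y \<omega>)) \<in> borel_measurable M"
proof -
  have "(\<lambda>\<omega>. (Y i \<omega>, law Y \<omega>)) \<in> measurable M (borel \<Otimes>\<^sub>M P2_borel)"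
    using assms by (intro measurable_Pair measurable_empirical[OF N]) auto
  from measurable_compose[OF this b_measurable] measurable_compose[OF this \<sigma>_measurable]
  show "(\<lambda>\<omega>. b (Y i \<omega>) (law Y \<omega>)) \<in> borel_measurable M" "(\<lambda>\<omega>. \<sigma> (Y i \<omega>) (law Y \<omega>)) \<in> borel_measurable M"
    by simp_all
qed

text \<open>All of a step except the drift. It is a predicate and not a function because the two Ito
  integrals are determined only almost surely.\<close>

definition increment :: "(nat \<Rightarrow> 'w \<Rightarrow> real^'d) \<Rightarrow> real \<Rightarrow> real \<Rightarrow> nat \<Rightarrow> ('w \<Rightarrow> real^'d) \<Rightarrow> bool" where
  "increment Y a c i X \<longleftrightarrow> (\<exists>I J. has_ito_integral P F (Ws i) a c (self_term Y a i) I \<and>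
     has_ito_integral P F (Ws i) a c (interaction_term Y a i) J \<and>
     X = (\<lambda>\<omega>. \<sigma> (Y i \<omega>) (law Y \<omega>) *v (Ws i c \<omega> - Ws i a \<omega>) + I \<omega> + J \<omega>))"

lemma integrable_growth:
  assumes "adapted Y a" "0 \<le> a" "a \<le> T" "i \<in> {1..N}"
  shows "(\<lambda>\<omega>. L * (1 + norm (Y i \<omega>))) \<in> borel_measurable (F a)"
    and "integrable P (\<lambda>\<omega>. (L * (1 + norm (Y i \<omega>))) ^ m)"
proof -
  have Ym: "Y i \<in> borel_measurable (F a)" and Yi: "\<And>k. integrable P (\<lambda>\<omega>. norm (Y i \<omega>) ^ k)"
    using assms unfolding adapted_def by auto
  show "(\<lambda>\<omega>. L * (1 + norm (Y i \<omega>))) \<in> borel_measurable (F a)" using Ym by measurable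
  have [measurable]: "Y i \<in> borel_measurable P" using Ym assms by (intro measurable_filtration[of a]) auto
  show "integrable P (\<lambda>\<omega>. (L * (1 + norm (Y i \<omega>))) ^ m)"
  proof (rule integrable_bound_nonneg)
    show "integrable P (\<lambda>\<omega>. L ^ m * (2 ^ m * (1 ^ m + norm (Y i \<omega>) ^ m)))" using Yi by auto
    fix \<omega>
    show "0 \<le> (L * (1 + norm (Y i \<omega>))) ^ m" using L_pos by simp
    show "(L * (1 + norm (Y i \<omega>))) ^ m \<le> L ^ m * (2 ^ m * (1 ^ m + norm (Y i \<omega>) ^ m))"
      unfolding power_mult_distrib using L_pos add_power_le[of 1 "norm (Y i \<omega>)" m] by (intro mult_left_mono) auto
  qed measurable
qed

text \<open>The order (c - a)^k is dictated by \<open>\<sigma>\<close> times the Brownian increment;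
  the two Ito integrals obey a bound of the same form with the same growth factor. The last clause
  is the martingale property that removes linear terms.\<close>

lemma increment_properties:
  assumes k: "k \<ge> 1"
  obtains C where "C \<ge> 0" "\<forall>a c i Y X. 0 \<le> a \<longrightarrow> a < c \<longrightarrow> c \<le> T \<longrightarrow> i \<in> {1..N} \<longrightarrow> adapted Y a \<longrightarrow> increment Y a c i X \<longrightarrow>
    X \<in> borel_measurable (F c) \<and> integrable P (\<lambda>\<omega>. norm (X \<omega>) ^ (2 * k)) \<and>
    (\<forall>B\<in>sets (F a). expectation (\<lambda>\<omega>. indicator B \<omega> * norm (X \<omega>) ^ (2 * k))
       \<le> C * ((c - a) ^ k * expectation (\<lambda>\<omega>. indicator B \<omega> * (L * (1 + norm (Y i \<omega>))) ^ (2 * k)))) \<and>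
    (\<forall>Z :: 'w \<Rightarrow> real^'d. Z \<in> borel_measurable (F a) \<longrightarrow> integrable P (\<lambda>\<omega>. (norm (Z \<omega>))\<^sup>2) \<longrightarrow>
       integrable P (\<lambda>\<omega>. Z \<omega> \<bullet> X \<omega>) \<and> expectation (\<lambda>\<omega>. Z \<omega> \<bullet> X \<omega>) = 0)"
proof -
  obtain C1 where C1: "C1 \<ge> 0" "\<And>(W :: real \<Rightarrow> 'w \<Rightarrow> real^'m) a b (H :: real \<Rightarrow> 'w \<Rightarrow> real^'m^'d) I g B.
    brownian_motion T P F W \<Longrightarrow> 0 \<le> a \<Longrightarrow> a < b \<Longrightarrow> b \<le> T \<Longrightarrow>
    has_ito_integral P F W a b H I \<Longrightarrow> noise_lipschitz a b g H \<Longrightarrow>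
    g \<in> borel_measurable (F a) \<Longrightarrow> integrable P (\<lambda>\<omega>. (g \<omega>)\<^sup>2) \<Longrightarrow> B \<in> sets (F a) \<Longrightarrow>
    integrable P (\<lambda>\<omega>. g \<omega> ^ (2 * k)) \<Longrightarrow>
    integrable P (\<lambda>\<omega>. norm (I \<omega>) ^ (2 * k)) \<and>
    expectation (\<lambda>\<omega>. indicator B \<omega> * norm (I \<omega>) ^ (2 * k))
      \<le> C1 * ((b - a) ^ k * expectation (\<lambda>\<omega>. indicator B \<omega> * g \<omega> ^ (2 * k)))"
    by (rule ito_integral_moment[OF k]) (rule that, assumption, blast)
  define G where "G = gauss_bound TYPE('m) k"
  have G: "G \<ge> 0" by (simp add: G_def gauss_bound_def)
  \<comment> \<open>From applying \<open>norm_add_power_le\<close> twice to (S + I) + J, with G for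
    the Brownian part S and \<open>C1\<close> for each of the Ito integrals.\<close>
  define C where "C = 2 ^ (2 * k) * (2 ^ (2 * k) * (G + C1) + C1)"
  have C: "C \<ge> 0" using G C1(1) by (simp add: C_def)
  show ?thesis
  proof (rule that[OF C], intro allI impI)
    fix a c i Y X
    assume ac: "0 \<le> a" "a < c" "c \<le> T" and i: "i \<in> {1..N}" and Y: "adapted Y a" and X: "increment Y a c i X"
    from X obtain I J where I: "has_ito_integral P F (Ws i) a c (self_term Y a i) I"
      and J: "has_ito_integral P F (Ws i) a c (interaction_term Y a i) J"
      and Xeq: "X = (\<lambda>\<omega>. \<sigma> (Y i \<omega>) (law Y \<omega>) *v (Ws i c \<omega> - Ws i a \<omega>) + I \<omega> + J \<omega>)"
      unfolding increment_def by blast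
    define g where "g \<omega> = L * (1 + norm (Y i \<omega>))" for \<omega>
    have g: "g \<in> borel_measurable (F a)" "integrable P (\<lambda>\<omega>. g \<omega> ^ m)" for m
      using integrable_growth[OF Y ac(1) _ i] ac unfolding g_def[abs_def] by auto
    have Ym: "Y j \<in> borel_measurable (F a)" if "j \<in> {1..N}" for j using Y that unfolding adapted_def by auto
    define V where "V \<omega> = \<sigma> (Y i \<omega>) (law Y \<omega>)" for \<omega>
    define S where "S \<omega> = V \<omega> *v (Ws i c \<omega> - Ws i a \<omega>)" for \<omega>
    have Xeq': "X \<omega> = S \<omega> + I \<omega> + J \<omega>" for \<omega> by (simp add: Xeq S_def V_def)
    have Vm: "V \<in> borel_measurable (F a)" unfolding V_def[abs_def] by (rule coefficients_measurable[OF Ym i])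
    have Vg: "norm (V \<omega>) \<le> g \<omega>" for \<omega> unfolding V_def g_def by (rule \<sigma>_growth)
    have g0: "0 \<le> g \<omega>" for \<omega> unfolding g_def using L_pos by simp
    have W: "brownian_motion T P F (Ws i)" by (rule BM[OF i])
    have Im: "I \<in> borel_measurable (F c)" "integrable P (\<lambda>\<omega>. (norm (I \<omega>))\<^sup>2)"
      and IZ: "\<And>Z :: 'w \<Rightarrow> real^'d. Z \<in> borel_measurable (F a) \<Longrightarrow> integrable P (\<lambda>\<omega>. (norm (Z \<omega>))\<^sup>2) \<Longrightarrow>
        integrable P (\<lambda>\<omega>. Z \<omega> \<bullet> I \<omega>) \<and> expectation (\<lambda>\<omega>. Z \<omega> \<bullet> I \<omega>) = 0"
      using ito_integral_square_integrable[OF W ac(1) less_imp_le[OF ac(2)] ac(3) I] by blast+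
    have Jm: "J \<in> borel_measurable (F c)" "integrable P (\<lambda>\<omega>. (norm (J \<omega>))\<^sup>2)"
      and JZ: "\<And>Z :: 'w \<Rightarrow> real^'d. Z \<in> borel_measurable (F a) \<Longrightarrow> integrable P (\<lambda>\<omega>. (norm (Z \<omega>))\<^sup>2) \<Longrightarrow>
        integrable P (\<lambda>\<omega>. Z \<omega> \<bullet> J \<omega>) \<and> expectation (\<lambda>\<omega>. Z \<omega> \<bullet> J \<omega>) = 0"
      using ito_integral_square_integrable[OF W ac(1) less_imp_le[OF ac(2)] ac(3) J] by blast+
    have Vc: "V \<in> borel_measurable (F c)" using Vm ac by (intro measurable_filtration_mono[of a c]) auto
    have Wc: "Ws i c \<in> borel_measurable (F c)" "Ws i a \<in> borel_measurable (F c)"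
      using ac by (auto intro!: BM_measurable[OF W])
    have Sm: "S \<in> borel_measurable (F c)" unfolding S_def[abs_def] using Vc Wc by measurable
    have Xm: "X \<in> borel_measurable (F c)" unfolding Xeq'[abs_def] using Sm Im(1) Jm(1) by measurable
    have P: "f \<in> borel_measurable P" if "f \<in> borel_measurable (F c)" for f :: "'w \<Rightarrow> real^'d"
      using that ac by (intro measurable_filtration[of c]) auto
    note [measurable] = P[OF Sm] P[OF Im(1)] P[OF Jm(1)] P[OF Xm]
    have [measurable]: "g \<in> borel_measurable P" "V \<in> borel_measurable P"
      using g(1) Vm ac by (auto intro: measurable_filtration[of a])
    have [measurable]: "Ws i c \<in> borel_measurable P" "Ws i a \<in> borel_measurable P"
      using Wc ac by (auto intro: measurable_filtration[of c])
    have gD: "integrable P (\<lambda>\<omega>. indicator B \<omega> * g \<omega> ^ (2 * k) * norm (Ws i c \<omega> - Ws i a \<omega>) ^ (2 * k)) \<and>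
      expectation (\<lambda>\<omega>. indicator B \<omega> * g \<omega> ^ (2 * k) * norm (Ws i c \<omega> - Ws i a \<omega>) ^ (2 * k))
        \<le> G * ((c - a) ^ k * expectation (\<lambda>\<omega>. indicator B \<omega> * g \<omega> ^ (2 * k)))" if B: "B \<in> sets (F a)" for B
    proof -
      have BP: "B \<in> sets P" using B sets_filtration[of a] ac by auto
      have m: "(\<lambda>\<omega>. indicator B \<omega> * g \<omega> ^ (2 * k)) \<in> borel_measurable (F a)" using g(1) B by measurable
      have int: "integrable P (\<lambda>\<omega>. indicator B \<omega> * g \<omega> ^ (2 * k))"
        using integrable_mult_indicator[OF BP g(2)[of "2 * k"]] by simp
      have nn: "0 \<le> expectation (\<lambda>\<omega>. indicator B \<omega> * g \<omega> ^ (2 * k))"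
        by (intro Bochner_Integration.integral_nonneg) (auto simp: g0)
      have "expectation (\<lambda>\<omega>. indicator B \<omega> * g \<omega> ^ (2 * k) * norm (Ws i c \<omega> - Ws i a \<omega>) ^ (2 * k))
        = expectation (\<lambda>\<omega>. indicator B \<omega> * g \<omega> ^ (2 * k)) * expectation (\<lambda>\<omega>. norm (Ws i c \<omega> - Ws i a \<omega>) ^ (2 * k))"
        using expectation_mult_increment(2)[OF W ac m int, of k] .
      also have "\<dots> \<le> expectation (\<lambda>\<omega>. indicator B \<omega> * g \<omega> ^ (2 * k)) * (G * (c - a) ^ k)"
        unfolding G_def by (intro mult_left_mono increment_moment(2)[OF W ac] nn)
      finally show ?thesis using expectation_mult_increment(1)[OF W ac m int, of k] by (simp add: mult_ac)
    qed
    have Sle: "norm (S \<omega>) ^ (2 * k) \<le> g \<omega> ^ (2 * k) * norm (Ws i c \<omega> - Ws i a \<omega>) ^ (2 * k)" for \<omega>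
    proof -
      have "norm (S \<omega>) \<le> g \<omega> * norm (Ws i c \<omega> - Ws i a \<omega>)"
        unfolding S_def by (rule order_trans[OF norm_matrix_vector_mult_le]) (intro mult_right_mono Vg norm_ge_zero)
      from power_mono[OF this norm_ge_zero, of "2 * k"] show ?thesis by (simp add: power_mult_distrib)
    qed
    have spa: "space P \<in> sets (F a)" using space_filtration[of a] ac sets.top[of "F a"] by auto
    have Sint: "integrable P (\<lambda>\<omega>. norm (S \<omega>) ^ (2 * k))"
    proof (rule integrable_bound_nonneg[OF conjunct1[OF gD[OF spa]]])
      fix \<omega> assume "\<omega> \<in> space P"
      then show "norm (S \<omega>) ^ (2 * k) \<le> indicator (space P) \<omega> * g \<omega> ^ (2 * k) * norm (Ws i c \<omega> - Ws i a \<omega>) ^ (2 * k)"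
        using Sle by simp
    qed auto
    have lip: "noise_lipschitz a c g (self_term Y a i)" "noise_lipschitz a c g (interaction_term Y a i)"
      using noise_lipschitz_self[OF i, of a c Y] noise_lipschitz_interaction[of a c Y i]
      unfolding g_def[abs_def] .
    have IB: "integrable P (\<lambda>\<omega>. norm (I \<omega>) ^ (2 * k)) \<and> expectation (\<lambda>\<omega>. indicator B \<omega> * norm (I \<omega>) ^ (2 * k))
      \<le> C1 * ((c - a) ^ k * expectation (\<lambda>\<omega>. indicator B \<omega> * g \<omega> ^ (2 * k)))" if "B \<in> sets (F a)" for B
      by (rule C1(2)[OF W ac I lip(1) g(1) g(2) that g(2)])
    have JB: "integrable P (\<lambda>\<omega>. norm (J \<omega>) ^ (2 * k)) \<and> expectation (\<lambda>\<omega>. indicator B \<omega> * norm (J \<omega>) ^ (2 * k))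
      \<le> C1 * ((c - a) ^ k * expectation (\<lambda>\<omega>. indicator B \<omega> * g \<omega> ^ (2 * k)))" if "B \<in> sets (F a)" for B
      by (rule C1(2)[OF W ac J lip(2) g(1) g(2) that g(2)])
    have Iint: "integrable P (\<lambda>\<omega>. norm (I \<omega>) ^ (2 * k))" and Jint: "integrable P (\<lambda>\<omega>. norm (J \<omega>) ^ (2 * k))"
      using IB[OF spa] JB[OF spa] by auto
    have Xint: "integrable P (\<lambda>\<omega>. norm (X \<omega>) ^ (2 * k))"
      unfolding Xeq' by (intro integrable_norm_add_power Sint Iint Jint) measurable
    have Xle: "norm (X \<omega>) ^ (2 * k) \<le> 2 ^ (2 * k) * (2 ^ (2 * k) * (g \<omega> ^ (2 * k) * norm (Ws i c \<omega> - Ws i a \<omega>) ^ (2 * k)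
        + norm (I \<omega>) ^ (2 * k)) + norm (J \<omega>) ^ (2 * k))" for \<omega>
    proof -
      have "norm (X \<omega>) ^ (2 * k) \<le> 2 ^ (2 * k) * (norm (S \<omega> + I \<omega>) ^ (2 * k) + norm (J \<omega>) ^ (2 * k))"
        unfolding Xeq' by (rule norm_add_power_le)
      also have "\<dots> \<le> 2 ^ (2 * k) * (2 ^ (2 * k) * (norm (S \<omega>) ^ (2 * k) + norm (I \<omega>) ^ (2 * k)) + norm (J \<omega>) ^ (2 * k))"
        by (intro mult_left_mono add_right_mono norm_add_power_le) auto
      also have "\<dots> \<le> 2 ^ (2 * k) * (2 ^ (2 * k) * (g \<omega> ^ (2 * k) * norm (Ws i c \<omega> - Ws i a \<omega>) ^ (2 * k)
        + norm (I \<omega>) ^ (2 * k)) + norm (J \<omega>) ^ (2 * k))"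
        by (intro mult_left_mono add_right_mono Sle) auto
      finally show ?thesis .
    qed
    have XB: "expectation (\<lambda>\<omega>. indicator B \<omega> * norm (X \<omega>) ^ (2 * k))
       \<le> C * ((c - a) ^ k * expectation (\<lambda>\<omega>. indicator B \<omega> * g \<omega> ^ (2 * k)))" if B: "B \<in> sets (F a)" for B
    proof -
      have BP: "B \<in> sets P" using B sets_filtration[of a] ac by auto
      have ind: "integrable P (\<lambda>\<omega>. indicator B \<omega> * f \<omega>)" if "integrable P f" for f :: "'w \<Rightarrow> real"
        using integrable_mult_indicator[OF BP that] by simp
      note gi = conjunct1[OF gD[OF B]]
      let ?E = "(c - a) ^ k * expectation (\<lambda>\<omega>. indicator B \<omega> * g \<omega> ^ (2 * k))"
      have "expectation (\<lambda>\<omega>. indicator B \<omega> * norm (X \<omega>) ^ (2 * k)) \<le>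
        expectation (\<lambda>\<omega>. 2 ^ (2 * k) * (2 ^ (2 * k) * (indicator B \<omega> * g \<omega> ^ (2 * k) * norm (Ws i c \<omega> - Ws i a \<omega>) ^ (2 * k)
          + indicator B \<omega> * norm (I \<omega>) ^ (2 * k)) + indicator B \<omega> * norm (J \<omega>) ^ (2 * k)))"
      proof (rule integral_mono)
        show "integrable P (\<lambda>\<omega>. 2 ^ (2 * k) * (2 ^ (2 * k) * (indicator B \<omega> * g \<omega> ^ (2 * k) * norm (Ws i c \<omega> - Ws i a \<omega>) ^ (2 * k)
          + indicator B \<omega> * norm (I \<omega>) ^ (2 * k)) + indicator B \<omega> * norm (J \<omega>) ^ (2 * k)))"
          by (intro integrable_mult_right Bochner_Integration.integrable_add gi ind[OF Iint] ind[OF Jint])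
        show "indicator B \<omega> * norm (X \<omega>) ^ (2 * k) \<le> 2 ^ (2 * k) * (2 ^ (2 * k) * (indicator B \<omega> * g \<omega> ^ (2 * k) * norm (Ws i c \<omega> - Ws i a \<omega>) ^ (2 * k)
          + indicator B \<omega> * norm (I \<omega>) ^ (2 * k)) + indicator B \<omega> * norm (J \<omega>) ^ (2 * k))" for \<omega>
          using Xle[of \<omega>] by (cases "\<omega> \<in> B") simp_all
      qed (rule ind[OF Xint])
      also have "\<dots> = 2 ^ (2 * k) * (2 ^ (2 * k) * (expectation (\<lambda>\<omega>. indicator B \<omega> * g \<omega> ^ (2 * k) * norm (Ws i c \<omega> - Ws i a \<omega>) ^ (2 * k))
          + expectation (\<lambda>\<omega>. indicator B \<omega> * norm (I \<omega>) ^ (2 * k))) + expectation (\<lambda>\<omega>. indicator B \<omega> * norm (J \<omega>) ^ (2 * k)))"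
        using gi ind[OF Iint] ind[OF Jint] by simp
      also have "\<dots> \<le> 2 ^ (2 * k) * (2 ^ (2 * k) * (G * ?E + C1 * ?E) + C1 * ?E)"
        using gD[OF B] IB[OF B] JB[OF B] by (intro mult_left_mono add_mono) auto
      also have "\<dots> = C * ?E" by (simp add: C_def algebra_simps)
      finally show ?thesis .
    qed
    have XZ: "integrable P (\<lambda>\<omega>. Z \<omega> \<bullet> X \<omega>) \<and> expectation (\<lambda>\<omega>. Z \<omega> \<bullet> X \<omega>) = 0"
      if Z: "Z \<in> borel_measurable (F a)" "integrable P (\<lambda>\<omega>. (norm (Z \<omega>))\<^sup>2)" for Z :: "'w \<Rightarrow> real^'d"
    proof -
      have [measurable]: "Z \<in> borel_measurable P" using Z ac by (intro measurable_filtration[of a]) auto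
      have "integrable P (\<lambda>\<omega>. norm (Z \<omega>) * norm (V \<omega>))"
      proof (rule integrable_bound_nonneg[OF Bochner_Integration.integrable_add[OF Z(2) g(2)[of 2]]])
        fix \<omega>
        have "norm (Z \<omega>) * norm (V \<omega>) \<le> norm (Z \<omega>) * g \<omega>" by (intro mult_left_mono Vg) auto
        also have "\<dots> \<le> (norm (Z \<omega>))\<^sup>2 + (g \<omega>)\<^sup>2"
          using mult_power_le_add_power[of "norm (Z \<omega>)" "g \<omega>" 1 1] g0[of \<omega>] by (simp add: power2_eq_square)
        finally show "norm (Z \<omega>) * norm (V \<omega>) \<le> (norm (Z \<omega>))\<^sup>2 + (g \<omega>)\<^sup>2" .
      qed auto
      note SZ = expectation_inner_increment[OF W ac Z(1) Vm this, folded S_def]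
      show ?thesis using SZ IZ[OF Z] JZ[OF Z] by (simp add: Xeq' inner_add_right)
    qed
    show "X \<in> borel_measurable (F c) \<and> integrable P (\<lambda>\<omega>. norm (X \<omega>) ^ (2 * k)) \<and>
      (\<forall>B\<in>sets (F a). expectation (\<lambda>\<omega>. indicator B \<omega> * norm (X \<omega>) ^ (2 * k))
       \<le> C * ((c - a) ^ k * expectation (\<lambda>\<omega>. indicator B \<omega> * (L * (1 + norm (Y i \<omega>))) ^ (2 * k)))) \<and>
      (\<forall>Z :: 'w \<Rightarrow> real^'d. Z \<in> borel_measurable (F a) \<longrightarrow> integrable P (\<lambda>\<omega>. (norm (Z \<omega>))\<^sup>2) \<longrightarrow>
       integrable P (\<lambda>\<omega>. Z \<omega> \<bullet> X \<omega>) \<and> expectation (\<lambda>\<omega>. Z \<omega> \<bullet> X \<omega>) = 0)"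
      using Xm Xint XB XZ unfolding g_def by blast
  qed
qed

end

lemma indicator_integrable:
  fixes f :: "'w \<Rightarrow> real"
  assumes "integrable M f" "B \<in> sets M"
  shows "integrable M (\<lambda>\<omega>. indicator B \<omega> * f \<omega>)"
  using integrable_mult_indicator[OF assms(2,1)] by simp

context milstein_coefficients begin

text \<open>Apply \<open>power_increment_bound\<close> with u = e + |A|^2, s = <A,X> and w = |X|^2;
  the linear term has mean zero on B. A is the value after the drift. The weight e is only bounded
  below, because the same constant must serve e = 1 and e = 1/\<delta>^2.\<close>

lemma one_step:
  assumes k: "k \<ge> 1" and e0: "0 < e0" "e0 \<le> 1"
  obtains C where "C \<ge> 0" "\<forall>a c i Y X (A :: 'w \<Rightarrow> real^'d) e B. 0 \<le> a \<longrightarrow> a < c \<longrightarrow> c \<le> T \<longrightarrow> i \<in> {1..N} \<longrightarrow> adapted Y a \<longrightarrow>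
    increment Y a c i X \<longrightarrow> A \<in> borel_measurable (F a) \<longrightarrow> (\<forall>\<omega>. norm (A \<omega>) \<le> norm (Y i \<omega>) + 1) \<longrightarrow> e0 \<le> e \<longrightarrow> B \<in> sets (F a) \<longrightarrow>
    expectation (\<lambda>\<omega>. indicator B \<omega> * (e + (norm (A \<omega> + X \<omega>))\<^sup>2) ^ k)
      \<le> (1 + C * (c - a)) * expectation (\<lambda>\<omega>. indicator B \<omega> * (e + (norm (A \<omega>))\<^sup>2) ^ k)
        + C * ((c - a) * expectation (\<lambda>\<omega>. indicator B \<omega> * (e + (norm (Y i \<omega>))\<^sup>2) ^ k))"
proof -
  obtain c0 where c0: "c0 \<ge> 0" "\<And>h u s w :: real. 0 < h \<Longrightarrow> h \<le> T \<Longrightarrow> u \<ge> 0 \<Longrightarrow> w \<ge> 0 \<Longrightarrow> s\<^sup>2 \<le> u * w \<Longrightarrow>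
    (u + 2 * s + w) ^ k \<le> (1 + c0 * h) * u ^ k + 2 * real k * (u ^ (k - 1) * s) + c0 * (w ^ k / h ^ (k - 1))"
    using power_increment_bound[OF k T_pos] by blast
  obtain C1 where C1: "C1 \<ge> 0" and inc: "\<forall>a c i Y X. 0 \<le> a \<longrightarrow> a < c \<longrightarrow> c \<le> T \<longrightarrow> i \<in> {1..N} \<longrightarrow> adapted Y a \<longrightarrow> increment Y a c i X \<longrightarrow>
    X \<in> borel_measurable (F c) \<and> integrable P (\<lambda>\<omega>. norm (X \<omega>) ^ (2 * k)) \<and>
    (\<forall>B\<in>sets (F a). expectation (\<lambda>\<omega>. indicator B \<omega> * norm (X \<omega>) ^ (2 * k))
       \<le> C1 * ((c - a) ^ k * expectation (\<lambda>\<omega>. indicator B \<omega> * (L * (1 + norm (Y i \<omega>))) ^ (2 * k)))) \<and>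
    (\<forall>Z :: 'w \<Rightarrow> real^'d. Z \<in> borel_measurable (F a) \<longrightarrow> integrable P (\<lambda>\<omega>. (norm (Z \<omega>))\<^sup>2) \<longrightarrow>
       integrable P (\<lambda>\<omega>. Z \<omega> \<bullet> X \<omega>) \<and> expectation (\<lambda>\<omega>. Z \<omega> \<bullet> X \<omega>) = 0)"
    by (rule increment_properties[OF k]) (rule that)
  \<comment> \<open>From (1 + y)^2 <= 2 (1 + y^2) and e0 (1 + y^2) <= e + y^2, the latter by e0 <= 1
    and e0 <= e. It expresses the growth factor of the noise by the weighted moment, uniformly in
    e.\<close>
  define K0 where "K0 = (2 * L\<^sup>2 / e0) ^ k"
  have K0: "K0 \<ge> 0" using e0 by (simp add: K0_def)
  obtain l where l: "k = Suc l" using k by (cases k) auto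
  define C where "C = c0 + c0 * C1 * K0"
  have C: "C \<ge> 0" using c0(1) C1 K0 by (simp add: C_def)
  show ?thesis
  proof (rule that[OF C], intro allI impI)
    fix a c i Y X e B and A :: "'w \<Rightarrow> real^'d"
    assume ac: "0 \<le> a" "a < c" "c \<le> T" and i: "i \<in> {1..N}" and Y: "adapted Y a" and X: "increment Y a c i X"
      and A: "A \<in> borel_measurable (F a)" and AY: "\<forall>\<omega>. norm (A \<omega>) \<le> norm (Y i \<omega>) + 1" and e: "e0 \<le> e" and B: "B \<in> sets (F a)"
    let ?h = "c - a"
    have h: "0 < ?h" "?h \<le> T" using ac by auto
    have e_pos: "0 < e" using e e0 by simp
    have Xm: "X \<in> borel_measurable (F c)" and Xi: "integrable P (\<lambda>\<omega>. norm (X \<omega>) ^ (2 * k))"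
      and XB: "expectation (\<lambda>\<omega>. indicator B \<omega> * norm (X \<omega>) ^ (2 * k))
         \<le> C1 * (?h ^ k * expectation (\<lambda>\<omega>. indicator B \<omega> * (L * (1 + norm (Y i \<omega>))) ^ (2 * k)))"
      and XZ: "\<And>Z :: 'w \<Rightarrow> real^'d. Z \<in> borel_measurable (F a) \<Longrightarrow> integrable P (\<lambda>\<omega>. (norm (Z \<omega>))\<^sup>2) \<Longrightarrow>
         integrable P (\<lambda>\<omega>. Z \<omega> \<bullet> X \<omega>) \<and> expectation (\<lambda>\<omega>. Z \<omega> \<bullet> X \<omega>) = 0"
      using inc[rule_format, OF ac i Y X] B by blast+
    have BP[measurable]: "B \<in> sets P" using B sets_filtration[of a] ac by auto
    have Yi: "\<And>k. integrable P (\<lambda>\<omega>. norm (Y i \<omega>) ^ k)" and Yf: "Y i \<in> borel_measurable (F a)"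
      using Y i unfolding adapted_def by auto
    have [measurable]: "X \<in> borel_measurable P"
      by (rule measurable_filtration[OF _ _ Xm]) (use ac in auto)
    have [measurable]: "A \<in> borel_measurable P"
      by (rule measurable_filtration[OF _ _ A]) (use ac in auto)
    have [measurable]: "Y i \<in> borel_measurable P"
      by (rule measurable_filtration[OF _ _ Yf]) (use ac in auto)
    have Ai: "integrable P (\<lambda>\<omega>. norm (A \<omega>) ^ m)" for m
    proof (rule integrable_bound_nonneg)
      show "integrable P (\<lambda>\<omega>. 2 ^ m * (norm (Y i \<omega>) ^ m + 1 ^ m))" using Yi by auto
      fix \<omega>
      have "norm (A \<omega>) ^ m \<le> (norm (Y i \<omega>) + 1) ^ m" using AY by (intro power_mono) auto
      also have "\<dots> \<le> 2 ^ m * (norm (Y i \<omega>) ^ m + 1 ^ m)" by (intro add_power_le) auto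
      finally show "norm (A \<omega>) ^ m \<le> 2 ^ m * (norm (Y i \<omega>) ^ m + 1 ^ m)" .
    qed auto
    define u where "u \<omega> = e + (norm (A \<omega>))\<^sup>2" for \<omega>
    have u: "0 < u \<omega>" for \<omega> unfolding u_def using e_pos by (simp add: add_pos_nonneg)
    have ui: "integrable P (\<lambda>\<omega>. u \<omega> ^ m)" for m
      unfolding u_def using e_pos by (intro integrable_const_add_norm_square_power Ai) auto
    \<comment> \<open>Proportional to the gradient of (e + |x|^2)^k at A, cut off to B. It is known
      at time a, so its inner product with the noise has mean zero.\<close>
    define Z where "Z \<omega> = (indicator B \<omega> * u \<omega> ^ l) *\<^sub>R A \<omega>" for \<omega>
    have um: "u \<in> borel_measurable (F a)" unfolding u_def[abs_def] using A by measurable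
    have Zm: "Z \<in> borel_measurable (F a)" unfolding Z_def[abs_def]
      by (intro borel_measurable_scaleR borel_measurable_times borel_measurable_indicator borel_measurable_power B um A)
    have [measurable]: "Z \<in> borel_measurable P" using Zm ac by (intro measurable_filtration[of a]) auto
    have Zi: "integrable P (\<lambda>\<omega>. (norm (Z \<omega>))\<^sup>2)"
    proof (rule integrable_bound_nonneg[OF ui[of "Suc (2 * l)"]])
      fix \<omega>
      have "(norm (Z \<omega>))\<^sup>2 = indicator B \<omega> * (u \<omega> ^ (2 * l) * (norm (A \<omega>))\<^sup>2)"
        by (simp add: Z_def power_mult_distrib power_mult[symmetric] mult.commute indicator_def)
      also have "\<dots> \<le> 1 * (u \<omega> ^ (2 * l) * u \<omega>)"
        using u[of \<omega>] e_pos by (intro mult_mono mult_left_mono) (auto simp: u_def indicator_def)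
      finally show "(norm (Z \<omega>))\<^sup>2 \<le> u \<omega> ^ Suc (2 * l)" by (simp add: mult.commute)
    qed auto
    note ZX = XZ[OF Zm Zi]
    let ?R = "\<lambda>\<omega>. (1 + c0 * ?h) * (indicator B \<omega> * u \<omega> ^ k) + 2 * real k * (Z \<omega> \<bullet> X \<omega>) + c0 / ?h ^ l * (indicator B \<omega> * norm (X \<omega>) ^ (2 * k))"
    have le: "indicator B \<omega> * (e + (norm (A \<omega> + X \<omega>))\<^sup>2) ^ k \<le> ?R \<omega>" for \<omega>
    proof (cases "\<omega> \<in> B")
      case True
      have "(A \<omega> \<bullet> X \<omega>)\<^sup>2 \<le> (norm (A \<omega>))\<^sup>2 * (norm (X \<omega>))\<^sup>2"
        using Cauchy_Schwarz_ineq[of "A \<omega>" "X \<omega>"] by (simp add: power2_norm_eq_inner)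
      also have "\<dots> \<le> u \<omega> * (norm (X \<omega>))\<^sup>2" using e_pos by (intro mult_right_mono) (auto simp: u_def)
      finally have cs: "(A \<omega> \<bullet> X \<omega>)\<^sup>2 \<le> u \<omega> * (norm (X \<omega>))\<^sup>2" .
      have "e + (norm (A \<omega> + X \<omega>))\<^sup>2 = u \<omega> + 2 * (A \<omega> \<bullet> X \<omega>) + (norm (X \<omega>))\<^sup>2"
        by (simp add: u_def power2_norm_eq_inner inner_add_left inner_add_right inner_commute)
      then have "(e + (norm (A \<omega> + X \<omega>))\<^sup>2) ^ k \<le> (1 + c0 * ?h) * u \<omega> ^ k + 2 * real k * (u \<omega> ^ (k - 1) * (A \<omega> \<bullet> X \<omega>))
          + c0 * (((norm (X \<omega>))\<^sup>2) ^ k / ?h ^ (k - 1))"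
        using c0(2)[OF h less_imp_le[OF u] _ cs] by simp
      then show ?thesis using True by (simp add: Z_def l power_mult power2_eq_square mult.assoc)
    qed (simp add: Z_def)
    have int_l: "integrable P (\<lambda>\<omega>. indicator B \<omega> * (e + (norm (A \<omega> + X \<omega>))\<^sup>2) ^ k)"
      using e_pos by (intro indicator_integrable BP integrable_const_add_norm_square_power integrable_norm_add_power Ai Xi) auto
    have int_u: "integrable P (\<lambda>\<omega>. indicator B \<omega> * u \<omega> ^ k)" and int_X: "integrable P (\<lambda>\<omega>. indicator B \<omega> * norm (X \<omega>) ^ (2 * k))"
      by (intro indicator_integrable ui Xi BP)+
    have int_R: "integrable P ?R" using int_u int_X ZX by auto
    have int_Y: "integrable P (\<lambda>\<omega>. indicator B \<omega> * (e + (norm (Y i \<omega>))\<^sup>2) ^ k)"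
      using e_pos by (intro indicator_integrable BP integrable_const_add_norm_square_power Yi) auto
    let ?EY = "expectation (\<lambda>\<omega>. indicator B \<omega> * (e + (norm (Y i \<omega>))\<^sup>2) ^ k)"
    let ?EA = "expectation (\<lambda>\<omega>. indicator B \<omega> * u \<omega> ^ k)"
    have EA0: "0 \<le> ?EA" using less_imp_le[OF u] by (intro Bochner_Integration.integral_nonneg) auto
    have EY0: "0 \<le> ?EY" using e_pos by (intro Bochner_Integration.integral_nonneg) auto
    have gY: "expectation (\<lambda>\<omega>. indicator B \<omega> * (L * (1 + norm (Y i \<omega>))) ^ (2 * k)) \<le> K0 * ?EY"
    proof -
      have "expectation (\<lambda>\<omega>. indicator B \<omega> * (L * (1 + norm (Y i \<omega>))) ^ (2 * k)) \<le>
          expectation (\<lambda>\<omega>. K0 * (indicator B \<omega> * (e + (norm (Y i \<omega>))\<^sup>2) ^ k))"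
      proof (rule integral_mono)
        show "integrable P (\<lambda>\<omega>. indicator B \<omega> * (L * (1 + norm (Y i \<omega>))) ^ (2 * k))"
          using integrable_growth(2)[OF Y ac(1) _ i] ac by (intro indicator_integrable BP) auto
        show "integrable P (\<lambda>\<omega>. K0 * (indicator B \<omega> * (e + (norm (Y i \<omega>))\<^sup>2) ^ k))" using int_Y by simp
        fix \<omega>
        let ?y = "norm (Y i \<omega>)"
        have "(1 + ?y)\<^sup>2 \<le> 2 * (1 + ?y\<^sup>2)"
          using zero_le_power2[of "1 - ?y"] by (simp add: power2_eq_square algebra_simps)
        also have "1 + ?y\<^sup>2 \<le> (e + ?y\<^sup>2) / e0"
        proof -
          have "e0 * ?y\<^sup>2 \<le> ?y\<^sup>2" using e0 mult_right_mono[of e0 1 "?y\<^sup>2"] by simp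
          then have "e0 * (1 + ?y\<^sup>2) \<le> e + ?y\<^sup>2" using e by (simp add: algebra_simps)
          then show ?thesis using e0 by (simp add: pos_le_divide_eq mult.commute)
        qed
        finally have "L\<^sup>2 * (1 + ?y)\<^sup>2 \<le> L\<^sup>2 * (2 * ((e + ?y\<^sup>2) / e0))" by (intro mult_left_mono) auto
        moreover have "L\<^sup>2 * (2 * (v / e0)) = 2 * L\<^sup>2 / e0 * v" for v by simp
        ultimately have "(L * (1 + ?y))\<^sup>2 \<le> 2 * L\<^sup>2 / e0 * (e + ?y\<^sup>2)" by (simp only: power_mult_distrib)
        then have "((L * (1 + ?y))\<^sup>2) ^ k \<le> (2 * L\<^sup>2 / e0 * (e + ?y\<^sup>2)) ^ k" by (intro power_mono) auto
        also have "\<dots> = K0 * (e + ?y\<^sup>2) ^ k" unfolding K0_def by (rule power_mult_distrib)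
        finally have "(L * (1 + ?y)) ^ (2 * k) \<le> K0 * (e + ?y\<^sup>2) ^ k" by (simp only: power_mult)
        then show "indicator B \<omega> * (L * (1 + ?y)) ^ (2 * k) \<le> K0 * (indicator B \<omega> * (e + ?y\<^sup>2) ^ k)"
          by (cases "\<omega> \<in> B") simp_all
      qed
      then show ?thesis by simp
    qed
    have "expectation (\<lambda>\<omega>. indicator B \<omega> * (e + (norm (A \<omega> + X \<omega>))\<^sup>2) ^ k) \<le> expectation ?R"
      using int_l int_R le by (intro integral_mono) auto
    also have "\<dots> = (1 + c0 * ?h) * ?EA + c0 / ?h ^ l * expectation (\<lambda>\<omega>. indicator B \<omega> * norm (X \<omega>) ^ (2 * k))"
      using int_u int_X ZX by simp
    also have "\<dots> \<le> (1 + c0 * ?h) * ?EA + c0 / ?h ^ l * (C1 * (?h ^ k * (K0 * ?EY)))"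
    proof -
      have "expectation (\<lambda>\<omega>. indicator B \<omega> * norm (X \<omega>) ^ (2 * k)) \<le> C1 * (?h ^ k * (K0 * ?EY))"
        using h C1 by (intro order_trans[OF XB] mult_left_mono gY) auto
      then show ?thesis using c0(1) h by (intro add_left_mono mult_left_mono) auto
    qed
    also have "\<dots> = (1 + c0 * ?h) * ?EA + (c0 * C1 * K0) * (?h * ?EY)"
      using h by (simp add: l)
    also have "\<dots> \<le> (1 + C * ?h) * ?EA + C * (?h * ?EY)"
    proof -
      have CC: "c0 \<le> C" "c0 * C1 * K0 \<le> C" using c0(1) C1 K0 by (auto simp: C_def)
      have "(1 + c0 * ?h) * ?EA \<le> (1 + C * ?h) * ?EA"
        using CC h EA0 by (intro mult_right_mono add_left_mono) auto
      moreover have "(c0 * C1 * K0) * (?h * ?EY) \<le> C * (?h * ?EY)"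
        using CC h EY0 by (intro mult_right_mono) auto
      ultimately show ?thesis by linarith
    qed
    finally show "expectation (\<lambda>\<omega>. indicator B \<omega> * (e + (norm (A \<omega> + X \<omega>))\<^sup>2) ^ k)
      \<le> (1 + C * (c - a)) * expectation (\<lambda>\<omega>. indicator B \<omega> * (e + (norm (A \<omega>))\<^sup>2) ^ k)
        + C * ((c - a) * expectation (\<lambda>\<omega>. indicator B \<omega> * (e + (norm (Y i \<omega>))\<^sup>2) ^ k))"
      unfolding u_def .
  qed
qed

section \<open>Growth of the tamed drift\<close>

definition drift :: "real \<Rightarrow> (nat \<Rightarrow> 'w \<Rightarrow> real^'d) \<Rightarrow> nat \<Rightarrow> 'w \<Rightarrow> real^'d" where
  "drift \<delta> Y i \<omega> = Y i \<omega> + \<delta> *\<^sub>R tamed \<delta> b (Y i \<omega>) (law Y \<omega>)"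

lemma norm_drift_le:
  assumes "\<delta> > 0"
  shows "norm (drift \<delta> Y i \<omega>) \<le> norm (Y i \<omega>) + 1"
proof -
  let ?b = "norm (b (Y i \<omega>) (law Y \<omega>))"
  have "norm (\<delta> *\<^sub>R tamed \<delta> b (Y i \<omega>) (law Y \<omega>)) = \<delta> * ?b / (1 + \<delta> * ?b)"
    using assms by (simp add: tamed_def)
  also have "\<dots> \<le> 1" using assms by (simp add: divide_le_eq_1 add_pos_nonneg)
  finally show ?thesis unfolding drift_def using norm_triangle_ineq[of "Y i \<omega>" "\<delta> *\<^sub>R tamed \<delta> b (Y i \<omega>) (law Y \<omega>)"] by linarith
qed

lemma drift_measurable:
  assumes "adapted Y a" "i \<in> {1..N}"
  shows "drift \<delta> Y i \<in> borel_measurable (F a)"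
proof -
  have Y: "Y j \<in> borel_measurable (F a)" if "j \<in> {1..N}" for j using assms that unfolding adapted_def by auto
  note [measurable] = coefficients_measurable(1)[OF Y assms(2)] Y[OF assms(2)]
  show ?thesis unfolding drift_def[abs_def] tamed_def by measurable
qed

text \<open>Uses only that taming bounds the drift step by 1. The additive error 1 + 1/\<delta>
  equals (\<delta> + 1) \<delta> times 1/\<delta>^2, hence is a multiple of \<delta> times the
  weight.\<close>

lemma drift_growth_crude:
  assumes "0 < \<delta>" "\<delta> \<le> T"
  shows "1 / \<delta>\<^sup>2 + (norm (drift \<delta> Y i \<omega>))\<^sup>2 \<le> (1 + (T + 1) * \<delta>) * (1 / \<delta>\<^sup>2 + (norm (Y i \<omega>))\<^sup>2)"
proof -
  let ?y = "norm (Y i \<omega>)"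
  define z where "z = 1 / \<delta>\<^sup>2"
  have "(norm (drift \<delta> Y i \<omega>))\<^sup>2 \<le> (?y + 1)\<^sup>2" using norm_drift_le[OF assms(1)] by (intro power_mono) auto
  also have "\<dots> \<le> (1 + \<delta>) * ?y\<^sup>2 + (1 + 1 / \<delta>)"
  proof -
    \<comment> \<open>This square is 2 |y| <= \<delta> |y|^2 + 1/\<delta>, which absorbs the cross
      term of (|y| + 1)^2.\<close>
    have "0 \<le> (\<delta> * ?y - 1)\<^sup>2 / \<delta>" using assms by simp
    also have "\<dots> = \<delta> * ?y\<^sup>2 - 2 * ?y + 1 / \<delta>" using assms by (simp add: power2_eq_square field_simps)
    finally show ?thesis by (simp add: power2_eq_square algebra_simps)
  qed
  also have "1 + 1 / \<delta> = (\<delta> + 1) * \<delta> * z" using assms by (simp add: z_def power2_eq_square field_simps)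
  also have "\<dots> \<le> (T + 1) * \<delta> * z" using assms by (intro mult_right_mono) (auto simp: z_def)
  also have "(1 + \<delta>) * ?y\<^sup>2 \<le> (1 + (T + 1) * \<delta>) * ?y\<^sup>2"
    using assms T_pos by (intro mult_right_mono add_left_mono) auto
  finally show ?thesis unfolding z_def[symmetric] by (simp add: algebra_simps)
qed

lemma drift_growth:
  assumes \<delta>: "0 < \<delta>" "\<delta> \<le> T" and y: "norm (Y i \<omega>) ^ (2 * q) \<le> 1 + 1 / \<delta>"
  shows "1 + (norm (drift \<delta> Y i \<omega>))\<^sup>2 \<le> (1 + (2 * L + 4 * L\<^sup>2 * (2 * T + 1)) * \<delta>) * (1 + (norm (Y i \<omega>))\<^sup>2)"
proof -
  let ?y = "norm (Y i \<omega>)" and ?v = "b (Y i \<omega>) (law Y \<omega>)"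
  define \<beta> where "\<beta> = 1 / (1 + \<delta> * norm ?v)"
  have \<beta>: "0 \<le> \<beta>" "\<beta> \<le> 1" using \<delta> by (auto simp: \<beta>_def divide_le_eq_1 add_pos_nonneg)
  have sq: "(1 + x)\<^sup>2 \<le> 2 * (1 + x\<^sup>2)" for x :: real
    using zero_le_power2[of "1 - x"] by (simp add: power2_eq_square algebra_simps)
  have "(norm (drift \<delta> Y i \<omega>))\<^sup>2 = ?y\<^sup>2 + 2 * \<delta> * (\<beta> * (Y i \<omega> \<bullet> ?v)) + \<beta>\<^sup>2 * (\<delta>\<^sup>2 * (norm ?v)\<^sup>2)"
    unfolding drift_def tamed_def \<beta>_def[symmetric] power2_norm_eq_inner
    by (simp add: inner_add_left inner_add_right inner_commute power2_eq_square)
  also have "\<dots> \<le> ?y\<^sup>2 + 2 * \<delta> * (L * (1 + ?y\<^sup>2)) + 1 * (\<delta>\<^sup>2 * (norm ?v)\<^sup>2)"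
  proof (intro add_mono order.refl mult_left_mono mult_right_mono)
    have "\<beta> * (Y i \<omega> \<bullet> ?v) \<le> \<beta> * (L * (1 + ?y\<^sup>2))" using \<beta> by (intro mult_left_mono b_inner) auto
    also have "\<dots> \<le> 1 * (L * (1 + ?y\<^sup>2))" using \<beta> L_pos by (intro mult_right_mono) auto
    finally show "\<beta> * (Y i \<omega> \<bullet> ?v) \<le> L * (1 + ?y\<^sup>2)" by simp
    show "\<beta>\<^sup>2 \<le> 1" using \<beta> by (simp add: power_le_one)
  qed (use \<delta> in auto)
  also have "\<delta>\<^sup>2 * (norm ?v)\<^sup>2 \<le> \<delta> * (4 * L\<^sup>2 * (2 * T + 1) * (1 + ?y\<^sup>2))"
  proof -
    have "(norm ?v)\<^sup>2 \<le> (L * ((1 + ?y) * (1 + ?y ^ q)))\<^sup>2" by (intro power_mono b_growth) auto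
    also have "\<dots> = L\<^sup>2 * ((1 + ?y)\<^sup>2 * (1 + ?y ^ q)\<^sup>2)" by (simp add: power_mult_distrib)
    also have "\<dots> \<le> L\<^sup>2 * ((2 * (1 + ?y\<^sup>2)) * (2 * (1 + (?y ^ q)\<^sup>2)))"
      by (intro mult_left_mono mult_mono sq) auto
    also have "\<dots> = 4 * L\<^sup>2 * (1 + ?y\<^sup>2) * (1 + ?y ^ (2 * q))"
    proof -
      have "(?y ^ q)\<^sup>2 = ?y ^ (2 * q)" by (simp add: power_mult[symmetric] mult.commute)
      moreover have "L\<^sup>2 * ((2 * u) * (2 * v)) = 4 * L\<^sup>2 * u * v" for u v by simp
      ultimately show ?thesis by metis
    qed
    finally have "\<delta>\<^sup>2 * (norm ?v)\<^sup>2 \<le> \<delta>\<^sup>2 * (4 * L\<^sup>2 * (1 + ?y\<^sup>2) * (1 + ?y ^ (2 * q)))"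
      by (intro mult_left_mono) auto
    also have "\<dots> = \<delta> * (4 * L\<^sup>2 * (1 + ?y\<^sup>2) * (\<delta> * (1 + ?y ^ (2 * q))))" by (simp add: power2_eq_square)
    also have "\<dots> \<le> \<delta> * (4 * L\<^sup>2 * (1 + ?y\<^sup>2) * (2 * T + 1))"
    proof (intro mult_left_mono)
      \<comment> \<open>Here the stopping threshold enters: one of the two factors \<delta> absorbs
        the superlinear growth of \<open>b\<close>.\<close>
      have "\<delta> * (1 + ?y ^ (2 * q)) \<le> \<delta> * (2 + 1 / \<delta>)" using y \<delta> by (intro mult_left_mono) auto
      also have "\<dots> = 2 * \<delta> + 1" using \<delta> by (simp add: field_simps)
      finally show "\<delta> * (1 + ?y ^ (2 * q)) \<le> 2 * T + 1" using \<delta> by simp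
    qed (use \<delta> in auto)
    finally show ?thesis by (simp add: mult_ac)
  qed
  finally show ?thesis by (simp add: algebra_simps)
qed

end

section \<open>Moments of the scheme\<close>

context milstein_coefficients begin

abbreviation scheme :: "nat \<Rightarrow> (nat \<Rightarrow> nat \<Rightarrow> 'w \<Rightarrow> real^'d) \<Rightarrow> bool" where
  "scheme M Y \<equiv> tamed_milstein_scheme P F T M N b \<sigma> Ws X0s Y"

lemma scheme_0:
  assumes "scheme M Y" "i \<in> {1..N}"
  shows "AE \<omega> in P. Y i 0 \<omega> = X0s i \<omega>"
  using assms unfolding tamed_milstein_scheme_def Let_def by blast

lemma scheme_measurable:
  assumes "scheme M Y" "i \<in> {1..N}" "n \<le> M"
  shows "Y i n \<in> borel_measurable P"
  using assms unfolding tamed_milstein_scheme_def Let_def by blast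

lemma scheme_Suc:
  assumes Y: "scheme M Y" "i \<in> {1..N}" "n < M"
  obtains X where "increment (\<lambda>j. Y j n) (real n * (T / real M)) (real (Suc n) * (T / real M)) i X"
    "AE \<omega> in P. Y i (Suc n) \<omega> = drift (T / real M) (\<lambda>j. Y j n) i \<omega> + X \<omega>"
proof -
  let ?d = "T / real M" and ?Y = "\<lambda>j. Y j n"
  obtain I J where I: "has_ito_integral P F (Ws i) (real n * ?d) (real (Suc n) * ?d) (self_term ?Y (real n * ?d) i) I"
    and J: "has_ito_integral P F (Ws i) (real n * ?d) (real (Suc n) * ?d) (interaction_term ?Y (real n * ?d) i) J"
    and step: "AE \<omega> in P. Y i (Suc n) \<omega> = Y i n \<omega> + ?d *\<^sub>R tamed ?d b (Y i n \<omega>) (law ?Y \<omega>)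
        + \<sigma> (Y i n \<omega>) (law ?Y \<omega>) *v (Ws i (real (Suc n) * ?d) \<omega> - Ws i (real n * ?d) \<omega>) + I \<omega> + J \<omega>"
    using assms unfolding tamed_milstein_scheme_def Let_def by blast
  show ?thesis
  proof (rule that)
    show "increment ?Y (real n * ?d) (real (Suc n) * ?d) i
        (\<lambda>\<omega>. \<sigma> (Y i n \<omega>) (law ?Y \<omega>) *v (Ws i (real (Suc n) * ?d) \<omega> - Ws i (real n * ?d) \<omega>) + I \<omega> + J \<omega>)"
      unfolding increment_def using I J by blast
    show "AE \<omega> in P. Y i (Suc n) \<omega> = drift ?d ?Y i \<omega>
        + (\<sigma> (Y i n \<omega>) (law ?Y \<omega>) *v (Ws i (real (Suc n) * ?d) \<omega> - Ws i (real n * ?d) \<omega>) + I \<omega> + J \<omega>)"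
      using step by eventually_elim (simp add: drift_def add.assoc)
  qed
qed

lemma grid_times:
  assumes "M \<ge> 1" "n < M"
  shows "0 \<le> real n * (T / real M)" "real n * (T / real M) < real (Suc n) * (T / real M)" "real (Suc n) * (T / real M) \<le> T"
    and "real (Suc n) * (T / real M) - real n * (T / real M) = T / real M"
proof -
  have d: "T / real M > 0" using assms T_pos by simp
  show "0 \<le> real n * (T / real M)" by (intro mult_nonneg_nonneg less_imp_le[OF d]) simp
  show "real n * (T / real M) < real (Suc n) * (T / real M)" by (rule mult_strict_right_mono[OF _ d]) simp
  have "real (Suc n) * (T / real M) \<le> real M * (T / real M)" using assms d by (intro mult_right_mono) auto
  then show "real (Suc n) * (T / real M) \<le> T" using assms by simp
  show "real (Suc n) * (T / real M) - real n * (T / real M) = T / real M" by (simp add: algebra_simps add_divide_distrib)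
qed

text \<open>For a fixed number of steps all moments are finite, since the drift step has norm at
  most 1 and the noise has moments of every positive even order. Measurability survives the almost
  sure equations by \<open>measurable_filtration_AE\<close>.\<close>

lemma scheme_adapted:
  assumes M: "M \<ge> 1" and Y: "scheme M Y" and n: "n \<le> M"
  shows "adapted (\<lambda>i. Y i n) (real n * (T / real M))"
  using n
proof (induction n)
  case 0
  show ?case unfolding adapted_def
  proof (intro ballI conjI allI)
    fix i k assume i: "i \<in> {1..N}"
    have YP: "Y i 0 \<in> borel_measurable P" using scheme_measurable[OF Y i] by simp
    have XP: "X0s i \<in> borel_measurable P" using X0_measurable[OF i] T_pos by (intro measurable_filtration[of 0]) auto
    show "Y i 0 \<in> borel_measurable (F (real 0 * (T / real M)))"
      using measurable_filtration_AE[OF _ _ YP X0_measurable[OF i] scheme_0[OF Y i]] T_pos by simp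
    have "integrable P (\<lambda>\<omega>. norm (Y i 0 \<omega>) ^ k) = integrable P (\<lambda>\<omega>. norm (X0s i \<omega>) ^ k)"
      using scheme_0[OF Y i] YP XP by (intro integrable_cong_AE) (auto elim!: eventually_mono)
    then show "integrable P (\<lambda>\<omega>. norm (Y i 0 \<omega>) ^ k)" using X0_moment[OF i] by simp
  qed
next
  case (Suc n)
  then have n: "n < M" and IH: "adapted (\<lambda>i. Y i n) (real n * (T / real M))" by auto
  let ?a = "real n * (T / real M)" and ?c = "real (Suc n) * (T / real M)"
  note ac = grid_times(1-3)[OF M n]
  have d: "T / real M > 0" using M T_pos by simp
  show ?case unfolding adapted_def
  proof (intro ballI conjI allI)
    fix i k assume i: "i \<in> {1..N}"
    obtain X where X: "increment (\<lambda>j. Y j n) ?a ?c i X" and step: "AE \<omega> in P. Y i (Suc n) \<omega> = drift (T / real M) (\<lambda>j. Y j n) i \<omega> + X \<omega>"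
      by (rule scheme_Suc[OF Y i n])
    have props: "X \<in> borel_measurable (F ?c) \<and> integrable P (\<lambda>\<omega>. norm (X \<omega>) ^ (2 * m))" if "m \<ge> 1" for m
      by (rule increment_properties[OF that]) (use ac i IH X in blast)
    let ?A = "drift (T / real M) (\<lambda>j. Y j n) i"
    have Am: "?A \<in> borel_measurable (F ?a)" by (rule drift_measurable[OF IH i])
    have Ac: "?A \<in> borel_measurable (F ?c)" using Am ac by (intro measurable_filtration_mono[of ?a ?c]) auto
    have Xc: "X \<in> borel_measurable (F ?c)" using props[of 1] by simp
    have YP: "Y i (Suc n) \<in> borel_measurable P" using scheme_measurable[OF Y i] n by simp
    show "Y i (Suc n) \<in> borel_measurable (F ?c)"
    proof (rule measurable_filtration_AE[OF _ _ YP _ step])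
      show "(\<lambda>\<omega>. ?A \<omega> + X \<omega>) \<in> borel_measurable (F ?c)" using Ac Xc by (rule borel_measurable_add)
    qed (use ac in auto)
    have AP[measurable]: "?A \<in> borel_measurable P" by (rule measurable_filtration[OF _ _ Am]) (use ac in auto)
    have XP[measurable]: "X \<in> borel_measurable P" by (rule measurable_filtration[OF _ _ Xc]) (use ac in auto)
    have Yn: "Y i n \<in> borel_measurable P" "\<And>m. integrable P (\<lambda>\<omega>. norm (Y i n \<omega>) ^ m)"
      using scheme_measurable[OF Y i] n IH i unfolding adapted_def by auto
    have Ai: "integrable P (\<lambda>\<omega>. norm (?A \<omega>) ^ m)" for m
    proof (rule integrable_bound_nonneg)
      show "integrable P (\<lambda>\<omega>. 2 ^ m * (norm (Y i n \<omega>) ^ m + 1 ^ m))" using Yn by auto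
      fix \<omega>
      have "norm (?A \<omega>) ^ m \<le> (norm (Y i n \<omega>) + 1) ^ m" using norm_drift_le[OF d] by (intro power_mono) auto
      also have "\<dots> \<le> 2 ^ m * (norm (Y i n \<omega>) ^ m + 1 ^ m)" by (intro add_power_le) auto
      finally show "norm (?A \<omega>) ^ m \<le> 2 ^ m * (norm (Y i n \<omega>) ^ m + 1 ^ m)" .
    qed auto
    \<comment> \<open>\<open>increment_properties\<close> gives positive even exponents; 2 (k + 1)
      is one that exceeds k, also for k = 0.\<close>
    have Xi: "integrable P (\<lambda>\<omega>. norm (X \<omega>) ^ (2 * Suc k))" using props[of "Suc k"] by simp
    have "integrable P (\<lambda>\<omega>. norm (?A \<omega> + X \<omega>) ^ (2 * Suc k))"
      by (rule integrable_norm_add_power[OF AP XP Ai Xi])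
    then have "integrable P (\<lambda>\<omega>. norm (?A \<omega> + X \<omega>) ^ k)"
      by (rule integrable_norm_power_le[rotated]) auto
    moreover have "integrable P (\<lambda>\<omega>. norm (Y i (Suc n) \<omega>) ^ k) = integrable P (\<lambda>\<omega>. norm (?A \<omega> + X \<omega>) ^ k)"
      using step YP by (intro integrable_cong_AE) (auto elim!: eventually_mono)
    ultimately show "integrable P (\<lambda>\<omega>. norm (Y i (Suc n) \<omega>) ^ k)" by simp
  qed
qed

lemma scheme_integrable:
  assumes M: "M \<ge> 1" and Y: "scheme M Y" and n: "n \<le> M" and i: "i \<in> {1..N}" and e: "e \<ge> 0"
  shows "integrable P (\<lambda>\<omega>. (e + (norm (Y i n \<omega>))\<^sup>2) ^ k)"
  using scheme_adapted[OF M Y n] i e scheme_measurable[OF Y i n] unfolding adapted_def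
  by (intro integrable_const_add_norm_square_power) auto

lemma scheme_step:
  assumes k: "k \<ge> 1" and e0: "0 < e0" "e0 \<le> 1"
  obtains C where "C \<ge> 0" "\<forall>M Y n i e B. 1 \<le> M \<longrightarrow> scheme M Y \<longrightarrow> n < M \<longrightarrow> i \<in> {1..N} \<longrightarrow> e0 \<le> e \<longrightarrow>
    B \<in> sets (F (real n * (T / real M))) \<longrightarrow>
    expectation (\<lambda>\<omega>. indicator B \<omega> * (e + (norm (Y i (Suc n) \<omega>))\<^sup>2) ^ k)
      \<le> (1 + C * (T / real M)) * expectation (\<lambda>\<omega>. indicator B \<omega> * (e + (norm (drift (T / real M) (\<lambda>j. Y j n) i \<omega>))\<^sup>2) ^ k)
        + C * ((T / real M) * expectation (\<lambda>\<omega>. indicator B \<omega> * (e + (norm (Y i n \<omega>))\<^sup>2) ^ k))"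
proof -
  obtain C where C: "C \<ge> 0" and step: "\<forall>a c i Y X (A :: 'w \<Rightarrow> real^'d) e B. 0 \<le> a \<longrightarrow> a < c \<longrightarrow> c \<le> T \<longrightarrow> i \<in> {1..N} \<longrightarrow> adapted Y a \<longrightarrow>
    increment Y a c i X \<longrightarrow> A \<in> borel_measurable (F a) \<longrightarrow> (\<forall>\<omega>. norm (A \<omega>) \<le> norm (Y i \<omega>) + 1) \<longrightarrow> e0 \<le> e \<longrightarrow> B \<in> sets (F a) \<longrightarrow>
    expectation (\<lambda>\<omega>. indicator B \<omega> * (e + (norm (A \<omega> + X \<omega>))\<^sup>2) ^ k)
      \<le> (1 + C * (c - a)) * expectation (\<lambda>\<omega>. indicator B \<omega> * (e + (norm (A \<omega>))\<^sup>2) ^ k)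
        + C * ((c - a) * expectation (\<lambda>\<omega>. indicator B \<omega> * (e + (norm (Y i \<omega>))\<^sup>2) ^ k))"
    by (rule one_step[OF k e0]) (rule that)
  show ?thesis
  proof (rule that[OF C], intro allI impI)
    fix M Y n i e B
    assume M: "1 \<le> M" and Y: "scheme M Y" and n: "n < M" and i: "i \<in> {1..N}" and e: "e0 \<le> e"
      and B: "B \<in> sets (F (real n * (T / real M)))"
    let ?a = "real n * (T / real M)" and ?c = "real (Suc n) * (T / real M)"
    let ?A = "drift (T / real M) (\<lambda>j. Y j n) i"
    note ac = grid_times(1-3)[OF M n] and ca = grid_times(4)[OF M n]
    have d: "T / real M > 0" using M T_pos by simp
    have ad: "adapted (\<lambda>i. Y i n) ?a" using scheme_adapted[OF M Y] n by simp
    obtain X where X: "increment (\<lambda>j. Y j n) ?a ?c i X" and eq: "AE \<omega> in P. Y i (Suc n) \<omega> = ?A \<omega> + X \<omega>"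
      by (rule scheme_Suc[OF Y i n])
    have A: "?A \<in> borel_measurable (F ?a)" by (rule drift_measurable[OF ad i])
    have Xc: "X \<in> borel_measurable (F ?c)"
      by (rule increment_properties[of 1]) (simp, use ac i ad X in blast)
    have [measurable]: "?A \<in> borel_measurable P" by (rule measurable_filtration[OF _ _ A]) (use ac in auto)
    have [measurable]: "X \<in> borel_measurable P" by (rule measurable_filtration[OF _ _ Xc]) (use ac in auto)
    have [measurable]: "Y i (Suc n) \<in> borel_measurable P" using scheme_measurable[OF Y i] n by simp
    have [measurable]: "B \<in> sets P" using B sets_filtration[of ?a] ac by auto
    have "expectation (\<lambda>\<omega>. indicator B \<omega> * (e + (norm (Y i (Suc n) \<omega>))\<^sup>2) ^ k) =
        expectation (\<lambda>\<omega>. indicator B \<omega> * (e + (norm (?A \<omega> + X \<omega>))\<^sup>2) ^ k)"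
    proof (rule integral_cong_AE)
      show "AE \<omega> in P. indicator B \<omega> * (e + (norm (Y i (Suc n) \<omega>))\<^sup>2) ^ k = indicator B \<omega> * (e + (norm (?A \<omega> + X \<omega>))\<^sup>2) ^ k"
        using eq by eventually_elim simp
    qed measurable
    also have "\<dots> \<le> (1 + C * (?c - ?a)) * expectation (\<lambda>\<omega>. indicator B \<omega> * (e + (norm (?A \<omega>))\<^sup>2) ^ k)
        + C * ((?c - ?a) * expectation (\<lambda>\<omega>. indicator B \<omega> * (e + (norm (Y i n \<omega>))\<^sup>2) ^ k))"
      using step[rule_format, OF ac i ad X A _ e B] norm_drift_le[OF d] by blast
    finally show "expectation (\<lambda>\<omega>. indicator B \<omega> * (e + (norm (Y i (Suc n) \<omega>))\<^sup>2) ^ k)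
      \<le> (1 + C * (T / real M)) * expectation (\<lambda>\<omega>. indicator B \<omega> * (e + (norm (?A \<omega>))\<^sup>2) ^ k)
        + C * ((T / real M) * expectation (\<lambda>\<omega>. indicator B \<omega> * (e + (norm (Y i n \<omega>))\<^sup>2) ^ k))"
      unfolding ca .
  qed
qed

text \<open>The drift growth enters as a hypothesis on the event \<open>B\<close>, so that this covers both the crude
  growth on the whole space and the sharp one before the stopping time.\<close>

lemma scheme_growth:
  assumes k: "k \<ge> 1" and e0: "0 < e0" "e0 \<le> 1" and c: "c \<ge> 0"
  obtains C where "C \<ge> 0" "\<forall>M Y n i e B. 1 \<le> M \<longrightarrow> scheme M Y \<longrightarrow> n < M \<longrightarrow> i \<in> {1..N} \<longrightarrow> e0 \<le> e \<longrightarrow>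
    B \<in> sets (F (real n * (T / real M))) \<longrightarrow>
    (\<forall>\<omega>\<in>B. e + (norm (drift (T / real M) (\<lambda>j. Y j n) i \<omega>))\<^sup>2 \<le> (1 + c * (T / real M)) * (e + (norm (Y i n \<omega>))\<^sup>2)) \<longrightarrow>
    expectation (\<lambda>\<omega>. indicator B \<omega> * (e + (norm (Y i (Suc n) \<omega>))\<^sup>2) ^ k)
      \<le> exp (C * (T / real M)) * expectation (\<lambda>\<omega>. indicator B \<omega> * (e + (norm (Y i n \<omega>))\<^sup>2) ^ k)"
proof -
  obtain C where C: "C \<ge> 0" and step: "\<forall>M Y n i e B. 1 \<le> M \<longrightarrow> scheme M Y \<longrightarrow> n < M \<longrightarrow> i \<in> {1..N} \<longrightarrow> e0 \<le> e \<longrightarrow>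
    B \<in> sets (F (real n * (T / real M))) \<longrightarrow>
    expectation (\<lambda>\<omega>. indicator B \<omega> * (e + (norm (Y i (Suc n) \<omega>))\<^sup>2) ^ k)
      \<le> (1 + C * (T / real M)) * expectation (\<lambda>\<omega>. indicator B \<omega> * (e + (norm (drift (T / real M) (\<lambda>j. Y j n) i \<omega>))\<^sup>2) ^ k)
        + C * ((T / real M) * expectation (\<lambda>\<omega>. indicator B \<omega> * (e + (norm (Y i n \<omega>))\<^sup>2) ^ k))"
    by (rule scheme_step[OF k e0]) (rule that)
  \<comment> \<open>With h the step size, the two terms combine to (1 + 2 C h) exp (k c h) <= exp
    ((2 C + k c) h). The exponent k c is the growth c of the squared norm raised to the power
    k.\<close>
  define C' where "C' = 2 * C + real k * c"
  have C': "C' \<ge> 0" using C c by (simp add: C'_def)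
  show ?thesis
  proof (rule that[OF C'], intro allI impI)
    fix M Y n i e B
    assume M: "1 \<le> M" and Y: "scheme M Y" and n: "n < M" and i: "i \<in> {1..N}" and e: "e0 \<le> e"
      and B: "B \<in> sets (F (real n * (T / real M)))"
      and gr: "\<forall>\<omega>\<in>B. e + (norm (drift (T / real M) (\<lambda>j. Y j n) i \<omega>))\<^sup>2 \<le> (1 + c * (T / real M)) * (e + (norm (Y i n \<omega>))\<^sup>2)"
    let ?d = "T / real M" and ?A = "drift (T / real M) (\<lambda>j. Y j n) i"
    let ?E = "expectation (\<lambda>\<omega>. indicator B \<omega> * (e + (norm (Y i n \<omega>))\<^sup>2) ^ k)"
    have d: "?d > 0" using M T_pos by simp
    have e_pos: "e > 0" using e e0 by simp
    have E0: "0 \<le> ?E" using e_pos by (intro Bochner_Integration.integral_nonneg) auto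
    have BP[measurable]: "B \<in> sets P" using B sets_filtration[of "real n * ?d"] grid_times[OF M n] by auto
    have iY: "integrable P (\<lambda>\<omega>. indicator B \<omega> * (e + (norm (Y i n \<omega>))\<^sup>2) ^ k)"
      using scheme_integrable[OF M Y _ i] n e_pos by (intro indicator_integrable BP) auto
    have pw: "indicator B \<omega> * (e + (norm (?A \<omega>))\<^sup>2) ^ k \<le> (1 + c * ?d) ^ k * (indicator B \<omega> * (e + (norm (Y i n \<omega>))\<^sup>2) ^ k)" for \<omega>
    proof (cases "\<omega> \<in> B")
      case True
      have "(e + (norm (?A \<omega>))\<^sup>2) ^ k \<le> ((1 + c * ?d) * (e + (norm (Y i n \<omega>))\<^sup>2)) ^ k"
        using gr True e_pos by (intro power_mono) auto
      then show ?thesis using True by (simp add: power_mult_distrib)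
    qed simp
    have ad: "adapted (\<lambda>i. Y i n) (real n * ?d)" using scheme_adapted[OF M Y] n by simp
    have [measurable]: "?A \<in> borel_measurable P"
      by (rule measurable_filtration[OF _ _ drift_measurable[OF ad i]]) (use grid_times[OF M n] in auto)
    have iA: "integrable P (\<lambda>\<omega>. indicator B \<omega> * (e + (norm (?A \<omega>))\<^sup>2) ^ k)"
      by (rule integrable_bound_nonneg[OF integrable_mult_right[OF iY, of "(1 + c * ?d) ^ k"]])
        (use pw e_pos in auto)
    have "expectation (\<lambda>\<omega>. indicator B \<omega> * (e + (norm (?A \<omega>))\<^sup>2) ^ k) \<le> (1 + c * ?d) ^ k * ?E"
      using integral_mono[OF iA integrable_mult_right[OF iY, of "(1 + c * ?d) ^ k"]] pw by simp
    also have "\<dots> \<le> exp (real k * c * ?d) * ?E"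
    proof -
      have "(1 + c * ?d) ^ k \<le> exp (c * ?d) ^ k"
        using c d by (intro power_mono exp_ge_add_one_self add_nonneg_nonneg mult_nonneg_nonneg less_imp_le[OF d]) auto
      also have "\<dots> = exp (real k * c * ?d)" by (simp add: exp_of_nat_mult[symmetric] mult.assoc)
      finally show ?thesis using E0 by (intro mult_right_mono)
    qed
    finally have EA: "expectation (\<lambda>\<omega>. indicator B \<omega> * (e + (norm (?A \<omega>))\<^sup>2) ^ k) \<le> exp (real k * c * ?d) * ?E" .
    have Cd: "0 \<le> C * ?d" and kcd: "0 \<le> real k * c * ?d"
      by (intro mult_nonneg_nonneg less_imp_le[OF d] C c of_nat_0_le_iff)+
    have "expectation (\<lambda>\<omega>. indicator B \<omega> * (e + (norm (Y i (Suc n) \<omega>))\<^sup>2) ^ k)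
      \<le> (1 + C * ?d) * expectation (\<lambda>\<omega>. indicator B \<omega> * (e + (norm (?A \<omega>))\<^sup>2) ^ k) + C * (?d * ?E)"
      using step[rule_format, OF M Y n i e B] .
    also have "\<dots> \<le> (1 + C * ?d) * (exp (real k * c * ?d) * ?E) + C * ?d * (exp (real k * c * ?d) * ?E)"
    proof (rule add_mono)
      show "(1 + C * ?d) * expectation (\<lambda>\<omega>. indicator B \<omega> * (e + (norm (?A \<omega>))\<^sup>2) ^ k) \<le> (1 + C * ?d) * (exp (real k * c * ?d) * ?E)"
        using EA Cd by (intro mult_left_mono) auto
      have "1 * ?E \<le> exp (real k * c * ?d) * ?E" using E0 kcd by (intro mult_right_mono) auto
      then show "C * (?d * ?E) \<le> C * ?d * (exp (real k * c * ?d) * ?E)"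
        using mult_left_mono[OF _ Cd, of ?E "exp (real k * c * ?d) * ?E"] by (simp add: mult.assoc)
    qed
    also have "\<dots> = (1 + 2 * C * ?d) * (exp (real k * c * ?d) * ?E)" by (simp add: algebra_simps)
    also have "\<dots> \<le> exp (2 * C * ?d) * (exp (real k * c * ?d) * ?E)"
      using E0 by (intro mult_right_mono exp_ge_add_one_self) auto
    also have "\<dots> = exp (C' * ?d) * ?E"
      by (simp add: C'_def mult.assoc[symmetric] exp_add[symmetric] distrib_right add_divide_distrib)
    finally show "expectation (\<lambda>\<omega>. indicator B \<omega> * (e + (norm (Y i (Suc n) \<omega>))\<^sup>2) ^ k)
      \<le> exp (C' * (T / real M)) * expectation (\<lambda>\<omega>. indicator B \<omega> * (e + (norm (Y i n \<omega>))\<^sup>2) ^ k)" .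
  qed
qed

lemma exp_recursion:
  fixes a :: "nat \<Rightarrow> real"
  assumes M: "M \<ge> 1" and C: "C \<ge> 0" and a0: "a 0 \<ge> 0"
    and step: "\<And>n. n < M \<Longrightarrow> a (Suc n) \<le> exp (C * (T / real M)) * a n" and n: "n \<le> M"
  shows "a n \<le> exp (C * T) * a 0"
proof -
  have "a n \<le> exp (real n * (C * (T / real M))) * a 0" using n
  proof (induction n)
    case (Suc n)
    have "a (Suc n) \<le> exp (C * (T / real M)) * a n" using step Suc by simp
    also have "\<dots> \<le> exp (C * (T / real M)) * (exp (real n * (C * (T / real M))) * a 0)"
      using Suc by (intro mult_left_mono) auto
    also have "\<dots> = exp (real (Suc n) * (C * (T / real M))) * a 0"
      by (simp add: mult.assoc[symmetric] exp_add[symmetric] distrib_right add_divide_distrib add.commute)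
    finally show ?case .
  qed simp
  also have "\<dots> \<le> exp (C * T) * a 0"
  proof (intro mult_right_mono a0)
    have "real n * (C * (T / real M)) \<le> real M * (C * (T / real M))"
      using n C T_pos by (intro mult_right_mono) auto
    also have "\<dots> = C * T" using M by simp
    finally show "exp (real n * (C * (T / real M))) \<le> exp (C * T)" by simp
  qed
  finally show ?thesis .
qed

lemma step_size:
  assumes "M \<ge> 1"
  shows "0 < T / real M" "T / real M \<le> T"
proof -
  show "0 < T / real M" using assms T_pos by simp
  have "T / real M \<le> T / 1" using assms T_pos by (intro divide_left_mono) auto
  then show "T / real M \<le> T" by simp
qed

lemma expectation_initial:
  assumes Y: "scheme M Y" and i: "i \<in> {1..N}"
  shows "expectation (\<lambda>\<omega>. (e + (norm (Y i 0 \<omega>))\<^sup>2) ^ k) = expectation (\<lambda>\<omega>. (e + (norm (X0s i \<omega>))\<^sup>2) ^ k)"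
proof (rule integral_cong_AE)
  have [measurable]: "Y i 0 \<in> borel_measurable P" using scheme_measurable[OF Y i] by simp
  have [measurable]: "X0s i \<in> borel_measurable P" using X0_measurable[OF i] T_pos by (intro measurable_filtration[of 0]) auto
  show "(\<lambda>\<omega>. (e + (norm (Y i 0 \<omega>))\<^sup>2) ^ k) \<in> borel_measurable P" by measurable
  show "(\<lambda>\<omega>. (e + (norm (X0s i \<omega>))\<^sup>2) ^ k) \<in> borel_measurable P" by measurable
  show "AE \<omega> in P. (e + (norm (Y i 0 \<omega>))\<^sup>2) ^ k = (e + (norm (X0s i \<omega>))\<^sup>2) ^ k"
    using scheme_0[OF Y i] by eventually_elim simp
qed

lemma initial_integrable:
  assumes i: "i \<in> {1..N}" and e: "e \<ge> 0"
  shows "integrable P (\<lambda>\<omega>. (e + (norm (r *\<^sub>R X0s i \<omega>))\<^sup>2) ^ k)"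
proof (rule integrable_const_add_norm_square_power)
  have [measurable]: "X0s i \<in> borel_measurable P" using X0_measurable[OF i] T_pos by (intro measurable_filtration[of 0]) auto
  show "(\<lambda>\<omega>. r *\<^sub>R X0s i \<omega>) \<in> borel_measurable P" by measurable
  show "integrable P (\<lambda>\<omega>. norm (r *\<^sub>R X0s i \<omega>) ^ (2 * k))"
    using X0_moment[OF i, of "2 * k"] by (simp add: power_mult_distrib)
qed (rule e)

section \<open>Moments polynomial in the inverse step size\<close>

text \<open>With the weight 1/\<delta>^2 the crude drift growth holds everywhere, so no event has to
  be excluded. The price is an initial value of order \<delta>^(-2k), compensated by the factor in
  the statement.\<close>

lemma scheme_crude_moment:
  assumes k: "k \<ge> 1"
  obtains D where "D \<ge> 0" "\<forall>M Y n i. 1 \<le> M \<longrightarrow> scheme M Y \<longrightarrow> n \<le> M \<longrightarrow> i \<in> {1..N} \<longrightarrow>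
    (T / real M) ^ (2 * k) * expectation (\<lambda>\<omega>. (1 + (norm (Y i n \<omega>))\<^sup>2) ^ k) \<le> D"
proof -
  \<comment> \<open>All weights 1/\<delta>^2 are at least 1/T^2, because \<delta> <= T; the minimum
    with 1 is required by \<open>scheme_growth\<close>.\<close>
  define e0 where "e0 = min 1 (1 / T\<^sup>2)"
  have e0: "0 < e0" "e0 \<le> 1" using T_pos by (auto simp: e0_def)
  have c: "0 \<le> T + 1" using T_pos by simp
  obtain C where C: "C \<ge> 0" and gr: "\<forall>M Y n i e B. 1 \<le> M \<longrightarrow> scheme M Y \<longrightarrow> n < M \<longrightarrow> i \<in> {1..N} \<longrightarrow> e0 \<le> e \<longrightarrow>
    B \<in> sets (F (real n * (T / real M))) \<longrightarrow>
    (\<forall>\<omega>\<in>B. e + (norm (drift (T / real M) (\<lambda>j. Y j n) i \<omega>))\<^sup>2 \<le> (1 + (T + 1) * (T / real M)) * (e + (norm (Y i n \<omega>))\<^sup>2)) \<longrightarrow>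
    expectation (\<lambda>\<omega>. indicator B \<omega> * (e + (norm (Y i (Suc n) \<omega>))\<^sup>2) ^ k)
      \<le> exp (C * (T / real M)) * expectation (\<lambda>\<omega>. indicator B \<omega> * (e + (norm (Y i n \<omega>))\<^sup>2) ^ k)"
    by (rule scheme_growth[OF k e0 c]) (rule that)
  \<comment> \<open>Exchanges weights: 1 + x <= m (1/\<delta>^2 + x) for x >= 0, by m >= 1 and m >=
    T^2 >= \<delta>^2.\<close>
  define m where "m = max 1 (T\<^sup>2)"
  have m: "m \<ge> 1" "m \<ge> T\<^sup>2" by (auto simp: m_def)
  let ?x = "\<lambda>i. expectation (\<lambda>\<omega>. (1 + (norm (T *\<^sub>R X0s i \<omega>))\<^sup>2) ^ k)"
  have x0: "0 \<le> ?x i" for i by (intro Bochner_Integration.integral_nonneg) auto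
  define D where "D = m ^ k * (exp (C * T) * (\<Sum>i\<in>{1..N}. ?x i))"
  have D: "D \<ge> 0" unfolding D_def using m x0 by (intro mult_nonneg_nonneg sum_nonneg) auto
  show ?thesis
  proof (rule that[OF D], intro allI impI)
    fix M Y n i assume M: "1 \<le> M" and Y: "scheme M Y" and n: "n \<le> M" and i: "i \<in> {1..N}"
    define d where "d = T / real M"
    have d: "0 < d" "d \<le> T" using step_size[OF M] by (auto simp: d_def)
    define z where "z = 1 / d\<^sup>2"
    have z: "0 < z" "e0 \<le> z"
    proof -
      show "0 < z" using d by (simp add: z_def)
      have "1 / T\<^sup>2 \<le> z" unfolding z_def using d by (intro divide_left_mono power_mono) auto
      then show "e0 \<le> z" by (simp add: e0_def min.coboundedI2)
    qed
    let ?a = "\<lambda>n. expectation (\<lambda>\<omega>. (z + (norm (Y i n \<omega>))\<^sup>2) ^ k)"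
    have full: "expectation (\<lambda>\<omega>. indicator (space P) \<omega> * f \<omega>) = expectation f" for f :: "'w \<Rightarrow> real"
      by (rule Bochner_Integration.integral_cong) auto
    have rec: "?a n \<le> exp (C * T) * ?a 0"
    proof (rule exp_recursion[OF M C _ _ n])
      show "0 \<le> ?a 0" using z by (intro Bochner_Integration.integral_nonneg) auto
      fix n assume n: "n < M"
      have B: "space P \<in> sets (F (real n * (T / real M)))"
        using space_filtration[of "real n * (T / real M)"] grid_times[OF M n] sets.top[of "F (real n * (T / real M))"] by auto
      show "?a (Suc n) \<le> exp (C * (T / real M)) * ?a n"
        using gr[rule_format, OF M Y n i z(2) B] drift_growth_crude[OF d] unfolding full d_def[symmetric] z_def by blast
    qed
    have iY: "integrable P (\<lambda>\<omega>. (e + (norm (Y i n \<omega>))\<^sup>2) ^ k)" if "e \<ge> 0" for e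
      by (rule scheme_integrable[OF M Y n i that])
    have "expectation (\<lambda>\<omega>. (1 + (norm (Y i n \<omega>))\<^sup>2) ^ k) \<le> expectation (\<lambda>\<omega>. m ^ k * (z + (norm (Y i n \<omega>))\<^sup>2) ^ k)"
    proof (rule integral_mono)
      show "integrable P (\<lambda>\<omega>. m ^ k * (z + (norm (Y i n \<omega>))\<^sup>2) ^ k)" using iY[of z] z by simp
      fix \<omega>
      have "1 \<le> m * z"
      proof -
        have "d\<^sup>2 \<le> m" using d by (intro order_trans[OF _ m(2)] power_mono) auto
        then show ?thesis using d by (simp add: z_def)
      qed
      moreover have "(norm (Y i n \<omega>))\<^sup>2 \<le> m * (norm (Y i n \<omega>))\<^sup>2" using m(1) mult_right_mono[of 1 m "(norm (Y i n \<omega>))\<^sup>2"] by simp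
      ultimately have "1 + (norm (Y i n \<omega>))\<^sup>2 \<le> m * (z + (norm (Y i n \<omega>))\<^sup>2)" by (simp add: distrib_left)
      then have "(1 + (norm (Y i n \<omega>))\<^sup>2) ^ k \<le> (m * (z + (norm (Y i n \<omega>))\<^sup>2)) ^ k" by (intro power_mono) auto
      then show "(1 + (norm (Y i n \<omega>))\<^sup>2) ^ k \<le> m ^ k * (z + (norm (Y i n \<omega>))\<^sup>2) ^ k" by (simp add: power_mult_distrib)
    qed (rule iY, simp)
    also have "\<dots> = m ^ k * ?a n" by simp
    also have "\<dots> \<le> m ^ k * (exp (C * T) * ?a 0)" using rec m by (intro mult_left_mono) auto
    finally have "d ^ (2 * k) * expectation (\<lambda>\<omega>. (1 + (norm (Y i n \<omega>))\<^sup>2) ^ k) \<le> d ^ (2 * k) * (m ^ k * (exp (C * T) * ?a 0))"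
      using d by (intro mult_left_mono) auto
    also have "\<dots> = m ^ k * (exp (C * T) * (d ^ (2 * k) * expectation (\<lambda>\<omega>. (z + (norm (X0s i \<omega>))\<^sup>2) ^ k)))"
      by (simp add: expectation_initial[OF Y i])
    \<comment> \<open>Multiplication by d^(2k) turns the weight 1/d^2 into 1 and scales the initial
      value by d <= T, which makes the bound independent of the step size.\<close>
    also have "d ^ (2 * k) * expectation (\<lambda>\<omega>. (z + (norm (X0s i \<omega>))\<^sup>2) ^ k) = expectation (\<lambda>\<omega>. (1 + (norm (d *\<^sub>R X0s i \<omega>))\<^sup>2) ^ k)"
    proof -
      have "d ^ (2 * k) * (z + x) ^ k = (1 + d\<^sup>2 * x) ^ k" for x
      proof -
        have "d ^ (2 * k) * (z + x) ^ k = (d\<^sup>2 * (z + x)) ^ k" by (simp add: power_mult power_mult_distrib)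
        also have "d\<^sup>2 * (z + x) = 1 + d\<^sup>2 * x" using d by (simp add: z_def distrib_left)
        finally show ?thesis .
      qed
      then show ?thesis using d by (simp add: power_mult_distrib flip: integral_mult_right_zero)
    qed
    also have "m ^ k * (exp (C * T) * \<dots>) \<le> m ^ k * (exp (C * T) * ?x i)"
    proof -
      have "expectation (\<lambda>\<omega>. (1 + (norm (d *\<^sub>R X0s i \<omega>))\<^sup>2) ^ k) \<le> ?x i"
      proof (intro integral_mono initial_integrable[OF i])
        fix \<omega>
        have "norm (d *\<^sub>R X0s i \<omega>) \<le> norm (T *\<^sub>R X0s i \<omega>)" using d by (simp add: mult_right_mono)
        then show "(1 + (norm (d *\<^sub>R X0s i \<omega>))\<^sup>2) ^ k \<le> (1 + (norm (T *\<^sub>R X0s i \<omega>))\<^sup>2) ^ k"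
          by (intro power_mono add_left_mono) auto
      qed auto
      then show ?thesis using m by (intro mult_left_mono) auto
    qed
    also have "\<dots> \<le> D"
      unfolding D_def using m x0 i by (intro mult_left_mono member_le_sum) auto
    finally show "(T / real M) ^ (2 * k) * expectation (\<lambda>\<omega>. (1 + (norm (Y i n \<omega>))\<^sup>2) ^ k) \<le> D"
      unfolding d_def .
  qed
qed

section \<open>Stopping at the first large value\<close>

text \<open>The threshold is the condition of \<open>drift_growth\<close>. As all times up to n are
  included, the events decrease in n and define an exit time.\<close>

definition tame_event :: "real \<Rightarrow> (nat \<Rightarrow> 'w \<Rightarrow> real^'d) \<Rightarrow> nat \<Rightarrow> 'w set" where
  "tame_event \<delta> y n = {\<omega> \<in> space P. \<forall>m\<le>n. norm (y m \<omega>) ^ (2 * q) \<le> 1 + 1 / \<delta>}"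

primrec stopped :: "nat \<Rightarrow> real \<Rightarrow> (nat \<Rightarrow> 'w \<Rightarrow> real^'d) \<Rightarrow> nat \<Rightarrow> 'w \<Rightarrow> real" where
  "stopped k \<delta> y 0 \<omega> = (1 + (norm (y 0 \<omega>))\<^sup>2) ^ k"
| "stopped k \<delta> y (Suc n) \<omega> = (if \<omega> \<in> tame_event \<delta> y n then (1 + (norm (y (Suc n) \<omega>))\<^sup>2) ^ k else stopped k \<delta> y n \<omega>)"

lemma stopped_tame:
  assumes "\<omega> \<in> tame_event \<delta> y n"
  shows "stopped k \<delta> y n \<omega> = (1 + (norm (y n \<omega>))\<^sup>2) ^ k"
proof (cases n)
  case (Suc m)
  then have "\<omega> \<in> tame_event \<delta> y m" using assms by (auto simp: tame_event_def)
  then show ?thesis using Suc by simp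
qed simp

lemma stopped_nonneg: "0 \<le> stopped k \<delta> y n \<omega>"
  by (induction n) auto

text \<open>A pathwise form of Markov's inequality: at the exit |y|^(2q) > 1/\<delta>, so the
  recorded power with exponent q j is at least (1/\<delta>)^j, and it is never changed
  afterwards.\<close>

lemma stopped_not_tame:
  assumes \<delta>: "0 < \<delta>" and \<omega>: "\<omega> \<in> space P" "\<omega> \<notin> tame_event \<delta> y n"
  shows "(1 / \<delta>) ^ j \<le> stopped (q * j) \<delta> y n \<omega>"
  using \<omega>(2)
proof (induction n)
  have large: "(1 / \<delta>) ^ j \<le> (1 + (norm v)\<^sup>2) ^ (q * j)" if "\<not> norm v ^ (2 * q) \<le> 1 + 1 / \<delta>" for v :: "real^'d"
  proof -
    have "1 / \<delta> \<le> ((norm v)\<^sup>2) ^ q" using that by (simp add: power_mult)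
    also have "\<dots> \<le> (1 + (norm v)\<^sup>2) ^ q" by (intro power_mono) auto
    finally have "(1 / \<delta>) ^ j \<le> ((1 + (norm v)\<^sup>2) ^ q) ^ j" using \<delta> by (intro power_mono) auto
    then show ?thesis by (simp add: power_mult)
  qed
  {
    case 0
    then show ?case using \<omega>(1) large by (simp add: tame_event_def)
  next
    case (Suc n)
    show ?case
    proof (cases "\<omega> \<in> tame_event \<delta> y n")
      case True
      then have "\<not> norm (y (Suc n) \<omega>) ^ (2 * q) \<le> 1 + 1 / \<delta>"
        using Suc.prems \<omega>(1) by (auto simp: tame_event_def le_Suc_eq)
      then show ?thesis using True large by simp
    next
      case False
      then show ?thesis using Suc by simp
    qed
  }
qed

text \<open>On the tame event, which is known at the left end of the step,
  \<open>scheme_growth\<close> applies with the sharp drift growth. Off it the stopped value does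
  not move, and 1 is at most the same exponential factor. The sum over the particles in D makes the
  bound uniform in i.\<close>

lemma stopped_moment:
  assumes k: "k \<ge> 1"
  obtains D where "D \<ge> 0" "\<forall>M Y n i. 1 \<le> M \<longrightarrow> scheme M Y \<longrightarrow> n \<le> M \<longrightarrow> i \<in> {1..N} \<longrightarrow>
    integrable P (stopped k (T / real M) (Y i) n) \<and> expectation (stopped k (T / real M) (Y i) n) \<le> D"
proof -
  define c where "c = 2 * L + 4 * L\<^sup>2 * (2 * T + 1)"
  have c: "0 \<le> c" using L_pos T_pos by (simp add: c_def)
  obtain C where C: "C \<ge> 0" and gr: "\<forall>M Y n i e B. 1 \<le> M \<longrightarrow> scheme M Y \<longrightarrow> n < M \<longrightarrow> i \<in> {1..N} \<longrightarrow> 1 \<le> e \<longrightarrow>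
    B \<in> sets (F (real n * (T / real M))) \<longrightarrow>
    (\<forall>\<omega>\<in>B. e + (norm (drift (T / real M) (\<lambda>j. Y j n) i \<omega>))\<^sup>2 \<le> (1 + c * (T / real M)) * (e + (norm (Y i n \<omega>))\<^sup>2)) \<longrightarrow>
    expectation (\<lambda>\<omega>. indicator B \<omega> * (e + (norm (Y i (Suc n) \<omega>))\<^sup>2) ^ k)
      \<le> exp (C * (T / real M)) * expectation (\<lambda>\<omega>. indicator B \<omega> * (e + (norm (Y i n \<omega>))\<^sup>2) ^ k)"
    by (rule scheme_growth[OF k zero_less_one order.refl c]) (rule that)
  let ?x = "\<lambda>i. expectation (\<lambda>\<omega>. (1 + (norm (X0s i \<omega>))\<^sup>2) ^ k)"
  have x0: "0 \<le> ?x i" for i by (intro Bochner_Integration.integral_nonneg) auto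
  define D where "D = exp (C * T) * (\<Sum>i\<in>{1..N}. ?x i)"
  have D: "D \<ge> 0" unfolding D_def using x0 by (intro mult_nonneg_nonneg sum_nonneg) auto
  show ?thesis
  proof (rule that[OF D], intro allI impI)
    fix M Y n i assume M: "1 \<le> M" and Y: "scheme M Y" and n: "n \<le> M" and i: "i \<in> {1..N}"
    define d where "d = T / real M"
    have d: "0 < d" "d \<le> T" using step_size[OF M] by (auto simp: d_def)
    let ?V = "\<lambda>n \<omega>. (1 + (norm (Y i n \<omega>))\<^sup>2) ^ k" and ?S = "\<lambda>n. stopped k d (Y i) n" and ?B = "\<lambda>n. tame_event d (Y i) n"
    have V: "integrable P (?V n)" if "n \<le> M" for n by (rule scheme_integrable[OF M Y that i]) simp
    have BF: "?B n \<in> sets (F (real n * d))" if n: "n < M" for n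
    proof -
      note t = grid_times[OF M n, folded d_def]
      have Ym: "Y i m \<in> borel_measurable (F (real n * d))" if "m \<le> n" for m
      proof (rule measurable_filtration_mono[of "real m * d" "real n * d"])
        show "Y i m \<in> borel_measurable (F (real m * d))"
          using scheme_adapted[OF M Y, of m] i that n unfolding adapted_def d_def by auto
        show "real m * d \<le> real n * d" using that d by (intro mult_right_mono) auto
      qed (use d t in auto)
      have "?B n = (\<Inter>m\<in>{..n}. {\<omega> \<in> space (F (real n * d)). norm (Y i m \<omega>) ^ (2 * q) \<le> 1 + 1 / d})"
        using space_filtration[of "real n * d"] t by (auto simp: tame_event_def)
      also have "\<dots> \<in> sets (F (real n * d))"
      proof (rule sets.finite_INT)
        fix m assume "m \<in> {..n}"
        then have [measurable]: "Y i m \<in> borel_measurable (F (real n * d))" using Ym by simp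
        show "{\<omega> \<in> space (F (real n * d)). norm (Y i m \<omega>) ^ (2 * q) \<le> 1 + 1 / d} \<in> sets (F (real n * d))"
          by measurable
      qed auto
      finally show ?thesis .
    qed
    have BP: "?B n \<in> sets P" if "n < M" for n
      using BF[OF that] sets_filtration[of "real n * d"] grid_times[OF M that] unfolding d_def by auto
    have split: "?S (Suc n) \<omega> = indicator (?B n) \<omega> * ?V (Suc n) \<omega> + indicator (space P - ?B n) \<omega> * ?S n \<omega>" if "\<omega> \<in> space P" for n \<omega>
      using that by (simp add: indicator_def)
    \<comment> \<open>The same splitting at the earlier time, possible because on the tame event the
      stopped value is still the current one. It allows both parts of the estimate to be joined
      again.\<close>
    have split': "?S n \<omega> = indicator (?B n) \<omega> * ?V n \<omega> + indicator (space P - ?B n) \<omega> * ?S n \<omega>" if "\<omega> \<in> space P" for n \<omega>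
      using that by (cases "\<omega> \<in> ?B n") (simp_all add: stopped_tame)
    have S: "integrable P (?S n)" if "n \<le> M" for n
      using that
    proof (induction n)
      case 0
      have "?S 0 = ?V 0" by (simp add: fun_eq_iff)
      then show ?case using V[of 0] by simp
    next
      case (Suc n)
      then have "integrable P (\<lambda>\<omega>. indicator (?B n) \<omega> * ?V (Suc n) \<omega> + indicator (space P - ?B n) \<omega> * ?S n \<omega>)"
        by (intro Bochner_Integration.integrable_add indicator_integrable V BP sets.Diff sets.top) auto
      moreover have "integrable P (?S (Suc n)) = integrable P (\<lambda>\<omega>. indicator (?B n) \<omega> * ?V (Suc n) \<omega> + indicator (space P - ?B n) \<omega> * ?S n \<omega>)"
        by (rule Bochner_Integration.integrable_cong[OF refl split])
      ultimately show ?case by (simp only:)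
    qed
    have "expectation (?S n) \<le> exp (C * T) * expectation (?S 0)"
    proof (rule exp_recursion[OF M C _ _ n])
      show "0 \<le> expectation (?S 0)" by (intro Bochner_Integration.integral_nonneg stopped_nonneg)
      fix n assume n: "n < M"
      have iB: "integrable P (\<lambda>\<omega>. indicator (?B n) \<omega> * ?V (Suc n) \<omega>)" "integrable P (\<lambda>\<omega>. indicator (?B n) \<omega> * ?V n \<omega>)"
        "integrable P (\<lambda>\<omega>. indicator (space P - ?B n) \<omega> * ?S n \<omega>)"
        using n by (intro indicator_integrable V S BP sets.Diff sets.top; simp)+
      have R0: "0 \<le> expectation (\<lambda>\<omega>. indicator (space P - ?B n) \<omega> * ?S n \<omega>)"
        by (intro Bochner_Integration.integral_nonneg mult_nonneg_nonneg stopped_nonneg) auto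
      have ex: "1 \<le> exp (C * (T / real M))" using C d unfolding d_def by simp
      have tame: "\<forall>\<omega>\<in>?B n. 1 + (norm (drift (T / real M) (\<lambda>j. Y j n) i \<omega>))\<^sup>2 \<le> (1 + c * (T / real M)) * (1 + (norm (Y i n \<omega>))\<^sup>2)"
      proof
        fix \<omega> assume "\<omega> \<in> ?B n"
        then have "norm (Y i n \<omega>) ^ (2 * q) \<le> 1 + 1 / d" by (auto simp: tame_event_def)
        then show "1 + (norm (drift (T / real M) (\<lambda>j. Y j n) i \<omega>))\<^sup>2 \<le> (1 + c * (T / real M)) * (1 + (norm (Y i n \<omega>))\<^sup>2)"
          using drift_growth[OF d, of "\<lambda>j. Y j n" i \<omega>] unfolding c_def d_def by simp
      qed
      have "expectation (?S (Suc n)) = expectation (\<lambda>\<omega>. indicator (?B n) \<omega> * ?V (Suc n) \<omega>) + expectation (\<lambda>\<omega>. indicator (space P - ?B n) \<omega> * ?S n \<omega>)"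
        using iB by (subst Bochner_Integration.integral_cong[OF refl split]) auto
      also have "\<dots> \<le> exp (C * (T / real M)) * expectation (\<lambda>\<omega>. indicator (?B n) \<omega> * ?V n \<omega>)
          + exp (C * (T / real M)) * expectation (\<lambda>\<omega>. indicator (space P - ?B n) \<omega> * ?S n \<omega>)"
      proof (rule add_mono)
        show "expectation (\<lambda>\<omega>. indicator (?B n) \<omega> * ?V (Suc n) \<omega>) \<le> exp (C * (T / real M)) * expectation (\<lambda>\<omega>. indicator (?B n) \<omega> * ?V n \<omega>)"
          using gr[rule_format, OF M Y n i order.refl] BF[OF n] tame unfolding d_def by blast
        show "expectation (\<lambda>\<omega>. indicator (space P - ?B n) \<omega> * ?S n \<omega>)
            \<le> exp (C * (T / real M)) * expectation (\<lambda>\<omega>. indicator (space P - ?B n) \<omega> * ?S n \<omega>)"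
          using mult_right_mono[OF ex R0] by simp
      qed
      also have "\<dots> = exp (C * (T / real M)) * (expectation (\<lambda>\<omega>. indicator (?B n) \<omega> * ?V n \<omega>) + expectation (\<lambda>\<omega>. indicator (space P - ?B n) \<omega> * ?S n \<omega>))"
        by (simp add: distrib_left)
      also have "expectation (\<lambda>\<omega>. indicator (?B n) \<omega> * ?V n \<omega>) + expectation (\<lambda>\<omega>. indicator (space P - ?B n) \<omega> * ?S n \<omega>) = expectation (?S n)"
      proof -
        have "expectation (?S n) = expectation (\<lambda>\<omega>. indicator (?B n) \<omega> * ?V n \<omega> + indicator (space P - ?B n) \<omega> * ?S n \<omega>)"
          by (rule Bochner_Integration.integral_cong[OF refl split'])
        then show ?thesis using iB by simp
      qed
      finally show "expectation (?S (Suc n)) \<le> exp (C * (T / real M)) * expectation (?S n)" .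
    qed
    also have "expectation (?S 0) = ?x i"
    proof -
      have "?S 0 = ?V 0" by (simp add: fun_eq_iff)
      then show ?thesis using expectation_initial[OF Y i] by (simp only:)
    qed
    also have "exp (C * T) * ?x i \<le> D" unfolding D_def using x0 i by (intro mult_left_mono member_le_sum) auto
    finally show "integrable P (stopped k (T / real M) (Y i) n) \<and> expectation (stopped k (T / real M) (Y i) n) \<le> D"
      using S[OF n] unfolding d_def by simp
  qed
qed

section \<open>Removal of the stopping\<close>

text \<open>With V = 1 + |Y|^2, on the tame event V^k is the stopped value. Off it V^k <=
  \<delta>^(-4k) + \<delta>^(4k) V^(2k): the first term is dominated by a stopped value with a high
  exponent, the second has bounded mean by the crude moments.\<close>

lemma scheme_moment_bound:
  assumes k: "k \<ge> 1" and q: "q \<ge> 1"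
  obtains D where "D \<ge> 0" "\<forall>M Y n i. 1 \<le> M \<longrightarrow> scheme M Y \<longrightarrow> n \<le> M \<longrightarrow> i \<in> {1..N} \<longrightarrow>
    expectation (\<lambda>\<omega>. (1 + (norm (Y i n \<omega>))\<^sup>2) ^ k) \<le> D"
proof -
  obtain D1 where D1: "D1 \<ge> 0" "\<forall>M Y n i. 1 \<le> M \<longrightarrow> scheme M Y \<longrightarrow> n \<le> M \<longrightarrow> i \<in> {1..N} \<longrightarrow>
    integrable P (stopped k (T / real M) (Y i) n) \<and> expectation (stopped k (T / real M) (Y i) n) \<le> D1"
    by (rule stopped_moment[OF k]) (rule that)
  \<comment> \<open>The exponent q (4k) makes the stopped value exceed \<delta>^(-4k) after the
    exit; the crude moment with exponent 2k comes with exactly the factor \<delta>^(4k).\<close>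
  have "q * (4 * k) \<ge> 1" "2 * k \<ge> 1" using k q by auto
  then obtain D2 D3 where D2: "D2 \<ge> 0" "\<forall>M Y n i. 1 \<le> M \<longrightarrow> scheme M Y \<longrightarrow> n \<le> M \<longrightarrow> i \<in> {1..N} \<longrightarrow>
    integrable P (stopped (q * (4 * k)) (T / real M) (Y i) n) \<and> expectation (stopped (q * (4 * k)) (T / real M) (Y i) n) \<le> D2"
    and D3: "D3 \<ge> 0" "\<forall>M Y n i. 1 \<le> M \<longrightarrow> scheme M Y \<longrightarrow> n \<le> M \<longrightarrow> i \<in> {1..N} \<longrightarrow>
    (T / real M) ^ (2 * (2 * k)) * expectation (\<lambda>\<omega>. (1 + (norm (Y i n \<omega>))\<^sup>2) ^ (2 * k)) \<le> D3"
    using stopped_moment[of "q * (4 * k)"] scheme_crude_moment[of "2 * k"] by metis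
  show ?thesis
  proof (rule that[of "D1 + D2 + D3"], use D1 D2 D3 in simp, intro allI impI)
    fix M Y n i assume M: "1 \<le> M" and Y: "scheme M Y" and n: "n \<le> M" and i: "i \<in> {1..N}"
    define d where "d = T / real M"
    have d: "0 < d" "d \<le> T" using step_size[OF M] by (auto simp: d_def)
    let ?V = "\<lambda>\<omega>. 1 + (norm (Y i n \<omega>))\<^sup>2"
    let ?S1 = "stopped k d (Y i) n" and ?S2 = "stopped (q * (4 * k)) d (Y i) n"
    have S1: "integrable P ?S1" "expectation ?S1 \<le> D1" using D1(2) M Y n i unfolding d_def by blast+
    have S2: "integrable P ?S2" "expectation ?S2 \<le> D2" using D2(2) M Y n i unfolding d_def by blast+
    have V: "integrable P (\<lambda>\<omega>. ?V \<omega> ^ m)" for m by (rule scheme_integrable[OF M Y n i]) simp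
    have "expectation (\<lambda>\<omega>. ?V \<omega> ^ k) \<le> expectation (\<lambda>\<omega>. ?S1 \<omega> + ?S2 \<omega> + d ^ (2 * (2 * k)) * ?V \<omega> ^ (2 * k))"
    proof (rule integral_mono)
      show "integrable P (\<lambda>\<omega>. ?S1 \<omega> + ?S2 \<omega> + d ^ (2 * (2 * k)) * ?V \<omega> ^ (2 * k))"
        using S1 S2 V by auto
      fix \<omega> assume \<omega>: "\<omega> \<in> space P"
      show "?V \<omega> ^ k \<le> ?S1 \<omega> + ?S2 \<omega> + d ^ (2 * (2 * k)) * ?V \<omega> ^ (2 * k)"
      proof (cases "\<omega> \<in> tame_event d (Y i) n")
        case True
        then have "?S1 \<omega> = ?V \<omega> ^ k" by (rule stopped_tame)
        moreover have "0 \<le> d ^ (2 * (2 * k)) * ?V \<omega> ^ (2 * k)" using d by simp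
        ultimately show ?thesis using stopped_nonneg[of "q * (4 * k)" d "Y i" n \<omega>] by linarith
      next
        case False
        have x: "(1 / d) ^ (4 * k) \<le> ?S2 \<omega>" by (rule stopped_not_tame[OF d(1) \<omega> False])
        \<comment> \<open>Either V^k is below the level \<delta>^(-4k), or \<delta>^(4k) V^k >= 1
          and multiplication by V^k gives the second term.\<close>
        have "?V \<omega> ^ k \<le> (1 / d) ^ (4 * k) + d ^ (2 * (2 * k)) * ?V \<omega> ^ (2 * k)"
        proof (cases "?V \<omega> ^ k \<le> (1 / d) ^ (4 * k)")
          case True
          moreover have "0 \<le> d ^ (2 * (2 * k)) * ?V \<omega> ^ (2 * k)" using d by simp
          ultimately show ?thesis by linarith
        next
          case False
          have "1 = d ^ (4 * k) * (1 / d) ^ (4 * k)" using d by (simp add: power_divide)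
          also have "\<dots> \<le> d ^ (4 * k) * ?V \<omega> ^ k" using False d by (intro mult_left_mono) auto
          finally have "1 * ?V \<omega> ^ k \<le> (d ^ (4 * k) * ?V \<omega> ^ k) * ?V \<omega> ^ k" by (intro mult_right_mono) auto
          also have "\<dots> = d ^ (2 * (2 * k)) * ?V \<omega> ^ (2 * k)" by (simp add: mult.assoc power_add[symmetric] mult_2[symmetric])
          finally have "?V \<omega> ^ k \<le> d ^ (2 * (2 * k)) * ?V \<omega> ^ (2 * k)" by simp
          moreover have "0 \<le> (1 / d) ^ (4 * k)" using d by simp
          ultimately show ?thesis by linarith
        qed
        then show ?thesis using x stopped_nonneg[of k d "Y i" n \<omega>] by linarith
      qed
    qed (rule V)
    also have "\<dots> = expectation ?S1 + expectation ?S2 + d ^ (2 * (2 * k)) * expectation (\<lambda>\<omega>. ?V \<omega> ^ (2 * k))"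
      using S1 S2 V by simp
    also have "\<dots> \<le> D1 + D2 + D3"
      using S1(2) S2(2) D3(2)[rule_format, OF M Y n i] unfolding d_def by (intro add_mono)
    finally show "expectation (\<lambda>\<omega>. (1 + (norm (Y i n \<omega>))\<^sup>2) ^ k) \<le> D1 + D2 + D3" .
  qed
qed

end

section \<open>From the hypotheses on the coefficients to the moment bound\<close>

theorem lemma2p4:
  fixes P :: "'w measure"
    and F :: "real \<Rightarrow> 'w measure"
    and T p :: real
    and N :: nat
    and b :: "real^'d \<Rightarrow> (real^'d) measure \<Rightarrow> real^'d"
    and \<sigma> :: "real^'d \<Rightarrow> (real^'d) measure \<Rightarrow> real^'m^'d"
    and W :: "real \<Rightarrow> 'w \<Rightarrow> real^'m"
    and X0 :: "'w \<Rightarrow> real^'d"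
    and Ws :: "nat \<Rightarrow> real \<Rightarrow> 'w \<Rightarrow> real^'m"
    and X0s :: "nat \<Rightarrow> 'w \<Rightarrow> real^'d"
    and Lb1 \<alpha>1 Lb4 L\<sigma>1 L\<sigma>2 L\<sigma>4 :: real
  assumes T: "T > 0" and p: "p \<ge> 1" and N: "N \<ge> 1"
    and P: "prob_space P" "atomless P"
    and F: "filtration_on T P F" "usual_conditions T P F"
    and W: "brownian_motion T P F W"
    and X0: "X0 \<in> borel_measurable (F 0)"
      "prob_space.indep_set P {X0 -` A \<inter> space P | A. A \<in> sets borel}
         {sample_path T W -` A \<inter> space P | A. A \<in> sets (path_space T)}"
      "\<And>q::real. q \<ge> 1 \<Longrightarrow> integrable P (\<lambda>\<omega>. norm (X0 \<omega>) powr q)"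
    and copies: "\<And>i. i \<in> {1..N} \<Longrightarrow> brownian_motion T P F (Ws i)"
      "\<And>i. i \<in> {1..N} \<Longrightarrow> X0s i \<in> borel_measurable (F 0)"
      "\<And>i. i \<in> {1..N} \<Longrightarrow>
         distr P (path_space T \<Otimes>\<^sub>M borel) (\<lambda>\<omega>. (sample_path T (Ws i) \<omega>, X0s i \<omega>)) =
         distr P (path_space T \<Otimes>\<^sub>M borel) (\<lambda>\<omega>. (sample_path T W \<omega>, X0 \<omega>))"
      "prob_space.indep_vars P (\<lambda>_. path_space T \<Otimes>\<^sub>M borel)
         (\<lambda>i \<omega>. (sample_path T (Ws i) \<omega>, X0s i \<omega>)) {1..N}"
    and measurable_coeffs:
      "(\<lambda>(x, \<mu>). b x \<mu>) \<in> borel_measurable (borel \<Otimes>\<^sub>M P2_borel)"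
      "(\<lambda>(x, \<mu>). \<sigma> x \<mu>) \<in> borel_measurable (borel \<Otimes>\<^sub>M P2_borel)"
    and constants: "Lb1 > 0" "\<alpha>1 > 0" "Lb4 > 0" "L\<sigma>1 > 0" "L\<sigma>2 > 0" "L\<sigma>4 > 0"
    and i: "\<And>x y \<mu>. \<mu> \<in> P2 \<Longrightarrow> (x - y) \<bullet> (b x \<mu> - b y \<mu>) \<le> Lb1 * (norm (x - y))\<^sup>2"
      "\<And>x y \<mu>. \<mu> \<in> P2 \<Longrightarrow>
         norm (b x \<mu> - b y \<mu>) \<le> Lb1 * (1 + norm x powr \<alpha>1 + norm y powr \<alpha>1) * norm (x - y)"
      "\<And>x \<mu> \<nu>. \<mu> \<in> P2 \<Longrightarrow> \<nu> \<in> P2 \<Longrightarrow> norm (b x \<mu> - b x \<nu>) \<le> Lb1 * W2 \<mu> \<nu>"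
    and ii: "\<And>\<mu>. \<mu> \<in> P2 \<Longrightarrow> norm (b 0 \<mu>) \<le> Lb4"
    and iii: "\<And>x y \<mu> \<nu>. \<mu> \<in> P2 \<Longrightarrow> \<nu> \<in> P2 \<Longrightarrow>
         norm (\<sigma> x \<mu> - \<sigma> y \<nu>) \<le> L\<sigma>1 * (norm (x - y) + W2 \<mu> \<nu>)"
    and iv: "\<And>k l. (\<lambda>x \<mu>. \<sigma> x \<mu> $ k $ l) \<in> C2_21 P"
      "\<And>k l x y \<mu>. \<mu> \<in> P2 \<Longrightarrow>
         max (norm (DL P (\<lambda>x \<mu>. \<sigma> x \<mu> $ k $ l) x \<mu> y))
           (max (norm (jacobian (DL P (\<lambda>x \<mu>. \<sigma> x \<mu> $ k $ l) x \<mu>) (at y)))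
             (norm (DL2 P (\<lambda>x \<mu>. \<sigma> x \<mu> $ k $ l) x \<mu> y y))) \<le> L\<sigma>2"
    and v: "\<And>x y \<mu>. \<mu> \<in> P2 \<Longrightarrow>
         norm (\<sigma> 0 \<mu>) + hs_norm (\<lambda>w. DL_op P \<sigma> x \<mu> y (\<sigma> y \<mu> *v w)) \<le> L\<sigma>4"
  shows "\<exists>C>0. \<forall>M\<ge>1. \<forall>Y. tamed_milstein_scheme P F T M N b \<sigma> Ws X0s Y \<longrightarrow>
           (SUP i\<in>{1..N}. SUP n\<in>{0..M}. \<integral>\<^sup>+\<omega>. ennreal (norm (Y i n \<omega>) powr p) \<partial>P) \<le> ennreal C"
proof -
  interpret interacting_noise P F T N Ws
    using P(1) F T N copies(1)
    by (simp add: interacting_noise_def interacting_noise_axioms_def filtered_space_def filtered_space_axioms_def)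
  define q where "q = Suc (nat \<lceil>\<alpha>1\<rceil>)"
  have q: "\<alpha>1 \<le> real q" "q \<ge> 1"
    using real_nat_ceiling_ge[of \<alpha>1] by (auto simp: q_def)
  \<comment> \<open>A common upper bound: \<open>Lb1 + Lb4\<close> for the inner product with
    \<open>b\<close>, \<open>2 * Lb1 + Lb4\<close> for the growth of \<open>b\<close>,
    \<open>L\<sigma>4 + L\<sigma>1\<close> for the growth of \<open>\<sigma>\<close>,
    \<open>L\<sigma>1 * (L\<sigma>4 + L\<sigma>1)\<close> for the gradient applied to
    \<open>\<sigma>\<close>, and \<open>L\<sigma>4\<close> for the Lions derivative applied to
    \<open>\<sigma>\<close>.\<close>
  define L where "L = 2 * Lb1 + Lb4 + L\<sigma>4 + L\<sigma>1 * (L\<sigma>4 + L\<sigma>1) + L\<sigma>1"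
  have L_nonneg: "0 \<le> L\<sigma>1 * (L\<sigma>4 + L\<sigma>1)" using constants by simp
  have L_ge: "L > 0" "Lb1 + Lb4 \<le> L" "2 * Lb1 + Lb4 \<le> L" "L\<sigma>4 + L\<sigma>1 \<le> L" "L\<sigma>1 * (L\<sigma>4 + L\<sigma>1) \<le> L" "L\<sigma>4 \<le> L"
    unfolding L_def using constants L_nonneg by linarith+
  have emp: "empirical N y \<in> P2" for y :: "nat \<Rightarrow> real^'d" by (rule empirical_in_P2[OF N])
  \<comment> \<open>Condition (iii) is used below with the same measure in both arguments; pairing
    equal indices bounds the distance of an empirical measure to itself.\<close>
  have W2_self: "W2 (empirical N y) (empirical N y) \<le> 0" for y :: "nat \<Rightarrow> real^'d"
    using W2_empirical_le[OF N, of y y] by simp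
  have lip: "norm (\<sigma> x (empirical N y) - \<sigma> z (empirical N y)) \<le> L\<sigma>1 * norm (x - z)" for x z y
  proof -
    have "norm (\<sigma> x (empirical N y) - \<sigma> z (empirical N y)) \<le> L\<sigma>1 * (norm (x - z) + W2 (empirical N y) (empirical N y))"
      by (rule iii[OF emp emp])
    also have "\<dots> \<le> L\<sigma>1 * (norm (x - z) + 0)"
      using constants W2_self by (intro mult_left_mono add_left_mono) auto
    finally show ?thesis by simp
  qed
  have hs_nonneg: "0 \<le> hs_norm A" for A :: "real^'m \<Rightarrow> real^'m^'d" by (simp add: hs_norm_def sum_nonneg)
  \<comment> \<open>Condition (v) bounds a sum, and the Hilbert-Schmidt norm in it is
    nonnegative.\<close>
  have \<sigma>0: "norm (\<sigma> 0 (empirical N y)) \<le> L\<sigma>4" for y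
    using v[OF emp[of y], of 0 0] hs_nonneg[of "\<lambda>w. DL_op P \<sigma> 0 (empirical N y) 0 (\<sigma> 0 (empirical N y) *v w)"] by linarith
  have \<sigma>_growth: "norm (\<sigma> x (empirical N y)) \<le> (L\<sigma>4 + L\<sigma>1) * (1 + norm x)" for x y
  proof -
    have "norm (\<sigma> x (empirical N y)) \<le> norm (\<sigma> 0 (empirical N y)) + norm (\<sigma> x (empirical N y) - \<sigma> 0 (empirical N y))"
      using norm_triangle_ineq[of "\<sigma> 0 (empirical N y)" "\<sigma> x (empirical N y) - \<sigma> 0 (empirical N y)"] by simp
    also have "\<dots> \<le> L\<sigma>4 + L\<sigma>1 * norm x" using \<sigma>0 lip[of x y 0] by (intro add_mono) auto
    also have "\<dots> \<le> (L\<sigma>4 + L\<sigma>1) * (1 + norm x)" using constants by (simp add: algebra_simps)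
    finally show ?thesis .
  qed
  have diff: "(\<lambda>z. \<sigma> z (empirical N y)) differentiable (at x)" for x y
  proof (rule twice_cont_differentiable_imp_differentiable)
    fix k l show "twice_cont_differentiable (\<lambda>x. \<sigma> x (empirical N y) $ k $ l)"
      using iv(1)[of k l] emp[of y] unfolding C2_21_def by blast
  qed
  have grad: "((\<lambda>z. \<sigma> z (empirical N y)) has_derivative grad_op \<sigma> x (empirical N y)) (at x)" for x y
    using diff[of y x] unfolding grad_op_def frechet_derivative_works .
  have grad_bound: "norm (grad_op \<sigma> x (empirical N y) w) \<le> L\<sigma>1 * norm w" for x y w
    by (rule has_derivative_lipschitz_bound[OF grad]) (rule lip)
  \<comment> \<open>The copies share with (W, X0) only the joint law of path and initial value; the
    moments are read off this law through the second projection.\<close>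
  have X0_moment: "integrable P (\<lambda>\<omega>. norm (X0s i \<omega>) ^ k)" if i: "i \<in> {1..N}" for i k
  proof -
    have meas: "(\<lambda>\<omega>. (sample_path T V \<omega>, Z \<omega>)) \<in> measurable P (path_space T \<Otimes>\<^sub>M borel)"
      if V: "brownian_motion T P F V" and Z: "Z \<in> borel_measurable (F 0)" for V :: "real \<Rightarrow> 'w \<Rightarrow> real^'m" and Z :: "'w \<Rightarrow> real^'d"
    proof (intro measurable_Pair)
      show "(\<lambda>\<omega>. sample_path T V \<omega>) \<in> measurable P (path_space T)"
        unfolding sample_path_def
      proof (rule measurable_restrict)
        fix t assume "t \<in> {0..T}"
        then show "V t \<in> borel_measurable P"
          using BM_measurable[OF V, of t t] by (intro measurable_filtration[of t]) auto
      qed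
      show "Z \<in> borel_measurable P" using Z T by (intro measurable_filtration[of 0]) auto
    qed
    have "integrable P (\<lambda>\<omega>. norm (X0 \<omega>) ^ k)"
    \<comment> \<open>The moment hypothesis starts at exponent 1, and \<open>0 powr 0\<close> is 0
      whereas \<open>0 ^ 0\<close> is 1; so k = 0 is treated apart.\<close>
    proof (cases k)
      case 0
      then show ?thesis by simp
    next
      case (Suc l)
      have "norm (X0 \<omega>) powr real k = norm (X0 \<omega>) ^ k" for \<omega>
        using Suc by (cases "X0 \<omega> = 0") (simp_all add: powr_realpow del: of_nat_Suc power_Suc)
      then show ?thesis using X0(3)[of "real k"] Suc by simp
    qed
    then have "integrable (distr P (path_space T \<Otimes>\<^sub>M borel) (\<lambda>\<omega>. (sample_path T W \<omega>, X0 \<omega>))) (\<lambda>z. norm (snd z) ^ k)"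
      by (subst integrable_distr_eq[OF meas[OF W X0(1)]]) auto
    then show ?thesis
      unfolding copies(3)[OF i, symmetric]
      by (subst (asm) integrable_distr_eq[OF meas[OF copies(1,2)[OF i]]]) auto
  qed
  interpret milstein_coefficients P F T N Ws b \<sigma> X0s L q
  proof (rule milstein_coefficients.intro[OF _ milstein_coefficients_axioms.intro])
    show "interacting_noise P F T N Ws" by unfold_locales
    show "X0s i \<in> borel_measurable (F 0)" if "i \<in> {1..N}" for i using copies(2)[OF that] .
    show "integrable P (\<lambda>\<omega>. norm (X0s i \<omega>) ^ k)" if "i \<in> {1..N}" for i k using X0_moment[OF that] .
    show "(\<lambda>(x, \<mu>). b x \<mu>) \<in> borel_measurable (borel \<Otimes>\<^sub>M P2_borel)" "(\<lambda>(x, \<mu>). \<sigma> x \<mu>) \<in> borel_measurable (borel \<Otimes>\<^sub>M P2_borel)"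
      by (fact measurable_coeffs)+
    show "L > 0" by (fact L_ge(1))
    fix x z :: "real^'d" and y :: "nat \<Rightarrow> real^'d" and w :: "real^'m"
    let ?\<mu> = "empirical N y"
    have b0: "norm (b 0 ?\<mu>) \<le> Lb4" by (rule ii[OF emp])
    have one_le: "norm x \<le> 1 + (norm x)\<^sup>2"
      using power_le_one_add_power[of "norm x" 1 2] by simp
    have "x \<bullet> b x ?\<mu> = (x - 0) \<bullet> (b x ?\<mu> - b 0 ?\<mu>) + x \<bullet> b 0 ?\<mu>" by (simp add: inner_diff_right)
    also have "\<dots> \<le> Lb1 * (norm (x - 0))\<^sup>2 + norm x * Lb4"
      using order_trans[OF norm_cauchy_schwarz[of x "b 0 ?\<mu>"] mult_left_mono[OF b0 norm_ge_zero[of x]]]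
      by (intro add_mono i(1)[OF emp]) auto
    also have "\<dots> \<le> Lb1 * (1 + (norm x)\<^sup>2) + (1 + (norm x)\<^sup>2) * Lb4"
      using constants one_le by (intro add_mono mult_left_mono mult_right_mono) auto
    also have "\<dots> = (Lb1 + Lb4) * (1 + (norm x)\<^sup>2)" by (simp add: algebra_simps)
    also have "\<dots> \<le> L * (1 + (norm x)\<^sup>2)" using L_ge by (intro mult_right_mono) auto
    finally show "x \<bullet> b x ?\<mu> \<le> L * (1 + (norm x)\<^sup>2)" .
    have powr_le: "norm x powr \<alpha>1 \<le> 1 + norm x ^ q"
    proof (cases "norm x \<le> 1")
      case True
      then have "norm x powr \<alpha>1 \<le> 1 powr \<alpha>1" using constants by (intro powr_mono2) auto
      then show ?thesis by (simp add: add_increasing2)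
    next
      case False
      then have "norm x powr \<alpha>1 \<le> norm x powr real q" using q by (intro powr_mono) auto
      also have "\<dots> = norm x ^ q" using False by (intro powr_realpow) auto
      finally show ?thesis by simp
    qed
    have "norm (b x ?\<mu>) \<le> norm (b x ?\<mu> - b 0 ?\<mu>) + norm (b 0 ?\<mu>)"
      using norm_triangle_ineq[of "b x ?\<mu> - b 0 ?\<mu>" "b 0 ?\<mu>"] by simp
    also have "\<dots> \<le> Lb1 * (1 + norm x powr \<alpha>1 + norm (0 :: real^'d) powr \<alpha>1) * norm (x - 0) + Lb4"
      by (intro add_mono i(2)[OF emp] b0)
    also have "\<dots> \<le> Lb1 * (2 * (1 + norm x ^ q)) * (1 + norm x) + Lb4 * ((1 + norm x) * (1 + norm x ^ q))"
    proof (intro add_mono mult_mono mult_left_mono)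
      show "1 + norm x powr \<alpha>1 + norm (0 :: real^'d) powr \<alpha>1 \<le> 2 * (1 + norm x ^ q)" 
      proof -
        have "1 + norm x powr \<alpha>1 + norm (0 :: real^'d) powr \<alpha>1 = 1 + norm x powr \<alpha>1" by simp
        also have "\<dots> \<le> 1 + (1 + norm x ^ q)" using powr_le by (intro add_left_mono)
        also have "\<dots> \<le> 2 * (1 + norm x ^ q)" by simp
        finally show ?thesis .
      qed
      have "1 * 1 \<le> (1 + norm x) * (1 + norm x ^ q)" by (intro mult_mono) auto
      then show "Lb4 \<le> Lb4 * ((1 + norm x) * (1 + norm x ^ q))"
        using mult_left_mono[of 1 "(1 + norm x) * (1 + norm x ^ q)" Lb4] constants by simp
    qed (use constants in auto)
    also have "\<dots> = (2 * Lb1 + Lb4) * ((1 + norm x) * (1 + norm x ^ q))" by (simp add: algebra_simps)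
    also have "\<dots> \<le> L * ((1 + norm x) * (1 + norm x ^ q))"
      using L_ge by (intro mult_right_mono) auto
    finally show "norm (b x ?\<mu>) \<le> L * ((1 + norm x) * (1 + norm x ^ q))" .
    have "(L\<sigma>4 + L\<sigma>1) * (1 + norm x) \<le> L * (1 + norm x)"
      using L_ge by (intro mult_right_mono) auto
    then show "norm (\<sigma> x ?\<mu>) \<le> L * (1 + norm x)" using \<sigma>_growth[of x y] by linarith
    show "linear (grad_op \<sigma> x ?\<mu>)" using has_derivative_linear[OF grad] .
    have "norm (grad_op \<sigma> x ?\<mu> (\<sigma> x ?\<mu> *v w)) \<le> L\<sigma>1 * norm (\<sigma> x ?\<mu> *v w)" by (rule grad_bound)
    also have "\<dots> \<le> L\<sigma>1 * (((L\<sigma>4 + L\<sigma>1) * (1 + norm x)) * norm w)"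
      using constants by (intro mult_left_mono order_trans[OF norm_matrix_vector_mult_le] mult_right_mono \<sigma>_growth) auto
    also have "\<dots> = (L\<sigma>1 * (L\<sigma>4 + L\<sigma>1)) * (1 + norm x) * norm w" by (simp only: mult.assoc)
    also have "\<dots> \<le> L * (1 + norm x) * norm w"
      using L_ge by (intro mult_right_mono) auto
    finally show "norm (grad_op \<sigma> x ?\<mu> (\<sigma> x ?\<mu> *v w)) \<le> L * (1 + norm x) * norm w" .
    have "linear (\<lambda>w. DL_op P \<sigma> x ?\<mu> z (\<sigma> z ?\<mu> *v w))"
      using linear_compose[OF matrix_vector_mul_linear linear_DL_op] by (simp add: comp_def)
    then have "norm (DL_op P \<sigma> x ?\<mu> z (\<sigma> z ?\<mu> *v w)) \<le> hs_norm (\<lambda>w. DL_op P \<sigma> x ?\<mu> z (\<sigma> z ?\<mu> *v w)) * norm w"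
      by (rule norm_linear_le_hs_norm)
    also have "\<dots> \<le> L * norm w"
    proof (rule mult_right_mono)
      have "hs_norm (\<lambda>w. DL_op P \<sigma> x ?\<mu> z (\<sigma> z ?\<mu> *v w)) \<le> L\<sigma>4"
        using v[OF emp[of y], of x z] norm_ge_zero[of "\<sigma> 0 ?\<mu>"] by linarith
      then show "hs_norm (\<lambda>w. DL_op P \<sigma> x ?\<mu> z (\<sigma> z ?\<mu> *v w)) \<le> L"
        using L_ge(6) by simp
    qed simp
    finally show "norm (DL_op P \<sigma> x ?\<mu> z (\<sigma> z ?\<mu> *v w)) \<le> L * norm w" .
  qed
  define k where "k = nat \<lceil>p\<rceil>"
  have k: "p \<le> real k" "k \<ge> 1" using p real_nat_ceiling_ge[of p] by (auto simp: k_def) linarith+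
  obtain D where D: "D \<ge> 0" "\<forall>M Y n i. 1 \<le> M \<longrightarrow> scheme M Y \<longrightarrow> n \<le> M \<longrightarrow> i \<in> {1..N} \<longrightarrow>
      expectation (\<lambda>\<omega>. (1 + (norm (Y i n \<omega>))\<^sup>2) ^ k) \<le> D"
    by (rule scheme_moment_bound[OF k(2) q(2)]) (rule that)
  have le: "norm x powr p \<le> (1 + (norm x)\<^sup>2) ^ k" for x :: "real^'d"
  proof -
    have "norm x powr p \<le> (1 + (norm x)\<^sup>2) powr p"
      using power_le_one_add_power[of "norm x" 1 2] p by (intro powr_mono2) auto
    also have "\<dots> \<le> (1 + (norm x)\<^sup>2) powr real k" using k by (intro powr_mono) auto
    also have "\<dots> = (1 + (norm x)\<^sup>2) ^ k" by (intro powr_realpow add_pos_nonneg) auto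
    finally show ?thesis .
  qed
  show ?thesis
  \<comment> \<open>D is only known to be nonnegative, while the constant has to be
    positive.\<close>
  proof (intro exI[of _ "D + 1"] conjI allI impI)
    show "D + 1 > 0" using D(1) by simp
    fix M Y assume M: "1 \<le> M" and Y: "scheme M Y"
    show "(SUP i\<in>{1..N}. SUP n\<in>{0..M}. \<integral>\<^sup>+\<omega>. ennreal (norm (Y i n \<omega>) powr p) \<partial>P) \<le> ennreal (D + 1)"
    proof (intro SUP_least)
      fix i n assume i: "i \<in> {1..N}" and n: "n \<in> {0..M}"
      have "(\<integral>\<^sup>+\<omega>. ennreal (norm (Y i n \<omega>) powr p) \<partial>P) \<le> (\<integral>\<^sup>+\<omega>. ennreal ((1 + (norm (Y i n \<omega>))\<^sup>2) ^ k) \<partial>P)"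
        by (intro nn_integral_mono ennreal_leI le)
      also have "\<dots> = ennreal (expectation (\<lambda>\<omega>. (1 + (norm (Y i n \<omega>))\<^sup>2) ^ k))"
        using scheme_integrable[OF M Y _ i, of n 1 k] n by (intro nn_integral_eq_integral) auto
      also have "\<dots> \<le> ennreal (D + 1)"
        using D(2)[rule_format, OF M Y _ i, of n] n by (intro ennreal_leI) auto
      finally show "(\<integral>\<^sup>+\<omega>. ennreal (norm (Y i n \<omega>) powr p) \<partial>P) \<le> ennreal (D + 1)" .
    qed
  qed
qed

end
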